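(* Let $\varphi:\mathbb{R}\to\mathbb{R}$ be a Borel measurable function. Assume that $a_G\le a_F$ and $F\{a_F\}=0$, that $F$ is continuous, and that (i) $\int \frac{\varphi^2}{G}\,dF<\infty$ and (ii) $\int\frac{dF}{G}<\infty$. Then $$n^{1/2}\int\varphi\,[dF_n-dF]\to\mathcal{N}(0,\sigma^2)\quad\text{in distribution as } n\to\infty,$$ with $$\sigma^2=\operatorname{Var}\left\{\frac{\psi(X)}{C(X)}-\int_Y^X\frac{\psi(y)}{C^2(y)}\,F^*(dy)\right\},$$ where $(X,Y)$ is distributed as an observed pair, i.e. has joint distribution function $H^*$, and $$\psi(y)=\varphi(y)(1-F(y))-\int_{\{y<x\}}\frac{\varphi(x)(1-F(x))}{C(x)}\,F^*(dx)=\int_{\{y<x\}}[\varphi(y)-\varphi(x)]\,F(dx).$$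
   Context: Left-truncation model: $X$ and $Y$ are independent real random variables with distribution functions $F$ and $G$, and $\alpha:=\mathbb{P}(Y\le X)>0$. A pair is observed only when $Y\le X$; conditionally on the number $n$ of observed pairs, the observed data $(X_1,Y_1),\dots,(X_n,Y_n)$ are i.i.d. with joint distribution function $H^*(x,y)=\mathbb{P}(X\le x,Y\le y\mid Y\le X)=\alpha^{-1}\int_{(-\infty,x]}G(y\wedge z)\,F(dz)$. All stochastic statements refer to these i.i.d. data as $n\to\infty$. Notation: $F(z-)=\lim_{x\uparrow z}F(x)$; $F\{z\}=F(z)-F(z-)$ (similarly for other distribution functions); $a_G=\inf\{x:G(x)>0\}$, $a_F=\inf\{x:F(x)>0\}$. Further $$F^*(x)=\mathbb{P}(X\le x\mid Y\le X)=\alpha^{-1}\int_{(-\infty,x]}G(z)\,F(dz),\qquad C(z)=\mathbb{P}(Y\le z\le X\mid Y\le X)=\alpha^{-1}G(z)[1-F(z-)],$$ $$F_n^*(x)=\frac1n\sum_{i=1}^n\mathbf 1_{\{X_i\le x\}},\qquad C_n(z)=\frac1n\sum_{i=1}^n\mathbf 1_{\{Y_i\le z\le X_i\}}.$$ The Lynden-Bell estimator $F_n$ of $F$ is defined by $$1-F_n(x)=\prod_{\text{distinct }X_i\le x}\left[1-\frac{F_n^*\{X_i\}}{C_n(X_i)}\right],$$ the product running over the distinct values among the observed $X_i$ that are $\le x$; $\int\varphi\,dF_n$ is the corresponding finite sum $\sum\varphi(x)F_n\{x\}$ over the distinct observed values $x$. *)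

theory Defs
  imports "HOL-Probability.Probability"
begin

definition jump :: "(real \<Rightarrow> real) \<Rightarrow> real \<Rightarrow> real" where
  "jump F z = F z - Lim (at_left z) F"

text \<open>An extended real: a distribution whose support is unbounded below has left endpoint
  \<open>-\<infinity>\<close>.\<close>

definition left_endpoint :: "(real \<Rightarrow> real) \<Rightarrow> ereal" where
  "left_endpoint F = Inf (ereal ` {x. F x > 0})"

text \<open>For \<open>v = 0\<close> this is the point mass at \<open>0\<close>.\<close>

definition centred_normal :: "real \<Rightarrow> real measure" where
  "centred_normal v = distr std_normal_distribution borel (\<lambda>z. sqrt v * z)"

text \<open>The conditional probability given \<open>Y \<le> X\<close>. The law of \<open>(X, Y)\<close> under this measure
  is the law of an observed pair.\<close>

definition observed :: "'a measure \<Rightarrow> ('a \<Rightarrow> real) \<Rightarrow> ('a \<Rightarrow> real) \<Rightarrow> 'a measure" where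
  "observed M X Y = uniform_measure M {\<omega> \<in> space M. Y \<omega> \<le> X \<omega>}"

definition H_star :: "'a measure \<Rightarrow> ('a \<Rightarrow> real) \<Rightarrow> ('a \<Rightarrow> real) \<Rightarrow> real \<Rightarrow> real \<Rightarrow> real" where
  "H_star M X Y x y = measure (observed M X Y) {\<omega> \<in> space M. X \<omega> \<le> x \<and> Y \<omega> \<le> y}"

text \<open>The probability measure on the line whose distribution function is \<open>F\<^sup>*\<close>.\<close>

definition F_star :: "'a measure \<Rightarrow> ('a \<Rightarrow> real) \<Rightarrow> ('a \<Rightarrow> real) \<Rightarrow> real measure" where
  "F_star M X Y = distr (observed M X Y) borel X"

definition C_fun :: "'a measure \<Rightarrow> ('a \<Rightarrow> real) \<Rightarrow> ('a \<Rightarrow> real) \<Rightarrow> real \<Rightarrow> real" where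
  "C_fun M X Y z = measure (observed M X Y) {\<omega> \<in> space M. Y \<omega> \<le> z \<and> z \<le> X \<omega>}"

definition psi ::
  "'a measure \<Rightarrow> ('a \<Rightarrow> real) \<Rightarrow> ('a \<Rightarrow> real) \<Rightarrow> (real \<Rightarrow> real) \<Rightarrow> real \<Rightarrow> real" where
  "psi M X Y \<phi> y =
     \<phi> y * (1 - cdf (distr M borel X) y)
     - (LINT x:{y<..}|F_star M X Y. \<phi> x * (1 - cdf (distr M borel X) x) / C_fun M X Y x)"

text \<open>The random variable whose variance under \<^term>\<open>observed M X Y\<close> is \<open>\<sigma>\<^sup>2\<close>.\<close>

definition influence ::
  "'a measure \<Rightarrow> ('a \<Rightarrow> real) \<Rightarrow> ('a \<Rightarrow> real) \<Rightarrow> (real \<Rightarrow> real) \<Rightarrow> 'a \<Rightarrow> real" where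
  "influence M X Y \<phi> \<omega> =
     psi M X Y \<phi> (X \<omega>) / C_fun M X Y (X \<omega>)
     - (LINT y:{Y \<omega>..X \<omega>}|F_star M X Y. psi M X Y \<phi> y / (C_fun M X Y y)\<^sup>2)"

text \<open>The sample of size \<open>n\<close> is \<open>(xs i, ys i)\<close> for \<open>i < n\<close>.\<close>

definition Fn_star :: "nat \<Rightarrow> (nat \<Rightarrow> real) \<Rightarrow> real \<Rightarrow> real" where
  "Fn_star n xs x = real (card {i. i < n \<and> xs i \<le> x}) / real n"

definition Cn :: "nat \<Rightarrow> (nat \<Rightarrow> real) \<Rightarrow> (nat \<Rightarrow> real) \<Rightarrow> real \<Rightarrow> real" where
  "Cn n xs ys z = real (card {i. i < n \<and> ys i \<le> z \<and> z \<le> xs i}) / real n"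

definition lynden_bell :: "nat \<Rightarrow> (nat \<Rightarrow> real) \<Rightarrow> (nat \<Rightarrow> real) \<Rightarrow> real \<Rightarrow> real" where
  "lynden_bell n xs ys x =
     1 - (\<Prod>a \<in> {a \<in> xs ` {..<n}. a \<le> x}. 1 - jump (Fn_star n xs) a / Cn n xs ys a)"

definition lynden_bell_integral ::
  "(real \<Rightarrow> real) \<Rightarrow> nat \<Rightarrow> (nat \<Rightarrow> real) \<Rightarrow> (nat \<Rightarrow> real) \<Rightarrow> real" where
  "lynden_bell_integral \<phi> n xs ys =
     (\<Sum>a \<in> xs ` {..<n}. \<phi> a * jump (lynden_bell n xs ys) a)"

end

theory Submission
  imports Defs
begin

text \<open>
  Let \<open>S = 1 - F\<close>, let \<open>d\<Lambda> = dF / S\<close>, let \<open>S\<^sub>n\<close> be the Lynden-Bell estimate of \<open>S\<close>, and let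
  \<open>R = n C\<^sub>n\<close> be the number at risk. Given its entry time \<open>Y\<^sub>i\<close>, an observed lifetime \<open>X\<^sub>i\<close> follows \<open>F\<close>
  restricted to \<open>[Y\<^sub>i, \<infinity>)\<close>, so its hazard is \<open>d\<Lambda>\<close> from \<open>Y\<^sub>i\<close> on. Hence for every integrand \<open>k\<close>
  which at time \<open>z\<close> uses only the entry times and the deaths before \<open>z\<close>, the compensated sum
  \<open>\<Sum>i. k (X\<^sub>i) - \<integral> k R d\<Lambda>\<close> has mean zero, and its second moment is at most \<open>E \<integral> k\<^sup>2 R d\<Lambda>\<close>. These two
  martingale properties are proved by resampling one observation at a time (\<open>nn_integral_compensator_sum\<close>, \<open>integral_mart\<close>, \<open>mart_second_moment\<close>).

  Duhamel's equation (\<open>duhamel\<close>) writes \<open>\<integral> \<phi> dF\<^sub>n - \<integral> \<phi> dF\<close> as the integral of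
  \<open>\<psi>(z) S\<^sub>n(z-) / S(z)\<close> against \<open>d(\<Lambda>\<^sub>n - \<Lambda>)\<close>. Replacing \<open>S\<^sub>n(z-) / (S(z) C\<^sub>n(z))\<close> by \<open>1 / C(z)\<close> turns
  this into the mean of the influence function over the sample, to which the central limit theorem
  applies. What is left over has two parts (\<open>expansion\<close>). One is a compensated sum with integrand
  \<open>\<psi> (S\<^sub>n(z-) / (S C\<^sub>n) - 1/C)\<close>. The other is an integral over the times before the first entry: at any
  later time with nobody at risk the estimate \<open>S\<^sub>n\<close> has already dropped to zero (\<open>B_hole\<close>), so such holes
  contribute nothing.

  The first part is handled by its second moment, \<open>\<integral> \<psi>\<^sup>2 E[(S\<^sub>n(z-) / (S C\<^sub>n) - 1/C)\<^sup>2 C\<^sub>n] d\<Lambda>\<close>, and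
  dominated convergence. Pointwise convergence is consistency of \<open>S\<^sub>n\<close> (\<open>consistency\<close>). The dominating
  function is a constant times \<open>\<psi>\<^sup>2 / C\<close>, because \<open>S\<^sub>n\<^sup>2 / (S R)\<close> is bounded in mean by a supermartingale
  argument (\<open>supermartingale_bound\<close>). The bound is uniform in \<open>z\<close>, up to both
  end points. Finally \<open>\<integral> \<psi>\<^sup>2 / C d\<Lambda>\<close> is finite (\<open>finite_information\<close>): near the left end by
  \<open>\<integral> dF / G < \<infinity>\<close>, and near the right end by Hardy's inequality. The second part is negligible because
  \<open>\<surd>n (1 - C)\<^sup>n \<le> 1 / \<surd>C\<close>.\<close>

section \<open>The truncated pair\<close>

lemma observable_set[measurable]: "{p::real \<times> real. snd p \<le> fst p} \<in> sets (borel \<Otimes>\<^sub>M borel)"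
  using borel_measurable_le[of snd "borel \<Otimes>\<^sub>M borel :: (real \<times> real) measure" fst]
  by (simp add: space_pair_measure)

text \<open>The laws of the lifetime \<open>X\<close> and of the entry time \<open>Y\<close> before truncation are \<open>\<mu>\<close> and \<open>\<nu>\<close>.
Continuity of the distribution function of \<open>X\<close> is the absence of atoms of \<open>\<mu>\<close>.\<close>

locale left_truncation = \<mu>: real_distribution \<mu> + \<nu>: real_distribution \<nu>
  for \<mu> \<nu> :: "real measure" +
  assumes no_atoms: "measure \<mu> {x} = 0"
    and observable: "measure (\<mu> \<Otimes>\<^sub>M \<nu>) {p. snd p \<le> fst p} > 0"
begin

sublocale \<mu>\<nu>: pair_prob_space \<mu> \<nu> ..

definition S :: "real \<Rightarrow> real" where "S x = measure \<mu> {x..}"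
definition G :: "real \<Rightarrow> real" where "G = cdf \<nu>"
definition \<alpha> :: real where "\<alpha> = measure (\<mu> \<Otimes>\<^sub>M \<nu>) {p. snd p \<le> fst p}"

text \<open>This is the function \<open>C\<close> of the model; \<open>C_eq_prob\<close> below identifies it with the probability that an observed pair
is at risk at time \<open>z\<close>.\<close>

definition C :: "real \<Rightarrow> real" where "C z = G z * S z / \<alpha>"

text \<open>The law of an observed pair: \<open>X\<close> and \<open>Y\<close> are independent, and the pair is kept if \<open>Y \<le> X\<close>.\<close>

definition H :: "(real \<times> real) measure" where
  "H = density (\<mu> \<Otimes>\<^sub>M \<nu>) (\<lambda>p. ennreal (indicator {p. snd p \<le> fst p} p / \<alpha>))"

lemma \<alpha>_pos: "\<alpha> > 0"
  using observable by (simp add: \<alpha>_def)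

lemma S_conv: "S x = 1 - cdf \<mu> x"
proof -
  have "measure \<mu> {x..} = measure \<mu> {x} + measure \<mu> {x<..}"
    by (subst \<mu>.finite_measure_Union[symmetric]) (auto intro: arg_cong[where f = "measure \<mu>"])
  moreover have "measure \<mu> {x<..} = 1 - measure \<mu> {..x}"
    using \<mu>.prob_compl[of "{..x}"] by (simp add: Compl_eq_Diff_UNIV[symmetric] not_le Collect_neg_eq[symmetric])
  ultimately show ?thesis by (simp add: S_def cdf_def no_atoms)
qed

lemma S_nonneg: "0 \<le> S x" and S_le_1: "S x \<le> 1"
  by (simp_all add: S_def)

lemma S_antimono: "x \<le> y \<Longrightarrow> S y \<le> S x"
  unfolding S_def by (rule \<mu>.finite_measure_mono) auto

lemma borel_measurable_S[measurable]: "S \<in> borel_measurable borel"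
proof -
  have "(\<lambda>x. - S x) \<in> borel_measurable borel"
    by (rule borel_measurable_mono) (auto simp: mono_def S_antimono)
  then show ?thesis by simp
qed

lemma G_nonneg: "0 \<le> G x" and G_le_1: "G x \<le> 1"
  by (simp_all add: G_def cdf_def)

lemma G_mono: "x \<le> y \<Longrightarrow> G x \<le> G y"
  unfolding G_def by (rule \<nu>.cdf_nondecreasing)

lemma borel_measurable_G[measurable]: "G \<in> borel_measurable borel"
  by (rule borel_measurable_mono) (auto simp: mono_def G_mono)

lemma C_nonneg: "0 \<le> C x"
  using \<alpha>_pos by (simp add: C_def G_nonneg S_nonneg)

lemma borel_measurable_C[measurable]: "C \<in> borel_measurable borel"
  unfolding C_def[abs_def] by measurable

lemma continuous_S: "isCont S x"
proof -
  have "isCont (cdf \<mu>) x"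
    using \<mu>.isCont_cdf no_atoms by blast
  then show ?thesis unfolding S_conv[abs_def] by simp
qed

lemma AE_neq: "AE x in \<mu>. x \<noteq> c"
proof (rule AE_I)
  show "{x \<in> space \<mu>. \<not> x \<noteq> c} \<subseteq> {c}" "{c} \<in> sets \<mu>" by auto
  show "emeasure \<mu> {c} = 0" by (simp add: \<mu>.emeasure_eq_measure no_atoms)
qed

subsection \<open>Calculus with a continuous survival function\<close>

text \<open>The probability integral transform. The set where \<open>S \<le> t\<close> is a closed half-line starting at its
infimum \<open>b\<close>, and continuity forces \<open>S b = t\<close>.\<close>

lemma measure_S_le:
  assumes "0 \<le> t" "t \<le> 1"
  shows "measure \<mu> {x. S x \<le> t} = t"
proof (cases "t = 1")
  case True
  have "{x. S x \<le> 1} = UNIV" by (auto simp: S_le_1)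
  with True show ?thesis using \<mu>.prob_space by simp
next
  case False
  with assms have t: "t < 1" by simp
  show ?thesis
  proof (cases "{x. S x \<le> t} = {}")
    case True
    have "t = 0"
    proof (rule ccontr)
      assume "t \<noteq> 0"
      with assms have "t > 0" by simp
      have "(cdf \<mu> \<longlongrightarrow> 1) at_top" by (rule \<mu>.cdf_lim_at_top_prob)
      then have "eventually (\<lambda>x. cdf \<mu> x > 1 - t) at_top"
        by (rule order_tendstoD) (use \<open>t > 0\<close> in simp)
      then obtain x where "cdf \<mu> x > 1 - t" using eventually_happens'[of at_top] by force
      with True show False using S_conv[of x] by (metis (mono_tags, lifting) diff_le_eq empty_Collect_eq
          le_diff_eq less_eq_real_def add.commute)
    qed
    with True show ?thesis by simp
  next
    case ne: False
    have "(cdf \<mu> \<longlongrightarrow> 0) at_bot" by (rule \<mu>.cdf_lim_at_bot)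
    then have "eventually (\<lambda>x. cdf \<mu> x < 1 - t) at_bot"
      by (rule order_tendstoD) (use t in simp)
    then obtain l where l: "cdf \<mu> l < 1 - t" using eventually_happens'[of at_bot] by force
    have bdd: "bdd_below {x. S x \<le> t}"
    proof (rule bdd_belowI)
      fix x assume "x \<in> {x. S x \<le> t}"
      then show "l \<le> x" using S_antimono[of x l] l S_conv[of l] by force
    qed
    have "closed {x. S x \<le> t}"
      by (rule closed_Collect_le) (auto simp: continuous_S continuous_at_imp_continuous_on)
    define b where "b = Inf {x. S x \<le> t}"
    have b: "S b \<le> t"
      using closed_contains_Inf[OF ne bdd \<open>closed _\<close>] by (simp add: b_def)
    have below: "S x > t" if "x < b" for x
      using that cInf_lower[OF _ bdd, of x] unfolding b_def by force
    have eq: "{x. S x \<le> t} = {b..}"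
      using below b S_antimono[of b] by (force simp: not_less[symmetric])
    have "t \<le> S b"
    proof (rule tendsto_lowerbound)
      show "(S \<longlongrightarrow> S b) (at_left b)"
        using continuous_S[of b] by (simp add: isCont_def filterlim_at_split)
      show "eventually (\<lambda>x. t \<le> S x) (at_left b)"
        by (auto simp: eventually_at_filter intro!: always_eventually less_imp_le below)
    qed simp
    with b have "measure \<mu> {b..} = t" by (simp add: S_def)
    then show ?thesis unfolding eq .
  qed
qed

text \<open>Since \<^term>\<open>\<mu>\<close> has no atoms, \<^term>\<open>S\<close> is uniformly distributed on the unit interval,
  so integrals of functions of \<^term>\<open>S\<close> are ordinary integrals.\<close>

lemma nn_integral_S:
  assumes [measurable]: "g \<in> borel_measurable borel"
  shows "(\<integral>\<^sup>+x. g (S x) \<partial>\<mu>) = (\<integral>\<^sup>+t. indicator {0..1} t * g t \<partial>lborel)"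
proof -
  have D: "distributed \<mu> lborel S (\<lambda>x. ennreal (indicator {0..1} x))"
    using \<mu>.uniform_distrI_borel_atLeastAtMost[of S 0 1] by (simp add: measure_S_le)
  have "(\<integral>\<^sup>+x. g (S x) \<partial>\<mu>) = (\<integral>\<^sup>+t. ennreal (indicator {0..1} t) * g t \<partial>lborel)"
    by (rule distributed_nn_integral[OF D, symmetric]) auto
  then show ?thesis by (simp add: ennreal_indicator)
qed

lemma AE_S_neq: "AE x in \<mu>. S x \<noteq> t"
proof -
  have "(\<integral>\<^sup>+x. indicator {t} (S x) \<partial>\<mu>) = (\<integral>\<^sup>+s. indicator {0..1} s * indicator {t} s \<partial>lborel)"
    by (rule nn_integral_S) auto
  also have "\<dots> = 0"
    by (subst nn_integral_0_iff_AE, simp, use AE_lborel_singleton[of t] in eventually_elim)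
       (auto split: split_indicator)
  finally have "AE x in \<mu>. indicator {t} (S x) = (0::ennreal)"
    by (subst (asm) nn_integral_0_iff_AE) auto
  then show ?thesis by eventually_elim (auto split: split_indicator_asm)
qed

lemma AE_S_pos: "AE x in \<mu>. S x > 0"
  using AE_S_neq[of 0] by eventually_elim (simp add: order.not_eq_order_implies_strict S_nonneg)

lemma AE_less_iff_S: "AE x in \<mu>. x < b \<longleftrightarrow> S b < S x"
  using AE_S_neq[of "S b"] by eventually_elim (metis S_antimono less_eq_real_def not_le order_less_irrefl)

text \<open>Since \<open>d(1/S) = dF / S\<^sup>2\<close>, the function \<open>1/S\<close> grows by these integrals. They are what makes \<open>1/S\<close>
compensate the jumps of the product-limit estimator.\<close>

lemma nn_integral_inverse_S_squared_level:
  assumes "0 < s" "s \<le> t" "t \<le> 1"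
  shows "(\<integral>\<^sup>+u. indicator {s<..t} (S u) * ennreal (1 / (S u)\<^sup>2) \<partial>\<mu>) = ennreal (1 / s - 1 / t)"
proof -
  have "(\<integral>\<^sup>+u. indicator {s<..t} (S u) * ennreal (1 / (S u)\<^sup>2) \<partial>\<mu>)
      = (\<integral>\<^sup>+v. indicator {0..1} v * (indicator {s<..t} v * ennreal (1 / v\<^sup>2)) \<partial>lborel)"
    by (rule nn_integral_S) auto
  also have "\<dots> = (\<integral>\<^sup>+v. ennreal (1 / v\<^sup>2) * indicator {s..t} v \<partial>lborel)"
    by (intro nn_integral_cong_AE, use AE_lborel_singleton[of s] in eventually_elim)
       (use assms in \<open>auto split: split_indicator\<close>)
  also have "\<dots> = ennreal (- 1 / t - (- 1 / s))"
  proof (rule nn_integral_FTC_Icc[where F = "\<lambda>v. -1/v"])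
    fix v assume "v \<in> {s..t}"
    with assms have "v > 0" by auto
    then show "((\<lambda>v. - 1 / v) has_real_derivative 1 / v\<^sup>2) (at v)"
      by (auto intro!: derivative_eq_intros simp: power2_eq_square)
  qed (use assms in auto)
  finally show ?thesis by simp
qed

lemma nn_integral_inverse_S_squared:
  assumes "a \<le> b" "S b > 0"
  shows "(\<integral>\<^sup>+u. indicator {a..<b} u * ennreal (1 / (S u)\<^sup>2) \<partial>\<mu>) = ennreal (1 / S b - 1 / S a)"
proof -
  have "(\<integral>\<^sup>+u. indicator {a..<b} u * ennreal (1 / (S u)\<^sup>2) \<partial>\<mu>)
      = (\<integral>\<^sup>+u. indicator {S b<..S a} (S u) * ennreal (1 / (S u)\<^sup>2) \<partial>\<mu>)"
    by (intro nn_integral_cong_AE, use AE_less_iff_S[of a] AE_less_iff_S[of b] in eventually_elim)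
       (auto split: split_indicator)
  then show ?thesis
    using nn_integral_inverse_S_squared_level[of "S b" "S a"] assms S_antimono S_le_1 by simp
qed

lemma nn_integral_inverse_S_squared_below:
  assumes "S b > 0"
  shows "(\<integral>\<^sup>+u. indicator {..<b} u * ennreal (1 / (S u)\<^sup>2) \<partial>\<mu>) = ennreal (1 / S b - 1)"
proof -
  have "(\<integral>\<^sup>+u. indicator {..<b} u * ennreal (1 / (S u)\<^sup>2) \<partial>\<mu>)
      = (\<integral>\<^sup>+u. indicator {S b<..1} (S u) * ennreal (1 / (S u)\<^sup>2) \<partial>\<mu>)"
    by (intro nn_integral_cong_AE, use AE_less_iff_S[of b] in eventually_elim)
       (auto split: split_indicator simp: S_le_1)
  then show ?thesis
    using nn_integral_inverse_S_squared_level[of "S b" 1] assms S_le_1 by simp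
qed

text \<open>The next two integrals are the ones needed for the Schur test behind Hardy's inequality.\<close>

lemma nn_integral_S_powr_above:
  "(\<integral>\<^sup>+u. indicator {z..} u * ennreal (S u powr (-1/2)) \<partial>\<mu>) = ennreal (2 * S z powr (1/2))"
proof -
  have "(\<integral>\<^sup>+u. indicator {z..} u * ennreal (S u powr (-1/2)) \<partial>\<mu>)
      = (\<integral>\<^sup>+u. indicator {..S z} (S u) * ennreal (S u powr (-1/2)) \<partial>\<mu>)"
    by (intro nn_integral_cong_AE, use AE_less_iff_S[of z] in eventually_elim)
       (auto split: split_indicator)
  also have "\<dots> = (\<integral>\<^sup>+t. indicator {0..1} t * (indicator {..S z} t * ennreal (t powr (-1/2))) \<partial>lborel)"
    by (rule nn_integral_S) auto
  also have "\<dots> = (\<integral>\<^sup>+t. indicator {0..S z} t * ennreal (t powr (-1/2)) \<partial>lborel)"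
    by (intro nn_integral_cong) (auto split: split_indicator simp: order_trans[OF _ S_le_1])
  also have "\<dots> = ennreal (S z powr (-1/2 + 1) / (-1/2 + 1))"
    using nn_integral_has_integral_lebesgue[OF _ has_integral_powr_from_0[of "-1/2" "S z"]] S_nonneg
    by (simp add: indicator_mult_ennreal)
  finally show ?thesis by simp
qed

lemma nn_integral_S_powr_below:
  assumes "S x > 0"
  shows "(\<integral>\<^sup>+u. indicator {..<x} u * ennreal (S u powr (-3/2)) \<partial>\<mu>) \<le> ennreal (2 * S x powr (-1/2))"
proof -
  have "(\<integral>\<^sup>+u. indicator {..<x} u * ennreal (S u powr (-3/2)) \<partial>\<mu>)
      = (\<integral>\<^sup>+u. indicator {S x<..} (S u) * ennreal (S u powr (-3/2)) \<partial>\<mu>)"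
    by (intro nn_integral_cong_AE, use AE_less_iff_S[of x] in eventually_elim)
       (auto split: split_indicator)
  also have "\<dots> = (\<integral>\<^sup>+t. indicator {0..1} t * (indicator {S x<..} t * ennreal (t powr (-3/2))) \<partial>lborel)"
    by (rule nn_integral_S) auto
  also have "\<dots> \<le> (\<integral>\<^sup>+t. ennreal (t powr (-3/2)) * indicator {S x..1} t \<partial>lborel)"
    by (intro nn_integral_mono) (auto split: split_indicator)
  also have "\<dots> = ennreal (- 2 * 1 powr (-1/2) - (- 2 * S x powr (-1/2)))"
  proof (rule nn_integral_FTC_Icc[where F = "\<lambda>t. -2 * t powr (-1/2)"])
    fix t assume "t \<in> {S x..1}"
    with assms have "t > 0" by auto
    then show "((\<lambda>t. - 2 * t powr (-1/2)) has_real_derivative t powr (-3/2)) (at t)"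
      by (auto intro!: derivative_eq_intros)
  qed (use S_le_1 in auto)
  also have "\<dots> \<le> ennreal (2 * S x powr (-1/2))"
    by (rule ennreal_leI) simp
  finally show ?thesis .
qed

end

section \<open>Counting-process integrals over the sample\<close>

type_synonym sample = "nat \<Rightarrow> real \<times> real"

text \<open>A sample assigns to each index the pair (lifetime, entry time).\<close>

definition obsX :: "sample \<Rightarrow> nat \<Rightarrow> real" where "obsX d i = fst (d i)"
definition obsY :: "sample \<Rightarrow> nat \<Rightarrow> real" where "obsY d i = snd (d i)"

lemma obs_upd[simp]:
  "obsX (d(i := p)) i = fst p" "obsY (d(i := p)) i = snd p"
  "j \<noteq> i \<Longrightarrow> obsX (d(i := p)) j = obsX d j" "j \<noteq> i \<Longrightarrow> obsY (d(i := p)) j = obsY d j"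
  by (auto simp: obsX_def obsY_def)

text \<open>The size of the risk set, \<open>n C\<^sub>n(z)\<close>.\<close>

definition risk :: "nat \<Rightarrow> sample \<Rightarrow> real \<Rightarrow> real" where
  "risk n d z = (\<Sum>i<n. if obsY d i \<le> z \<and> z \<le> obsX d i then 1 else 0)"

text \<open>What is known just before time \<open>z\<close>: all entry times, and for every individual either the time of its
death or the fact that it survives to \<open>z\<close>. Treating all entry times as known from the start is
legitimate because the hazard of a lifetime given its entry time does not depend on the other entries.\<close>

definition agree :: "nat \<Rightarrow> real \<Rightarrow> sample \<Rightarrow> sample \<Rightarrow> bool" where
  "agree n z d d' \<longleftrightarrow> (\<forall>i<n. obsY d i = obsY d' i \<and>
     (obsX d i = obsX d' i \<or> z \<le> obsX d i \<and> z \<le> obsX d' i))"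

text \<open>Predictable integrands use only what is known before the current time. Invariance under
\<open>agree\<close> plays the role of measurability with respect to a filtration.\<close>

definition predictable :: "nat \<Rightarrow> (real \<Rightarrow> sample \<Rightarrow> 'b) \<Rightarrow> bool" where
  "predictable n k \<longleftrightarrow> (\<forall>z d d'. agree n z d d' \<longrightarrow> k z d = k z d')"

lemma agree_mono: "agree n z d d' \<Longrightarrow> u \<le> z \<Longrightarrow> agree n u d d'"
  unfolding agree_def by (meson order_trans)

lemma predictableD: "predictable n k \<Longrightarrow> agree n z d d' \<Longrightarrow> k z d = k z d'"
  by (simp add: predictable_def)

lemma risk_agree: assumes "agree n z d d'" "u \<le> z" shows "risk n d u = risk n d' u"
  unfolding risk_def
proof (intro sum.cong refl)
  fix i assume "i \<in> {..<n}"
  then have "obsY d i = obsY d' i \<and> (obsX d i = obsX d' i \<or> z \<le> obsX d i \<and> z \<le> obsX d' i)"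
    using assms(1) by (auto simp: agree_def)
  then show "(if obsY d i \<le> u \<and> u \<le> obsX d i then 1 else 0) =
      (if obsY d' i \<le> u \<and> u \<le> obsX d' i then 1 else (0::real))"
    using assms(2) by force
qed

lemma risk_nonneg: "0 \<le> risk n d z"
  unfolding risk_def by (intro sum_nonneg) auto

lemma ennreal_risk: "ennreal (risk n d z) = (\<Sum>i<n. if obsY d i \<le> z \<and> z \<le> obsX d i then 1 else 0)"
proof -
  have "(\<Sum>i<n. if obsY d i \<le> z \<and> z \<le> obsX d i then 1 else 0)
      = (\<Sum>i<n. ennreal (if obsY d i \<le> z \<and> z \<le> obsX d i then 1 else 0))"
    by (intro sum.cong) auto
  also have "\<dots> = ennreal (risk n d z)" unfolding risk_def by (rule sum_ennreal) auto
  finally show ?thesis by simp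
qed

lemma risk_le: "risk n d z \<le> real n"
proof -
  have "risk n d z \<le> (\<Sum>i<n. 1)" unfolding risk_def by (intro sum_mono) auto
  then show ?thesis by simp
qed

text \<open>Integration by parts for the pure-jump function \<open>z \<mapsto> \<Sum> a\<^sub>j\<close> (over \<open>x\<^sub>j < z\<close>) minus the continuous
function \<open>z \<mapsto> \<integral> f\<close> (over \<open>u < z\<close>): its square is the sum of squared jumps plus twice the integral
of the function against its own increments. Continuous parts and distinct jump times produce no
further diagonal terms. In the application the second summand is again a compensated sum, hence has mean zero.\<close>

lemma square_of_compensated_sum:
  fixes x a :: "nat \<Rightarrow> real" and f :: "real \<Rightarrow> real"
  assumes "prob_space m" and sets_m[measurable_cong]: "sets m = sets borel"
    and atoms: "\<And>c. AE u in m. u \<noteq> c"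
    and inj: "inj_on x {..<n}" and f: "integrable m f"
  shows "((\<Sum>i<n. a i) - (\<integral>u. f u \<partial>m))\<^sup>2 = (\<Sum>i<n. (a i)\<^sup>2)
    + ((\<Sum>i<n. 2 * a i * ((\<Sum>j<n. if x j < x i then a j else 0) - (\<integral>u. (if u < x i then f u else 0) \<partial>m)))
      - (\<integral>z. 2 * f z * ((\<Sum>j<n. if x j < z then a j else 0) - (\<integral>u. (if u < z then f u else 0) \<partial>m)) \<partial>m))"
proof -
  interpret prob_space m by fact
  interpret pair_prob_space m m ..
  note [measurable] = borel_measurable_integrable[OF f]
  have int_lt: "integrable m (\<lambda>u. if u < c then f u else 0)"
    and int_gt: "integrable m (\<lambda>u. if c < u then f u else 0)" for c
    by (rule Bochner_Integration.integrable_bound[OF f]; auto)+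
  define If where "If = (\<integral>u. f u \<partial>m)"
  \<comment> \<open>The integral over the plane splits along the diagonal, which is a null set.\<close>
  define L where "L z = (\<integral>u. (if u < z then f u else 0) \<partial>m)" for z
  define U where "U z = (\<integral>u. (if z < u then f u else 0) \<partial>m)" for z
  have If_split: "If = L z + U z" for z
    unfolding If_def L_def U_def
    by (subst Bochner_Integration.integral_add[symmetric, OF int_lt int_gt], intro integral_cong_AE)
       (use atoms[of z] in \<open>auto elim!: eventually_mono\<close>)
  have pair: "integrable (m \<Otimes>\<^sub>M m) (\<lambda>p. f (fst p) * f (snd p))"
    by (rule Fubini_integrable) (auto intro!: integrable_mult_right integrable_mult_left integrable_norm f simp: abs_mult)
  have pair_lt: "integrable (m \<Otimes>\<^sub>M m) (\<lambda>(u, z). if u < z then f u * f z else 0)"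
    by (rule Bochner_Integration.integrable_bound[OF pair]) (auto simp: split_beta')
  have L_meas[measurable]: "L \<in> borel_measurable m"
    unfolding L_def[abs_def] by measurable
  have L_bound: "norm (L z) \<le> (\<integral>u. norm (f u) \<partial>m)" for z
    unfolding L_def by (rule order_trans[OF integral_norm_bound], rule integral_mono)
      (auto intro!: integrable_norm int_lt f)
  have int_fL: "integrable m (\<lambda>z. f z * L z)"
    by (rule Bochner_Integration.integrable_bound[OF integrable_mult_left[OF integrable_norm[OF f], of "\<integral>u. norm (f u) \<partial>m"]])
       (auto simp: abs_mult intro!: mult_left_mono order_trans[OF L_bound[unfolded real_norm_def]])
  have fU: "f z * U z = (\<integral>u. (if z < u then f z * f u else 0) \<partial>m)" for z
    unfolding U_def integral_mult_right_zero[symmetric]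
    by (intro Bochner_Integration.integral_cong) auto
  have fL: "f z * L z = (\<integral>u. (if u < z then f u * f z else 0) \<partial>m)" for z
    unfolding L_def integral_mult_right_zero[symmetric]
    by (intro Bochner_Integration.integral_cong) auto
  have "If * If = (\<integral>z. f z * If \<partial>m)" by (simp add: If_def)
  also have "\<dots> = (\<integral>z. f z * L z + f z * U z \<partial>m)"
    by (simp add: If_split[symmetric] distrib_left[symmetric])
  also have "\<dots> = (\<integral>z. f z * L z \<partial>m) + (\<integral>z. f z * U z \<partial>m)"
  proof (rule Bochner_Integration.integral_add[OF int_fL])
    have "integrable m (\<lambda>z. f z * If - f z * L z)" by (intro Bochner_Integration.integrable_diff integrable_mult_left f int_fL)
    moreover have "f z * U z = f z * If - f z * L z" for z
      using If_split[of z] by (simp add: algebra_simps)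
    ultimately show "integrable m (\<lambda>z. f z * U z)" by simp
  qed
  also have "(\<integral>z. f z * U z \<partial>m) = (\<integral>z. (\<integral>u. (if z < u then f z * f u else 0) \<partial>m) \<partial>m)"
    by (simp only: fU)
  also have "\<dots> = (\<integral>u. (\<integral>z. (if z < u then f z * f u else 0) \<partial>m) \<partial>m)"
    using Fubini_integral[OF pair_lt] by simp
  also have "\<dots> = (\<integral>u. f u * L u \<partial>m)"
    by (simp only: fL)
  finally have I2: "If * If = 2 * (\<integral>z. f z * L z \<partial>m)" by simp
  define T where "T = (\<Sum>i<n. \<Sum>j<n. if x j < x i then a i * a j else 0)"
  have sq: "(\<Sum>i<n. a i) * (\<Sum>i<n. a i) = (\<Sum>i<n. (a i)\<^sup>2) + 2 * T"
  proof -
    have "(\<Sum>i<n. a i) * (\<Sum>i<n. a i) = (\<Sum>i<n. \<Sum>j<n. a i * a j)"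
      by (simp add: sum_product)
    also have "\<dots> = (\<Sum>i<n. \<Sum>j<n. (if i = j then a i * a i else 0) + (if x j < x i then a i * a j else 0)
        + (if x i < x j then a i * a j else 0))"
      using inj by (intro sum.cong refl) (auto simp: inj_on_def not_less_iff_gr_or_eq linorder_neq_iff)
    also have "\<dots> = (\<Sum>i<n. \<Sum>j<n. if i = j then a i * a i else 0) + T
        + (\<Sum>i<n. \<Sum>j<n. if x i < x j then a i * a j else 0)"
      by (simp add: sum.distrib T_def)
    also have "(\<Sum>i<n. \<Sum>j<n. if x i < x j then a i * a j else 0) = T"
      unfolding T_def by (subst sum.swap) (auto intro!: sum.cong)
    finally show ?thesis by (simp add: sum.delta power2_eq_square)
  qed
  have cross: "(\<integral>z. f z * (\<Sum>j<n. if x j < z then a j else 0) \<partial>m) = (\<Sum>j<n. a j * U (x j))"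
  proof -
    have "(\<integral>z. f z * (\<Sum>j<n. if x j < z then a j else 0) \<partial>m) = (\<integral>z. (\<Sum>j<n. a j * (if x j < z then f z else 0)) \<partial>m)"
      by (intro Bochner_Integration.integral_cong refl) (auto simp: sum_distrib_left intro!: sum.cong)
    also have "\<dots> = (\<Sum>j<n. a j * U (x j))"
      unfolding U_def by (subst Bochner_Integration.integral_sum) (auto intro!: integrable_mult_right int_gt)
    finally show ?thesis .
  qed
  have int_fA: "integrable m (\<lambda>z. f z * (\<Sum>j<n. if x j < z then a j else 0))"
  proof -
    have "integrable m (\<lambda>z. (\<Sum>j<n. a j * (if x j < z then f z else 0)))"
      by (intro Bochner_Integration.integrable_sum integrable_mult_right int_gt)
    then show ?thesis by (rule back_subst[where P = "integrable m"]) (auto simp: fun_eq_iff sum_distrib_left intro!: sum.cong)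
  qed
  have "(\<integral>z. 2 * f z * ((\<Sum>j<n. if x j < z then a j else 0) - L z) \<partial>m)
      = (\<integral>z. 2 * (f z * (\<Sum>j<n. if x j < z then a j else 0)) - 2 * (f z * L z) \<partial>m)"
    by (simp add: algebra_simps)
  also have "\<dots> = 2 * (\<Sum>j<n. a j * U (x j)) - If * If"
    by (subst Bochner_Integration.integral_diff) (auto intro!: integrable_mult_right int_fA int_fL simp: cross I2)
  finally have part2: "(\<integral>z. 2 * f z * ((\<Sum>j<n. if x j < z then a j else 0) - L z) \<partial>m)
      = 2 * (\<Sum>j<n. a j * U (x j)) - If * If" .
  have part1: "(\<Sum>i<n. 2 * a i * ((\<Sum>j<n. if x j < x i then a j else 0) - L (x i))) =
      2 * T - 2 * (\<Sum>i<n. a i * L (x i))"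
    unfolding T_def sum_distrib_left sum_subtractf[symmetric]
    by (intro sum.cong refl) (simp add: algebra_simps sum_distrib_left if_distrib cong: if_cong)
  have mixed: "(\<Sum>i<n. a i) * If = (\<Sum>i<n. a i * L (x i)) + (\<Sum>i<n. a i * U (x i))"
    unfolding sum_distrib_right sum.distrib[symmetric]
    by (intro sum.cong refl) (simp only: If_split[symmetric] distrib_left[symmetric])
  have "((\<Sum>i<n. a i) - If)\<^sup>2 = (\<Sum>i<n. a i) * (\<Sum>i<n. a i) - 2 * ((\<Sum>i<n. a i) * If) + If * If"
    by (simp add: power2_eq_square algebra_simps)
  then show ?thesis
    unfolding L_def[symmetric] If_def[symmetric] part1 part2 sq mixed by simp
qed

context left_truncation
begin

lemma sets_H[measurable_cong]: "sets H = sets (borel \<Otimes>\<^sub>M borel)"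
  unfolding H_def by (simp cong: sets_pair_measure_cong)

lemma space_H[simp]: "space H = UNIV"
  using sets_eq_imp_space_eq[OF sets_H] by (simp add: space_pair_measure)

lemma nn_integral_H:
  assumes [measurable]: "f \<in> borel_measurable (borel \<Otimes>\<^sub>M borel)"
  shows "integral\<^sup>N H f = (\<integral>\<^sup>+y. \<integral>\<^sup>+x. (if y \<le> x then f (x, y) else 0) * ennreal (1 / \<alpha>) \<partial>\<mu> \<partial>\<nu>)"
proof -
  have "integral\<^sup>N H f = (\<integral>\<^sup>+p. ennreal (indicator {p. snd p \<le> fst p} p / \<alpha>) * f p \<partial>(\<mu> \<Otimes>\<^sub>M \<nu>))"
    unfolding H_def by (subst nn_integral_density) auto
  also have "\<dots> = (\<integral>\<^sup>+y. \<integral>\<^sup>+x. ennreal (indicator {p. snd p \<le> fst p} (x, y) / \<alpha>) * f (x, y) \<partial>\<mu> \<partial>\<nu>)"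
    by (subst \<mu>\<nu>.nn_integral_snd[symmetric]) (auto simp: split_beta')
  also have "\<dots> = (\<integral>\<^sup>+y. \<integral>\<^sup>+x. (if y \<le> x then f (x, y) else 0) * ennreal (1 / \<alpha>) \<partial>\<mu> \<partial>\<nu>)"
    by (intro nn_integral_cong) (auto split: split_indicator simp: mult.commute)
  finally show ?thesis .
qed

lemma prob_space_H: "prob_space H"
proof
  have "emeasure H (space H) = (\<integral>\<^sup>+p. ennreal (indicator {p. snd p \<le> fst p} p / \<alpha>) \<partial>(\<mu> \<Otimes>\<^sub>M \<nu>))"
  proof -
    have "emeasure H (space (\<mu> \<Otimes>\<^sub>M \<nu>)) = (\<integral>\<^sup>+p. ennreal (indicator {p. snd p \<le> fst p} p / \<alpha>)
        * indicator (space (\<mu> \<Otimes>\<^sub>M \<nu>)) p \<partial>(\<mu> \<Otimes>\<^sub>M \<nu>))"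
      unfolding H_def by (rule emeasure_density[OF _ sets.top]) measurable
    then show ?thesis by (simp add: space_pair_measure)
  qed
  also have "\<dots> = (\<integral>\<^sup>+p. ennreal (1 / \<alpha>) * indicator {p. snd p \<le> fst p} p \<partial>(\<mu> \<Otimes>\<^sub>M \<nu>))"
    by (intro nn_integral_cong) (auto split: split_indicator)
  also have "\<dots> = ennreal (1 / \<alpha>) * ennreal \<alpha>"
    by (subst nn_integral_cmult_indicator) (auto simp: \<alpha>_def \<mu>\<nu>.emeasure_eq_measure)
  also have "\<dots> = 1"
    using \<alpha>_pos by (subst ennreal_mult[symmetric]) auto
  finally show "emeasure H (space H) = 1" .
qed

sublocale H: prob_space H by (rule prob_space_H)

lemma nn_integral_S_above: "(\<integral>\<^sup>+x. (if z \<le> x then 1 else 0) \<partial>\<mu>) = ennreal (S z)"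
proof -
  have "(\<integral>\<^sup>+x. (if z \<le> x then 1 else 0) \<partial>\<mu>) = (\<integral>\<^sup>+x. indicator {z..} x \<partial>\<mu>)"
    by (intro nn_integral_cong) (auto split: split_indicator)
  then show ?thesis by (simp add: S_def \<mu>.emeasure_eq_measure)
qed

text \<open>The hazard of a single observed lifetime: given the entry time \<open>b\<close>, the lifetime has law \<open>\<mu>\<close> restricted
to \<open>[b, \<infinity>)\<close>. On the right-hand side the lifetime is integrated out first, and the factor
\<open>S z\<close> this produces cancels the denominator.\<close>

lemma nn_integral_compensator:
  assumes [measurable]: "(\<lambda>(z, b). \<kappa> z b) \<in> borel_measurable (borel \<Otimes>\<^sub>M borel)"
  shows "(\<integral>\<^sup>+p. \<kappa> (fst p) (snd p) \<partial>H) =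
    (\<integral>\<^sup>+p. (\<integral>\<^sup>+z. (if snd p \<le> z \<and> z \<le> fst p then \<kappa> z (snd p) else 0) * ennreal (1 / S z) \<partial>\<mu>) \<partial>H)"
proof -
  let ?f = "\<lambda>y x z. (if z \<le> x then 1 else 0) * ((if y \<le> z then \<kappa> z y else 0) * ennreal (1 / S z) * ennreal (1 / \<alpha>))"
  have "(\<integral>\<^sup>+p. (\<integral>\<^sup>+z. (if snd p \<le> z \<and> z \<le> fst p then \<kappa> z (snd p) else 0) * ennreal (1 / S z) \<partial>\<mu>) \<partial>H)
      = (\<integral>\<^sup>+y. \<integral>\<^sup>+x. (if y \<le> x then \<integral>\<^sup>+z. (if y \<le> z \<and> z \<le> x then \<kappa> z y else 0) * ennreal (1 / S z) \<partial>\<mu> else 0)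
          * ennreal (1 / \<alpha>) \<partial>\<mu> \<partial>\<nu>)"
    by (subst nn_integral_H) (auto simp only: split_beta' fst_conv snd_conv intro!: refl, measurable)
  also have "\<dots> = (\<integral>\<^sup>+y. \<integral>\<^sup>+x. \<integral>\<^sup>+z. (?f y x z) \<partial>\<mu> \<partial>\<mu> \<partial>\<nu>)"
  proof (intro nn_integral_cong)
    fix x y :: real
    have "(if y \<le> x then \<integral>\<^sup>+z. (if y \<le> z \<and> z \<le> x then \<kappa> z y else 0) * ennreal (1 / S z) \<partial>\<mu> else 0)
          = (\<integral>\<^sup>+z. (if z \<le> x then 1 else 0) * ((if y \<le> z then \<kappa> z y else 0) * ennreal (1 / S z)) \<partial>\<mu>)"
    proof (cases "y \<le> x")
      case True
      then show ?thesis by (auto intro!: nn_integral_cong)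
    next
      case False
      then have "(\<integral>\<^sup>+z. (if z \<le> x then 1 else 0) * ((if y \<le> z then \<kappa> z y else 0) * ennreal (1 / S z)) \<partial>\<mu>) = (\<integral>\<^sup>+z. 0 \<partial>\<mu>)"
        by (intro nn_integral_cong) auto
      with False show ?thesis by simp
    qed
    then show "(if y \<le> x then \<integral>\<^sup>+z. (if y \<le> z \<and> z \<le> x then \<kappa> z y else 0) * ennreal (1 / S z) \<partial>\<mu> else 0)
          * ennreal (1 / \<alpha>) = (\<integral>\<^sup>+z. (?f y x z) \<partial>\<mu>)"
      by (simp add: nn_integral_multc[symmetric] mult.assoc)
  qed
  also have "\<dots> = (\<integral>\<^sup>+y. \<integral>\<^sup>+z. \<integral>\<^sup>+x. (?f y x z) \<partial>\<mu> \<partial>\<mu> \<partial>\<nu>)"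
  proof (rule nn_integral_cong)
    fix y
    interpret \<mu>\<mu>: pair_prob_space \<mu> \<mu> ..
    show "(\<integral>\<^sup>+x. \<integral>\<^sup>+z. (?f y x z) \<partial>\<mu> \<partial>\<mu>) = (\<integral>\<^sup>+z. \<integral>\<^sup>+x. (?f y x z) \<partial>\<mu> \<partial>\<mu>)"
      by (rule \<mu>\<mu>.Fubini') measurable
  qed
  also have "\<dots> = (\<integral>\<^sup>+y. \<integral>\<^sup>+z. (if y \<le> z then \<kappa> z y else 0) * ennreal (1 / \<alpha>) \<partial>\<mu> \<partial>\<nu>)"
  proof (rule nn_integral_cong, rule nn_integral_cong_AE)
    fix y
    show "AE z in \<mu>. (\<integral>\<^sup>+x. (?f y x z) \<partial>\<mu>) = (if y \<le> z then \<kappa> z y else 0) * ennreal (1 / \<alpha>)"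
      using AE_S_pos
    proof eventually_elim
    fix z assume z: "0 < S z"
    have "(\<integral>\<^sup>+x. (?f y x z) \<partial>\<mu>) = ennreal (S z) * ((if y \<le> z then \<kappa> z y else 0) * ennreal (1 / S z) * ennreal (1 / \<alpha>))"
      by (subst nn_integral_multc) (auto simp: nn_integral_S_above)
    also have "\<dots> = ennreal (S z) * ennreal (1 / S z) * ((if y \<le> z then \<kappa> z y else 0) * ennreal (1 / \<alpha>))"
      by (simp add: mult_ac)
    also have "ennreal (S z) * ennreal (1 / S z) = 1"
      using z by (subst ennreal_mult[symmetric]) auto
    finally show "(\<integral>\<^sup>+x. (?f y x z) \<partial>\<mu>) = (if y \<le> z then \<kappa> z y else 0) * ennreal (1 / \<alpha>)"
      by simp
    qed
  qed
  also have "\<dots> = (\<integral>\<^sup>+p. \<kappa> (fst p) (snd p) \<partial>H)"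
    by (subst nn_integral_H) (auto simp only: split_beta' fst_conv snd_conv, measurable)
  finally show ?thesis by simp
qed

subsection \<open>The sample\<close>

definition D :: "nat \<Rightarrow> sample measure" where
  "D n = Pi\<^sub>M {..<n} (\<lambda>_. H)"

lemma sets_D[measurable_cong]: "sets (D n) = sets (Pi\<^sub>M {..<n} (\<lambda>_. borel \<Otimes>\<^sub>M borel))"
  unfolding D_def by (intro sets_PiM_cong refl sets_H)

sublocale D: prob_space "D n" for n
  unfolding D_def by (intro prob_space_PiM prob_space_H)

sublocale D\<mu>: pair_prob_space "D n" \<mu> for n ..

lemma measurable_obs[measurable (raw)]:
  assumes "f \<in> M \<rightarrow>\<^sub>M D n" "i \<in> {..<n}"
  shows "(\<lambda>w. obsX (f w) i) \<in> borel_measurable M" "(\<lambda>w. obsY (f w) i) \<in> borel_measurable M"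
proof -
  have "f \<in> M \<rightarrow>\<^sub>M Pi\<^sub>M {..<n} (\<lambda>_. borel \<Otimes>\<^sub>M borel)"
    using assms(1) measurable_cong_sets[OF refl sets_D] by blast
  from measurable_compose[OF this measurable_component_singleton[OF assms(2)]]
  have [measurable]: "(\<lambda>w. f w i) \<in> M \<rightarrow>\<^sub>M borel \<Otimes>\<^sub>M borel" .
  show "(\<lambda>w. obsX (f w) i) \<in> borel_measurable M" "(\<lambda>w. obsY (f w) i) \<in> borel_measurable M"
    unfolding obsX_def obsY_def by measurable
qed

lemma measurable_risk[measurable (raw)]:
  assumes [measurable]: "f \<in> M \<rightarrow>\<^sub>M D n" "g \<in> borel_measurable M"
  shows "(\<lambda>w. risk n (f w) (g w)) \<in> borel_measurable M"
  unfolding risk_def by measurable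

lemma measurable_upd[measurable (raw)]:
  assumes f: "f \<in> M \<rightarrow>\<^sub>M D n" and g: "g \<in> M \<rightarrow>\<^sub>M borel \<Otimes>\<^sub>M borel" and i: "i \<in> {..<n}"
  shows "(\<lambda>w. (f w)(i := g w)) \<in> M \<rightarrow>\<^sub>M D n"
proof -
  have "f \<in> M \<rightarrow>\<^sub>M Pi\<^sub>M {..<n} (\<lambda>_. borel \<Otimes>\<^sub>M borel)"
    using f measurable_cong_sets[OF refl sets_D] by blast
  then have "(\<lambda>w. (f w)(i := g w)) \<in> M \<rightarrow>\<^sub>M Pi\<^sub>M {..<n} (\<lambda>_. borel \<Otimes>\<^sub>M borel)"
    using i g by (intro measurable_fun_upd[where J = "{..<n}"]) auto
  then show ?thesis using measurable_cong_sets[OF refl sets_D] by blast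
qed

text \<open>One observation may be replaced by an independent copy without changing the law of the sample. This is how one
coordinate is integrated out while the index set of the product stays the same.\<close>

lemma resample:
  assumes [measurable]: "f \<in> borel_measurable (D n)" and i: "i < n"
  shows "integral\<^sup>N (D n) f = (\<integral>\<^sup>+d. \<integral>\<^sup>+p. f (d(i := p)) \<partial>H \<partial>D n)"
proof -
  interpret product_sigma_finite "\<lambda>_. H" ..
  note [measurable] = lessThan_iff[THEN iffD2, OF i]
  let ?J = "{..<n} - {i}"
  have ins: "insert i ?J = {..<n}" using i by auto
  have fold: "integral\<^sup>N (D n) g = (\<integral>\<^sup>+x. \<integral>\<^sup>+y. g (x(i := y)) \<partial>H \<partial>Pi\<^sub>M ?J (\<lambda>_. H))"
    if "g \<in> borel_measurable (D n)" for g
  proof -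
    have "integral\<^sup>N (Pi\<^sub>M (insert i ?J) (\<lambda>_. H)) g = (\<integral>\<^sup>+x. \<integral>\<^sup>+y. g (x(i := y)) \<partial>H \<partial>Pi\<^sub>M ?J (\<lambda>_. H))"
      by (rule product_nn_integral_insert) (use that in \<open>auto simp only: ins D_def\<close>)
    then show ?thesis unfolding ins D_def .
  qed
  have "(\<integral>\<^sup>+d. \<integral>\<^sup>+p. f (d(i := p)) \<partial>H \<partial>D n) = (\<integral>\<^sup>+x. \<integral>\<^sup>+y. \<integral>\<^sup>+p. f (x(i := p)) \<partial>H \<partial>H \<partial>Pi\<^sub>M ?J (\<lambda>_. H))"
  proof (subst fold)
    have "(\<lambda>(d, p). f (d(i := p))) \<in> borel_measurable (D n \<Otimes>\<^sub>M H)"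
      by measurable
    then show "(\<lambda>d. \<integral>\<^sup>+p. f (d(i := p)) \<partial>H) \<in> borel_measurable (D n)"
      by (rule H.borel_measurable_nn_integral)
  qed simp
  also have "\<dots> = integral\<^sup>N (D n) f"
    by (simp add: fold H.emeasure_space_1[simplified])
  finally show ?thesis by simp
qed

text \<open>Almost sure regularity of a sample: no ties, entries precede deaths, and no death lies beyond the support.\<close>

definition good :: "nat \<Rightarrow> sample \<Rightarrow> bool" where
  "good n d \<longleftrightarrow> inj_on (\<lambda>i. obsX d i) {..<n} \<and> (\<forall>i<n. obsY d i \<le> obsX d i \<and> S (obsX d i) > 0)"

lemma AE_H_iff:
  assumes [measurable]: "Measurable.pred (borel \<Otimes>\<^sub>M borel) P"
    and "\<And>y. AE x in \<mu>. y \<le> x \<longrightarrow> P (x, y)"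
  shows "AE p in H. P p"
proof -
  have "(\<integral>\<^sup>+p. (if P p then 0 else 1) \<partial>H) = (\<integral>\<^sup>+y. \<integral>\<^sup>+x. (if y \<le> x then if P (x, y) then 0 else 1 else 0) * ennreal (1 / \<alpha>) \<partial>\<mu> \<partial>\<nu>)"
    by (rule nn_integral_H) measurable
  also have "\<dots> = (\<integral>\<^sup>+y. \<integral>\<^sup>+x. 0 \<partial>\<mu> \<partial>\<nu>)"
  proof (rule nn_integral_cong, rule nn_integral_cong_AE)
    show "AE x in \<mu>. (if y \<le> x then if P (x, y) then 0 else 1 else 0) * ennreal (1 / \<alpha>) = 0" for y
      using assms(2)[of y] by eventually_elim auto
  qed
  also have "\<dots> = 0" by simp
  finally have "AE p in H. (if P p then 0 else 1) = (0::ennreal)"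
    by (subst (asm) nn_integral_0_iff_AE, measurable)
  then show ?thesis by eventually_elim (auto split: if_splits)
qed

lemma AE_D_resample:
  assumes [measurable]: "Measurable.pred (D n) P" and i: "i < n"
    and "\<And>d. AE p in H. P (d(i := p))"
  shows "AE d in D n. P d"
proof -
  note [measurable] = lessThan_iff[THEN iffD2, OF i]
  have "(\<integral>\<^sup>+d. (if P d then 0 else 1) \<partial>D n) = (\<integral>\<^sup>+d. \<integral>\<^sup>+p. (if P (d(i := p)) then 0 else 1) \<partial>H \<partial>D n)"
    by (rule resample[OF _ i]) measurable
  also have "\<dots> = (\<integral>\<^sup>+d. \<integral>\<^sup>+p. 0 \<partial>H \<partial>D n)"
  proof (rule nn_integral_cong, rule nn_integral_cong_AE)
    show "AE p in H. (if P (d(i := p)) then 0 else 1) = (0::ennreal)" for d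
      using assms(3)[of d] by eventually_elim auto
  qed
  also have "\<dots> = 0" by simp
  finally have "AE p in D n. (if P p then 0 else 1) = (0::ennreal)"
    by (subst (asm) nn_integral_0_iff_AE, measurable)
  then show ?thesis by eventually_elim (auto split: if_splits)
qed

lemma AE_good: "AE d in D n. good n d"
proof -
  have 1: "AE d in D n. obsY d i \<le> obsX d i \<and> S (obsX d i) > 0" if "i < n" for i
  proof (rule AE_D_resample[OF _ that])
    show "Measurable.pred (D n) (\<lambda>d. obsY d i \<le> obsX d i \<and> S (obsX d i) > 0)"
    proof -
      note [measurable] = lessThan_iff[THEN iffD2, OF that]
      have [measurable]: "(\<lambda>d. S (obsX d i)) \<in> borel_measurable (D n)" by measurable
      have [measurable]: "Measurable.pred (D n) (\<lambda>d. 0 < S (obsX d i))" by measurable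
      have [measurable]: "Measurable.pred (D n) (\<lambda>d. obsY d i \<le> obsX d i)"
        unfolding pred_def by (rule borel_measurable_le) measurable
      show ?thesis by measurable
    qed
    show "AE p in H. obsY (d(i := p)) i \<le> obsX (d(i := p)) i \<and> S (obsX (d(i := p)) i) > 0" for d
      unfolding obs_upd
      by (rule AE_H_iff, measurable) (use AE_S_pos in \<open>auto elim!: eventually_mono\<close>)
  qed
  have 2: "AE d in D n. obsX d i \<noteq> obsX d j" if "i < n" "j < n" "i \<noteq> j" for i j
  proof (rule AE_D_resample[OF _ that(1)])
    show "Measurable.pred (D n) (\<lambda>d. obsX d i \<noteq> obsX d j)"
    proof -
      note [measurable] = lessThan_iff[THEN iffD2, OF that(1)] lessThan_iff[THEN iffD2, OF that(2)]
      show ?thesis unfolding linorder_neq_iff by measurable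
    qed
    show "AE p in H. obsX (d(i := p)) i \<noteq> obsX (d(i := p)) j" for d
      unfolding obs_upd(1,2) obs_upd(3)[OF that(3)[symmetric]]
      by (rule AE_H_iff, measurable) (use AE_neq[of "obsX d j"] in \<open>auto elim!: eventually_mono\<close>)
  qed
  have "AE d in D n. (\<forall>i\<in>{..<n}. obsY d i \<le> obsX d i \<and> S (obsX d i) > 0)"
    by (subst AE_ball_countable) (use 1 in simp_all)
  moreover have "AE d in D n. (\<forall>i\<in>{..<n}. \<forall>j\<in>{..<n}-{i}. obsX d i \<noteq> obsX d j)"
    by (intro AE_ball_countable[THEN iffD2] ballI) (auto intro!: 2 simp: countable_finite)
  ultimately show ?thesis
    by eventually_elim (auto simp: good_def inj_on_def)
qed

text \<open>For a predictable integrand the value at \<open>z\<close> does not change when a lifetime that is still running at \<open>z\<close> is replaced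
by \<open>z\<close> itself. With all other observations fixed this leaves a fixed function of \<open>z\<close> and the entry time, and
the previous lemmas apply.\<close>

lemma nn_integral_compensator_coord:
  assumes k[measurable]: "(\<lambda>(z, d). k z d) \<in> borel_measurable (borel \<Otimes>\<^sub>M D n)"
    and pred: "predictable n k" and i: "i < n"
  shows "(\<integral>\<^sup>+d. k (obsX d i) d \<partial>D n) = (\<integral>\<^sup>+d. \<integral>\<^sup>+z. k z d *
     ((if obsY d i \<le> z \<and> z \<le> obsX d i then 1 else 0) * ennreal (1 / S z)) \<partial>\<mu> \<partial>D n)"
proof -
  let ?w = "\<lambda>p z. ((if snd p \<le> z \<and> z \<le> fst p then 1 else 0) * ennreal (1 / S z))"
  note [measurable] = i lessThan_iff[THEN iffD2, OF i]
  have "(\<integral>\<^sup>+d. k (obsX d i) d \<partial>D n) = (\<integral>\<^sup>+d. \<integral>\<^sup>+p. k (obsX (d(i := p)) i) (d(i := p)) \<partial>H \<partial>D n)"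
    by (rule resample[OF _ i]) measurable
  also have "\<dots> = (\<integral>\<^sup>+d. \<integral>\<^sup>+p. \<integral>\<^sup>+z. k z (d(i := p)) *
     (?w p z) \<partial>\<mu> \<partial>H \<partial>D n)"
  proof (rule nn_integral_cong)
    fix d assume d[measurable]: "d \<in> space (D n)"
    have "(\<integral>\<^sup>+p. k (obsX (d(i := p)) i) (d(i := p)) \<partial>H) =
       (\<integral>\<^sup>+p. (\<integral>\<^sup>+z. (if snd p \<le> z \<and> z \<le> fst p then k z (d(i := (z, snd p))) else 0) * ennreal (1 / S z) \<partial>\<mu>) \<partial>H)"
      using nn_integral_compensator[of "\<lambda>z b. k z (d(i := (z, b)))"] by simp
    also have "\<dots> = (\<integral>\<^sup>+p. \<integral>\<^sup>+z. k z (d(i := p)) *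
     (?w p z) \<partial>\<mu> \<partial>H)"
    proof (intro nn_integral_cong)
      fix p :: "real \<times> real" and z :: real
      have "agree n z (d(i := (z, snd p))) (d(i := p))" if "z \<le> fst p"
        using that by (auto simp: agree_def obsX_def obsY_def)
      from predictableD[OF pred this]
      show "(if snd p \<le> z \<and> z \<le> fst p then k z (d(i := (z, snd p))) else 0) * ennreal (1 / S z)
         = k z (d(i := p)) * (?w p z)"
        by auto
    qed
    finally show "(\<integral>\<^sup>+p. k (obsX (d(i := p)) i) (d(i := p)) \<partial>H) = (\<integral>\<^sup>+p. \<integral>\<^sup>+z. k z (d(i := p)) *
     (?w p z) \<partial>\<mu> \<partial>H)" .
  qed
  also have "\<dots> = (\<integral>\<^sup>+d. \<integral>\<^sup>+z. k z d *
     ((if obsY d i \<le> z \<and> z \<le> obsX d i then 1 else 0) * ennreal (1 / S z)) \<partial>\<mu> \<partial>D n)"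
    by (subst (2) resample[OF _ i]) auto
  finally show ?thesis .
qed

lemma nn_integral_compensator_sum:
  assumes k[measurable]: "(\<lambda>(z, d). k z d) \<in> borel_measurable (borel \<Otimes>\<^sub>M D n)"
    and pred: "predictable n k"
  shows "(\<integral>\<^sup>+d. (\<Sum>i<n. k (obsX d i) d) \<partial>D n) = (\<integral>\<^sup>+d. \<integral>\<^sup>+z. k z d * ennreal (risk n d z / S z) \<partial>\<mu> \<partial>D n)"
proof -
  let ?w = "\<lambda>d i z. ((if obsY d i \<le> z \<and> z \<le> obsX d i then 1 else 0) * ennreal (1 / S z))"
  have "(\<integral>\<^sup>+d. (\<Sum>i<n. k (obsX d i) d) \<partial>D n) = (\<Sum>i<n. \<integral>\<^sup>+d. k (obsX d i) d \<partial>D n)"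
    by (subst nn_integral_sum) auto
  also have "\<dots> = (\<Sum>i<n. \<integral>\<^sup>+d. \<integral>\<^sup>+z. k z d *
     (?w d i z) \<partial>\<mu> \<partial>D n)"
    by (intro sum.cong refl nn_integral_compensator_coord[OF k pred]) auto
  also have "\<dots> = (\<integral>\<^sup>+d. \<integral>\<^sup>+z. (\<Sum>i<n. k z d *
     (?w d i z)) \<partial>\<mu> \<partial>D n)"
  proof -
    have "(\<integral>\<^sup>+z. (\<Sum>i<n. k z d *
     (?w d i z)) \<partial>\<mu>) = (\<Sum>i<n. \<integral>\<^sup>+z. k z d *
     (?w d i z) \<partial>\<mu>)"
      if [measurable]: "d \<in> space (D n)" for d
      by (rule nn_integral_sum) measurable
    then have "(\<integral>\<^sup>+d. \<integral>\<^sup>+z. (\<Sum>i<n. k z d *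
     (?w d i z)) \<partial>\<mu> \<partial>D n)
      = (\<integral>\<^sup>+d. (\<Sum>i<n. \<integral>\<^sup>+z. k z d *
     (?w d i z) \<partial>\<mu>) \<partial>D n)"
      by (rule nn_integral_cong)
    also have "\<dots> = (\<Sum>i<n. \<integral>\<^sup>+d. \<integral>\<^sup>+z. k z d *
     (?w d i z) \<partial>\<mu> \<partial>D n)"
      by (rule nn_integral_sum) measurable
    finally show ?thesis by simp
  qed
  also have "\<dots> = (\<integral>\<^sup>+d. \<integral>\<^sup>+z. k z d * ennreal (risk n d z / S z) \<partial>\<mu> \<partial>D n)"
  proof (rule nn_integral_cong, rule nn_integral_cong)
    fix d z
    have "(\<Sum>i<n. k z d * (?w d i z))
       = k z d * ((\<Sum>i<n. (if obsY d i \<le> z \<and> z \<le> obsX d i then 1 else 0)) * ennreal (1 / S z))"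
      by (simp only: sum_distrib_left[symmetric] sum_distrib_right[symmetric])
    also have "\<dots> = k z d * ennreal (risk n d z / S z)"
      by (simp only: ennreal_risk[symmetric] times_divide_eq_right mult_1_right
          ennreal_mult''[symmetric] S_nonneg divide_nonneg_nonneg zero_le_one)
    finally show "(\<Sum>i<n. k z d * (?w d i z))
       = k z d * ennreal (risk n d z / S z)" .
  qed
  finally show ?thesis .
qed

end

lemma predictable_comp2:
  "predictable n k \<Longrightarrow> predictable n l \<Longrightarrow> predictable n (\<lambda>z d. f z (k z d) (l z d))"
  unfolding predictable_def by metis

lemma predictable_comp:
  "predictable n k \<Longrightarrow> predictable n (\<lambda>z d. f z (k z d))"
  unfolding predictable_def by metis

context left_truncation
begin

text \<open>The stochastic integral of \<open>k\<close> against the counting process of deaths minus its compensator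
\<open>n C\<^sub>n d\<Lambda>\<close>.\<close>

definition mart :: "nat \<Rightarrow> (real \<Rightarrow> sample \<Rightarrow> real) \<Rightarrow> sample \<Rightarrow> real" where
  "mart n k d = (\<Sum>i<n. k (obsX d i) d) - (\<integral>z. k z d * risk n d z / S z \<partial>\<mu>)"

lemma measurable_mart[measurable]:
  assumes [measurable]: "(\<lambda>(z, d). k z d) \<in> borel_measurable (borel \<Otimes>\<^sub>M D n)"
  shows "mart n k \<in> borel_measurable (D n)"
  unfolding mart_def[abs_def] by measurable

lemma weight_nonneg: "0 \<le> risk n d z / S z"
  by (simp add: risk_nonneg S_nonneg)

text \<open>For nonnegative integrands, finiteness of the expected compensator lets the identity for nonnegative
integrals pass to Bochner integrals.\<close>

lemma compensator_nonneg:
  assumes k[measurable]: "(\<lambda>(z, d). k z d) \<in> borel_measurable (borel \<Otimes>\<^sub>M D n)"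
    and pred: "predictable n k" and nonneg: "\<And>z d. 0 \<le> k z d"
    and fin: "(\<integral>\<^sup>+d. \<integral>\<^sup>+z. ennreal (k z d * risk n d z / S z) \<partial>\<mu> \<partial>D n) < \<infinity>"
  shows "integrable (D n) (\<lambda>d. \<Sum>i<n. k (obsX d i) d)" (is ?A)
    and "integrable (D n) (\<lambda>d. \<integral>z. k z d * risk n d z / S z \<partial>\<mu>)" (is ?B)
    and "(\<integral>d. (\<Sum>i<n. k (obsX d i) d) \<partial>D n) = (\<integral>d. \<integral>z. k z d * risk n d z / S z \<partial>\<mu> \<partial>D n)" (is ?C)
    and "AE d in D n. integrable \<mu> (\<lambda>z. k z d * risk n d z / S z)" (is ?D)
proof -
  let ?q = "\<lambda>p. k (snd p) (fst p) * risk n (fst p) (snd p) / S (snd p)"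
  have q: "(\<integral>\<^sup>+p. ennreal (?q p) \<partial>(D n \<Otimes>\<^sub>M \<mu>)) = (\<integral>\<^sup>+d. \<integral>\<^sup>+z. ennreal (k z d * risk n d z / S z) \<partial>\<mu> \<partial>D n)"
    using \<mu>.nn_integral_fst[of "\<lambda>p. ennreal (?q p)" "D n"] by simp
  have q0: "0 \<le> ?q p" for p
    using nonneg weight_nonneg[of n "fst p" "snd p"] by (metis mult_nonneg_nonneg times_divide_eq_right)
  have int: "integrable (D n \<Otimes>\<^sub>M \<mu>) ?q"
    by (rule integrableI_nonneg) (use q fin q0 in auto)
  show ?B using D\<mu>.integrable_fst'[OF int] by simp
  show ?D using D\<mu>.AE_integrable_fst'[OF int] by simp
  have sum: "(\<integral>\<^sup>+d. ennreal (\<Sum>i<n. k (obsX d i) d) \<partial>D n) = (\<integral>\<^sup>+p. ennreal (?q p) \<partial>(D n \<Otimes>\<^sub>M \<mu>))"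
  proof -
    have "(\<integral>\<^sup>+d. ennreal (\<Sum>i<n. k (obsX d i) d) \<partial>D n) = (\<integral>\<^sup>+d. (\<Sum>i<n. ennreal (k (obsX d i) d)) \<partial>D n)"
      using nonneg by (simp add: sum_ennreal)
    also have "\<dots> = (\<integral>\<^sup>+d. \<integral>\<^sup>+z. ennreal (k z d) * ennreal (risk n d z / S z) \<partial>\<mu> \<partial>D n)"
      by (rule nn_integral_compensator_sum) (use pred in \<open>auto intro: predictable_comp\<close>)
    also have "\<dots> = (\<integral>\<^sup>+p. ennreal (?q p) \<partial>(D n \<Otimes>\<^sub>M \<mu>))"
      unfolding q using nonneg weight_nonneg by (simp add: ennreal_mult[symmetric])
    finally show ?thesis .
  qed
  show ?A
    by (rule integrableI_nonneg) (use sum q fin nonneg in \<open>auto intro!: sum_nonneg\<close>)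
  have "(\<integral>d. (\<Sum>i<n. k (obsX d i) d) \<partial>D n) = enn2real (\<integral>\<^sup>+d. ennreal (\<Sum>i<n. k (obsX d i) d) \<partial>D n)"
    by (rule integral_eq_nn_integral) (use nonneg in \<open>auto intro!: sum_nonneg\<close>)
  also have "\<dots> = (\<integral>p. ?q p \<partial>(D n \<Otimes>\<^sub>M \<mu>))"
    unfolding sum by (rule integral_eq_nn_integral[symmetric]) (use q0 in auto)
  also have "\<dots> = (\<integral>d. \<integral>z. k z d * risk n d z / S z \<partial>\<mu> \<partial>D n)"
    using D\<mu>.integral_fst'[OF int] by simp
  finally show ?C .
qed

text \<open>The signed case follows by splitting into positive and negative parts.\<close>

lemma
  assumes k[measurable]: "(\<lambda>(z, d). k z d) \<in> borel_measurable (borel \<Otimes>\<^sub>M D n)"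
    and pred: "predictable n k"
    and fin: "(\<integral>\<^sup>+d. \<integral>\<^sup>+z. ennreal (\<bar>k z d\<bar> * risk n d z / S z) \<partial>\<mu> \<partial>D n) < \<infinity>"
  shows integrable_mart: "integrable (D n) (mart n k)"
    and integral_mart: "(\<integral>d. mart n k d \<partial>D n) = 0"
    and AE_integrable_mart: "AE d in D n. integrable \<mu> (\<lambda>z. k z d * risk n d z / S z)"
proof -
  define kp where "kp z d = max 0 (k z d)" for z d
  define km where "km z d = max 0 (- k z d)" for z d
  have [measurable]: "(\<lambda>(z, d). kp z d) \<in> borel_measurable (borel \<Otimes>\<^sub>M D n)"
    "(\<lambda>(z, d). km z d) \<in> borel_measurable (borel \<Otimes>\<^sub>M D n)"
    unfolding kp_def[abs_def] km_def[abs_def] by measurable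
  have pp: "predictable n kp" and pm: "predictable n km"
    unfolding kp_def[abs_def] km_def[abs_def] by (rule predictable_comp[OF pred])+
  have le: "l * risk n d z / S z \<le> l' * risk n d z / S z" if "l \<le> l'" for l l' d z
    using mult_right_mono[OF that weight_nonneg[of n d z]] by simp
  have fp: "(\<integral>\<^sup>+d. \<integral>\<^sup>+z. ennreal (kp z d * risk n d z / S z) \<partial>\<mu> \<partial>D n) < \<infinity>"
    by (rule le_less_trans[OF nn_integral_mono fin], rule nn_integral_mono, rule ennreal_leI, rule le)
       (simp add: kp_def)
  have fm: "(\<integral>\<^sup>+d. \<integral>\<^sup>+z. ennreal (km z d * risk n d z / S z) \<partial>\<mu> \<partial>D n) < \<infinity>"
    by (rule le_less_trans[OF nn_integral_mono fin], rule nn_integral_mono, rule ennreal_leI, rule le)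
       (simp add: km_def)
  note P = compensator_nonneg[OF _ pp _ fp] and N = compensator_nonneg[OF _ pm _ fm]
  have k_eq: "k z d = kp z d - km z d" for z d by (simp add: kp_def km_def)
  have nn: "0 \<le> kp z d" "0 \<le> km z d" for z d by (auto simp: kp_def km_def)
  have AEP: "AE d in D n. integrable \<mu> (\<lambda>z. kp z d * risk n d z / S z)"
    and AEN: "AE d in D n. integrable \<mu> (\<lambda>z. km z d * risk n d z / S z)"
    by (rule P(4) N(4); (measurable; fail)?; simp add: nn)+
  show "AE d in D n. integrable \<mu> (\<lambda>z. k z d * risk n d z / S z)"
    using AEP AEN by eventually_elim (simp add: k_eq left_diff_distrib diff_divide_distrib)
  let ?m = "\<lambda>d. ((\<Sum>i<n. kp (obsX d i) d) - (\<integral>z. kp z d * risk n d z / S z \<partial>\<mu>))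
      - ((\<Sum>i<n. km (obsX d i) d) - (\<integral>z. km z d * risk n d z / S z \<partial>\<mu>))"
  have eq: "AE d in D n. mart n k d = ?m d"
    using AEP AEN
    by eventually_elim (simp add: mart_def k_eq left_diff_distrib diff_divide_distrib sum_subtractf)
  have iP: "integrable (D n) (\<lambda>d. \<Sum>i<n. kp (obsX d i) d)" "integrable (D n) (\<lambda>d. \<integral>z. kp z d * risk n d z / S z \<partial>\<mu>)"
     "(\<integral>d. (\<Sum>i<n. kp (obsX d i) d) \<partial>D n) = (\<integral>d. \<integral>z. kp z d * risk n d z / S z \<partial>\<mu> \<partial>D n)"
    by (rule P(1) P(2) P(3); (measurable; fail)?; simp add: nn)+
  have iN: "integrable (D n) (\<lambda>d. \<Sum>i<n. km (obsX d i) d)" "integrable (D n) (\<lambda>d. \<integral>z. km z d * risk n d z / S z \<partial>\<mu>)"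
     "(\<integral>d. (\<Sum>i<n. km (obsX d i) d) \<partial>D n) = (\<integral>d. \<integral>z. km z d * risk n d z / S z \<partial>\<mu> \<partial>D n)"
    by (rule N(1) N(2) N(3); (measurable; fail)?; simp add: nn)+
  have im: "integrable (D n) ?m"
    by (intro Bochner_Integration.integrable_diff iP iN)
  then show "integrable (D n) (mart n k)"
    using integrable_cong_AE[OF measurable_mart[OF k] borel_measurable_integrable[OF im] eq] by simp
  have "(\<integral>d. mart n k d \<partial>D n) = (\<integral>d. ?m d \<partial>D n)"
    by (rule integral_cong_AE[OF measurable_mart[OF k] borel_measurable_integrable[OF im] eq])
  also have "\<dots> = 0"
    using iP iN by (simp del: Bochner_Integration.integral_sum)
  finally show "(\<integral>d. mart n k d \<partial>D n) = 0" .
qed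

text \<open>The running value of a stochastic integral, taken strictly before time \<open>z\<close>, is known before \<open>z\<close>; so it may be
used inside another stochastic integral.\<close>

lemma predictable_running:
  assumes pred: "predictable n k"
  shows "predictable n (\<lambda>z d. (\<Sum>i<n. if obsX d i < z then k (obsX d i) d else 0)
      - (\<integral>u. (if u < z then k u d * risk n d u / S u else 0) \<partial>\<mu>))"
  unfolding predictable_def
proof (intro allI impI)
  fix z d d' assume a: "agree n z d d'"
  have k: "k u d = k u d'" if "u < z" for u
    using predictableD[OF pred agree_mono[OF a]] that by simp
  have "(\<Sum>i<n. if obsX d i < z then k (obsX d i) d else 0) = (\<Sum>i<n. if obsX d' i < z then k (obsX d' i) d' else 0)"
    using a k by (intro sum.cong refl) (auto simp: agree_def)
  moreover have "(\<integral>u. (if u < z then k u d * risk n d u / S u else 0) \<partial>\<mu>) =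
      (\<integral>u. (if u < z then k u d' * risk n d' u / S u else 0) \<partial>\<mu>)"
    using k risk_agree[OF a] by (intro Bochner_Integration.integral_cong refl) auto
  ultimately show "(\<Sum>i<n. if obsX d i < z then k (obsX d i) d else 0)
      - (\<integral>u. (if u < z then k u d * risk n d u / S u else 0) \<partial>\<mu>) = (\<Sum>i<n. if obsX d' i < z then k (obsX d' i) d' else 0)
      - (\<integral>u. (if u < z then k u d' * risk n d' u / S u else 0) \<partial>\<mu>)" by simp
qed

text \<open>The isometry for bounded integrands supported where \<open>S\<close> is bounded away from zero. The square of
the integral is the sum of the squared jumps plus the stochastic integral of twice the running value times the
integrand; the latter has mean zero.\<close>

lemma mart_second_moment_bounded:
  assumes k[measurable]: "(\<lambda>(z, d). k z d) \<in> borel_measurable (borel \<Otimes>\<^sub>M D n)"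
    and pred: "predictable n k" and bound: "\<And>z d. \<bar>k z d\<bar> \<le> c" and \<epsilon>: "\<epsilon> > 0"
    and supp: "\<And>z d. S z < \<epsilon> \<Longrightarrow> k z d = 0"
  shows "(\<integral>\<^sup>+d. ennreal ((mart n k d)\<^sup>2) \<partial>D n) = (\<integral>\<^sup>+d. \<integral>\<^sup>+z. ennreal ((k z d)\<^sup>2 * risk n d z / S z) \<partial>\<mu> \<partial>D n)"
proof -
  have c: "0 \<le> c" using order_trans[OF abs_ge_zero bound] .
  define f where "f z d = k z d * risk n d z / S z" for z d
  have [measurable]: "(\<lambda>(z, d). f z d) \<in> borel_measurable (borel \<Otimes>\<^sub>M D n)"
    unfolding f_def[abs_def] by measurable
  have fb: "\<bar>f z d\<bar> \<le> c * n / \<epsilon>" for z d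
  proof (cases "S z < \<epsilon>")
    case True
    then show ?thesis using c \<epsilon> by (simp add: f_def supp)
  next
    case False
    have "\<bar>k z d\<bar> * risk n d z / S z \<le> c * n / \<epsilon>"
      using False c \<epsilon> bound by (intro frac_le mult_mono) (auto simp: risk_le risk_nonneg)
    then show ?thesis by (simp add: f_def abs_mult risk_nonneg S_nonneg)
  qed
  define A where "A z d = (\<Sum>i<n. if obsX d i < z then k (obsX d i) d else 0)
      - (\<integral>u. (if u < z then f u d else 0) \<partial>\<mu>)" for z d
  have A_meas[measurable]: "(\<lambda>(z, d). A z d) \<in> borel_measurable (borel \<Otimes>\<^sub>M D n)"
    unfolding A_def[abs_def] by measurable
  have A_pred: "predictable n A"
    unfolding A_def[abs_def] f_def[abs_def] by (rule predictable_running[OF pred])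
  have int_f: "integrable \<mu> (\<lambda>z. f z d)" if [measurable]: "d \<in> space (D n)" for d
    by (rule \<mu>.integrable_const_bound[where B = "c * n / \<epsilon>"]) (use fb in auto)
  have A_bound: "\<bar>A z d\<bar> \<le> n * c + c * n / \<epsilon>" if [measurable]: "d \<in> space (D n)" for z d
  proof -
    have "\<bar>\<Sum>i<n. if obsX d i < z then k (obsX d i) d else 0\<bar> \<le> (\<Sum>i<n. c)"
      by (rule order_trans[OF sum_abs], rule sum_mono) (use bound c in auto)
    moreover have "\<bar>\<integral>u. (if u < z then f u d else 0) \<partial>\<mu>\<bar> \<le> c * n / \<epsilon>"
    proof -
      have "norm (\<integral>u. (if u < z then f u d else 0) \<partial>\<mu>) \<le> (\<integral>u. c * n / \<epsilon> \<partial>\<mu>)"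
        by (rule order_trans[OF integral_norm_bound], rule integral_mono)
           (use fb c \<epsilon> in \<open>auto intro!: integrable_norm Bochner_Integration.integrable_bound[OF int_f[OF that]]\<close>)
      then show ?thesis using \<mu>.prob_space by simp
    qed
    ultimately show ?thesis unfolding A_def by simp
  qed
  define k2 where "k2 z d = 2 * k z d * A z d" for z d
  have [measurable]: "(\<lambda>(z, d). k2 z d) \<in> borel_measurable (borel \<Otimes>\<^sub>M D n)"
    unfolding k2_def[abs_def] by measurable
  have k2_pred: "predictable n k2"
    unfolding k2_def[abs_def] by (rule predictable_comp2[OF pred A_pred])
  have k2_fin: "(\<integral>\<^sup>+d. \<integral>\<^sup>+z. ennreal (\<bar>k2 z d\<bar> * risk n d z / S z) \<partial>\<mu> \<partial>D n) < \<infinity>"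
  proof -
    have "(\<integral>\<^sup>+d. \<integral>\<^sup>+z. ennreal (\<bar>k2 z d\<bar> * risk n d z / S z) \<partial>\<mu> \<partial>D n)
       \<le> (\<integral>\<^sup>+d. \<integral>\<^sup>+z. ennreal (2 * (c * n / \<epsilon>) * (n * c + c * n / \<epsilon>)) \<partial>\<mu> \<partial>D n)"
    proof (intro nn_integral_mono ennreal_leI)
      fix d z assume d: "d \<in> space (D n)"
      have "\<bar>k2 z d\<bar> * risk n d z / S z = 2 * \<bar>f z d\<bar> * \<bar>A z d\<bar>"
        by (simp add: k2_def f_def abs_mult risk_nonneg S_nonneg)
      also have "\<dots> \<le> 2 * (c * n / \<epsilon>) * (n * c + c * n / \<epsilon>)"
        using fb[of z d] A_bound[OF d, of z] c \<epsilon> by (intro mult_mono) auto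
      finally show "\<bar>k2 z d\<bar> * risk n d z / S z \<le> 2 * (c * n / \<epsilon>) * (n * c + c * n / \<epsilon>)" .
    qed
    also have "\<dots> < \<infinity>" by (simp add: D.emeasure_space_1 \<mu>.emeasure_space_1[simplified])
    finally show ?thesis .
  qed
  have path: "AE d in D n. (mart n k d)\<^sup>2 = (\<Sum>i<n. (k (obsX d i) d)\<^sup>2) + mart n k2 d"
  proof (rule AE_mp[OF AE_good AE_I2], rule impI)
    fix d assume d: "d \<in> space (D n)" and g: "good n d"
    have "(mart n k d)\<^sup>2 = ((\<Sum>i<n. k (obsX d i) d) - (\<integral>z. f z d \<partial>\<mu>))\<^sup>2"
      by (simp add: mart_def f_def)
    also have "\<dots> = (\<Sum>i<n. (k (obsX d i) d)\<^sup>2)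
    + ((\<Sum>i<n. 2 * k (obsX d i) d * ((\<Sum>j<n. if obsX d j < obsX d i then k (obsX d j) d else 0)
          - (\<integral>u. (if u < obsX d i then f u d else 0) \<partial>\<mu>)))
      - (\<integral>z. 2 * f z d * ((\<Sum>j<n. if obsX d j < z then k (obsX d j) d else 0)
          - (\<integral>u. (if u < z then f u d else 0) \<partial>\<mu>)) \<partial>\<mu>))"
      by (rule square_of_compensated_sum)
         (use g int_f[OF d] AE_neq in \<open>auto simp: good_def \<mu>.prob_space_axioms\<close>)
    also have "\<dots> = (\<Sum>i<n. (k (obsX d i) d)\<^sup>2) + mart n k2 d"
    proof -
      have "2 * f z d * A z d = k2 z d * risk n d z / S z" for z
        by (simp add: f_def k2_def)
      then show ?thesis unfolding mart_def A_def[symmetric] by (simp add: k2_def)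
    qed
    finally show "(mart n k d)\<^sup>2 = (\<Sum>i<n. (k (obsX d i) d)\<^sup>2) + mart n k2 d" .
  qed
  have k2_int: "integrable (D n) (mart n k2)" and k2_0: "(\<integral>d. mart n k2 d \<partial>D n) = 0"
    by (rule integrable_mart integral_mart; (measurable; fail)?; rule k2_pred k2_fin)+
  have sq_int: "integrable (D n) (\<lambda>d. \<Sum>i<n. (k (obsX d i) d)\<^sup>2)"
  proof (rule D.integrable_const_bound[where B = "n * c\<^sup>2"])
    have "norm (\<Sum>i<n. (k (obsX d i) d)\<^sup>2) \<le> n * c\<^sup>2" for d
    proof -
      have "(\<Sum>i<n. (k (obsX d i) d)\<^sup>2) \<le> (\<Sum>i<n. c\<^sup>2)"
        using bound c by (intro sum_mono) (simp add: abs_le_square_iff[symmetric])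
      then show ?thesis by (simp add: sum_nonneg)
    qed
    then show "AE d in D n. norm (\<Sum>i<n. (k (obsX d i) d)\<^sup>2) \<le> n * c\<^sup>2" by simp
  qed measurable
  have tot_int: "integrable (D n) (\<lambda>d. (\<Sum>i<n. (k (obsX d i) d)\<^sup>2) + mart n k2 d)"
    by (intro Bochner_Integration.integrable_add sq_int k2_int)
  have "(\<integral>\<^sup>+d. ennreal ((mart n k d)\<^sup>2) \<partial>D n) = (\<integral>\<^sup>+d. ennreal ((\<Sum>i<n. (k (obsX d i) d)\<^sup>2) + mart n k2 d) \<partial>D n)"
    by (rule nn_integral_cong_AE) (use path in \<open>auto elim!: eventually_mono\<close>)
  also have "\<dots> = ennreal (\<integral>d. (\<Sum>i<n. (k (obsX d i) d)\<^sup>2) + mart n k2 d \<partial>D n)"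
  proof (rule nn_integral_eq_integral[OF tot_int])
    show "AE d in D n. 0 \<le> (\<Sum>i<n. (k (obsX d i) d)\<^sup>2) + mart n k2 d"
      using path by eventually_elim (metis zero_le_power2)
  qed
  also have "\<dots> = ennreal (\<integral>d. (\<Sum>i<n. (k (obsX d i) d)\<^sup>2) \<partial>D n)"
    by (subst Bochner_Integration.integral_add[OF sq_int k2_int]) (simp add: k2_0)
  also have "\<dots> = (\<integral>\<^sup>+d. ennreal (\<Sum>i<n. (k (obsX d i) d)\<^sup>2) \<partial>D n)"
    by (rule nn_integral_eq_integral[symmetric, OF sq_int]) (auto intro!: sum_nonneg)
  also have "\<dots> = (\<integral>\<^sup>+d. (\<Sum>i<n. ennreal ((k (obsX d i) d)\<^sup>2)) \<partial>D n)"
    by (simp add: sum_ennreal)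
  also have "\<dots> = (\<integral>\<^sup>+d. \<integral>\<^sup>+z. ennreal ((k z d)\<^sup>2) * ennreal (risk n d z / S z) \<partial>\<mu> \<partial>D n)"
    by (rule nn_integral_compensator_sum) (use pred in \<open>auto intro: predictable_comp\<close>)
  also have "\<dots> = (\<integral>\<^sup>+d. \<integral>\<^sup>+z. ennreal ((k z d)\<^sup>2 * risk n d z / S z) \<partial>\<mu> \<partial>D n)"
    using weight_nonneg by (simp add: ennreal_mult[symmetric])
  finally show ?thesis .
qed

text \<open>For a fixed sample the compensator has bounded density, since nobody is at risk after the last death.\<close>

lemma risk_weight_bound:
  assumes "good n d" obtains c where "\<And>z. risk n d z / S z \<le> c"
proof (cases "n = 0")
  case True
  then show ?thesis by (intro that[of 0]) (simp add: risk_def)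
next
  case False
  define m where "m = Max (obsX d ` {..<n})"
  have "m \<in> obsX d ` {..<n}" unfolding m_def by (rule Max_in) (use False in auto)
  then have m: "S m > 0" using assms by (auto simp: good_def)
  have "risk n d z / S z \<le> n / S m" for z
  proof (cases "z \<le> m")
    case True
    then show ?thesis using m S_antimono[OF True] by (intro frac_le) (auto simp: risk_le)
  next
    case False
    have "obsX d i < z" if "i < n" for i
    proof -
      have "obsX d i \<le> m" unfolding m_def using that by (intro Max_ge) auto
      then show ?thesis using False by simp
    qed
    then have "risk n d z = 0" unfolding risk_def by (intro sum.neutral) (force simp: not_le)
    then show ?thesis using m by simp
  qed
  then show ?thesis by (rule that)
qed

text \<open>Truncate the integrand in size and in range, apply the isometry, and pass to the limit with Fatou's lemma. The limit of
the truncated integrals exists as soon as the right-hand side is finite.\<close>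

lemma mart_second_moment:
  assumes k[measurable]: "(\<lambda>(z, d). k z d) \<in> borel_measurable (borel \<Otimes>\<^sub>M D n)"
    and pred: "predictable n k"
  shows "(\<integral>\<^sup>+d. ennreal ((mart n k d)\<^sup>2) \<partial>D n) \<le> (\<integral>\<^sup>+d. \<integral>\<^sup>+z. ennreal ((k z d)\<^sup>2 * risk n d z / S z) \<partial>\<mu> \<partial>D n)"
    (is "?L \<le> ?R")
proof (cases "?R = \<infinity>")
  case True
  then show ?thesis by simp
next
  case False
  define kk where "kk m z d = (if \<bar>k z d\<bar> \<le> real m \<and> 1 / real (Suc m) \<le> S z then k z d else 0)" for m :: nat and z d
  have [measurable]: "(\<lambda>(z, d). kk m z d) \<in> borel_measurable (borel \<Otimes>\<^sub>M D n)" for m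
    unfolding kk_def[abs_def] by measurable
  have kk_le: "\<bar>kk m z d\<bar> \<le> \<bar>k z d\<bar>" for m z d by (simp add: kk_def)
  have kk_lim: "(\<lambda>m. kk m z d) \<longlonglongrightarrow> k z d" if "S z > 0" for z d
  proof (rule tendsto_eventually)
    have "eventually (\<lambda>m. \<bar>k z d\<bar> \<le> real m) sequentially"
      using filterlim_real_sequentially by (auto simp: filterlim_at_top)
    moreover have "eventually (\<lambda>m. 1 / real (Suc m) < S z) sequentially"
      using LIMSEQ_inverse_real_of_nat that by (auto simp: inverse_eq_divide dest: order_tendstoD)
    ultimately show "eventually (\<lambda>m. kk m z d = k z d) sequentially"
      by eventually_elim (auto simp: kk_def)
  qed
  have moment: "(\<integral>\<^sup>+d. ennreal ((mart n (kk m) d)\<^sup>2) \<partial>D n) \<le> ?R" for m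
  proof -
    have "(\<integral>\<^sup>+d. ennreal ((mart n (kk m) d)\<^sup>2) \<partial>D n)
        = (\<integral>\<^sup>+d. \<integral>\<^sup>+z. ennreal ((kk m z d)\<^sup>2 * risk n d z / S z) \<partial>\<mu> \<partial>D n)"
      by (rule mart_second_moment_bounded[where c = "real m" and \<epsilon> = "1 / real (Suc m)"])
         (use predictable_comp[OF pred, where f = "\<lambda>z v. if \<bar>v\<bar> \<le> real m \<and> 1 / real (Suc m) \<le> S z then v else 0"]
           in \<open>auto simp: kk_def[abs_def]\<close>)
    also have "\<dots> \<le> ?R"
    proof (intro nn_integral_mono ennreal_leI)
      fix d z
      have "(kk m z d)\<^sup>2 * (risk n d z / S z) \<le> (k z d)\<^sup>2 * (risk n d z / S z)"
        using kk_le by (intro mult_right_mono weight_nonneg) (simp add: abs_le_square_iff[symmetric])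
      then show "(kk m z d)\<^sup>2 * risk n d z / S z \<le> (k z d)\<^sup>2 * risk n d z / S z" by simp
    qed
    finally show ?thesis .
  qed
  have fin: "AE d in D n. (\<integral>\<^sup>+z. ennreal ((k z d)\<^sup>2 * risk n d z / S z) \<partial>\<mu>) \<noteq> \<infinity>"
    by (rule nn_integral_PInf_AE) (use False in auto)
  have lim: "AE d in D n. (\<lambda>m. (mart n (kk m) d)\<^sup>2) \<longlonglongrightarrow> (mart n k d)\<^sup>2"
  proof (rule AE_mp[OF AE_good], rule AE_mp[OF fin AE_I2], intro impI)
    fix d assume d[measurable]: "d \<in> space (D n)" and g: "good n d"
      and f: "(\<integral>\<^sup>+z. ennreal ((k z d)\<^sup>2 * risk n d z / S z) \<partial>\<mu>) \<noteq> \<infinity>"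
    obtain c where c: "\<And>z. risk n d z / S z \<le> c" by (rule risk_weight_bound[OF g]) blast
    have sq: "integrable \<mu> (\<lambda>z. (k z d)\<^sup>2 * risk n d z / S z)"
    proof (rule integrableI_nonneg)
      show "AE z in \<mu>. 0 \<le> (k z d)\<^sup>2 * risk n d z / S z"
        by (simp add: risk_nonneg S_nonneg)
    qed (use f in \<open>auto simp: less_top\<close>)
    have dom: "integrable \<mu> (\<lambda>z. c + (k z d)\<^sup>2 * risk n d z / S z)"
      using sq by simp
    have "(\<lambda>m. \<integral>z. kk m z d * risk n d z / S z \<partial>\<mu>) \<longlonglongrightarrow> (\<integral>z. k z d * risk n d z / S z \<partial>\<mu>)"
    proof (rule integral_dominated_convergence[OF _ _ dom])
      show "AE z in \<mu>. (\<lambda>m. kk m z d * risk n d z / S z) \<longlonglongrightarrow> k z d * risk n d z / S z"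
      proof (use AE_S_pos in eventually_elim)
        fix z assume z: "0 < S z"
        from tendsto_mult_right[OF kk_lim[OF z, of d], of "risk n d z / S z"]
        show "(\<lambda>m. kk m z d * risk n d z / S z) \<longlonglongrightarrow> k z d * risk n d z / S z" by simp
      qed
      \<comment> \<open>A finite second moment dominates the first one, because the compensator has finite mass.\<close>
      show "AE z in \<mu>. norm (kk m z d * risk n d z / S z) \<le> c + (k z d)\<^sup>2 * risk n d z / S z" for m
      proof (rule AE_I2)
        fix z
        have "\<bar>kk m z d\<bar> \<le> 1 + (k z d)\<^sup>2"
        proof -
          have "0 \<le> (\<bar>k z d\<bar> - 1)\<^sup>2" by simp
          then have "2 * \<bar>k z d\<bar> \<le> 1 + (k z d)\<^sup>2" by (simp add: power2_eq_square algebra_simps)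
          then show ?thesis using kk_le[of m z d] by linarith
        qed
        then have "\<bar>kk m z d\<bar> * (risk n d z / S z) \<le> (1 + (k z d)\<^sup>2) * (risk n d z / S z)"
          by (intro mult_right_mono weight_nonneg)
        also have "\<dots> = risk n d z / S z + (k z d)\<^sup>2 * risk n d z / S z"
          by (simp add: distrib_right add_divide_distrib)
        also have "\<dots> \<le> c + (k z d)\<^sup>2 * risk n d z / S z" using c[of z] by simp
        finally show "norm (kk m z d * risk n d z / S z) \<le> c + (k z d)\<^sup>2 * risk n d z / S z"
          by (simp add: abs_mult risk_nonneg S_nonneg)
      qed
    qed measurable
    moreover have "(\<lambda>m. \<Sum>i<n. kk m (obsX d i) d) \<longlonglongrightarrow> (\<Sum>i<n. k (obsX d i) d)"
      using g by (intro tendsto_sum kk_lim) (auto simp: good_def)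
    ultimately show "(\<lambda>m. (mart n (kk m) d)\<^sup>2) \<longlonglongrightarrow> (mart n k d)\<^sup>2"
      unfolding mart_def by (intro tendsto_power tendsto_diff)
  qed
  have "?L = (\<integral>\<^sup>+d. liminf (\<lambda>m. ennreal ((mart n (kk m) d)\<^sup>2)) \<partial>D n)"
  proof (rule nn_integral_cong_AE, use lim in eventually_elim)
    fix d assume "(\<lambda>m. (mart n (kk m) d)\<^sup>2) \<longlonglongrightarrow> (mart n k d)\<^sup>2"
    then have "(\<lambda>m. ennreal ((mart n (kk m) d)\<^sup>2)) \<longlonglongrightarrow> ennreal ((mart n k d)\<^sup>2)"
      by (rule tendsto_ennrealI)
    then show "ennreal ((mart n k d)\<^sup>2) = liminf (\<lambda>m. ennreal ((mart n (kk m) d)\<^sup>2))"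
      by (intro lim_imp_Liminf[symmetric]) auto
  qed
  also have "\<dots> \<le> liminf (\<lambda>m. \<integral>\<^sup>+d. ennreal ((mart n (kk m) d)\<^sup>2) \<partial>D n)"
    by (rule nn_integral_liminf) measurable
  also have "\<dots> \<le> ?R"
    by (rule Liminf_le) (auto intro: moment always_eventually)
  finally show ?thesis .
qed

end

section \<open>Pathwise identities for the product-limit estimator\<close>

text \<open>Adding the elements of a finite set in increasing order of \<open>x\<close> telescopes any set function. For
\<open>g\<close> a product this gives the jumps of the product-limit estimator.\<close>

lemma telescope_by_rank:
  fixes x :: "'i \<Rightarrow> real" and g :: "'i set \<Rightarrow> real"
  assumes "finite A" "inj_on x A"
  shows "g A - g {} = (\<Sum>i\<in>A. g {j\<in>A. x j \<le> x i} - g {j\<in>A. x j < x i})"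
  using assms
proof (induction A rule: finite_ranking_induct[where f = x])
  case empty
  then show ?case by simp
next
  case (insert a A)
  show ?case
  proof (cases "a \<in> A")
    case True
    then show ?thesis using insert by (simp add: insert_absorb)
  next
    case False
    have less: "x i < x a" if "i \<in> A" for i
      using insert.hyps(2)[OF that] insert.prems that False by (metis inj_onD insertCI order_le_imp_less_or_eq)
    have 1: "{j \<in> insert a A. x j \<le> x i} = {j \<in> A. x j \<le> x i}" "{j \<in> insert a A. x j < x i} = {j \<in> A. x j < x i}"
      if "i \<in> A" for i using less[OF that] by auto
    have 2: "{j \<in> insert a A. x j \<le> x a} = insert a A" "{j \<in> insert a A. x j < x a} = A"
      using less False by (auto simp: less_imp_le)
    have "(\<Sum>i\<in>insert a A. g {j\<in>insert a A. x j \<le> x i} - g {j\<in>insert a A. x j < x i})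
        = g (insert a A) - g A + (\<Sum>i\<in>A. g {j\<in>A. x j \<le> x i} - g {j\<in>A. x j < x i})"
      unfolding sum.insert[OF insert.hyps(1) False] 2 add_left_cancel
      by (rule sum.cong[OF refl]) (simp only: 1)
    also have "\<dots> = g (insert a A) - g A + (g A - g {})"
      using insert.IH insert.prems by simp
    finally show ?thesis by simp
  qed
qed

lemma integrable_tensor:
  fixes f g :: "'a \<Rightarrow> real"
  assumes "prob_space m" and f: "integrable m f" and g: "integrable m g"
  shows "integrable (m \<Otimes>\<^sub>M m) (\<lambda>p. f (fst p) * g (snd p))"
proof -
  interpret prob_space m by fact
  interpret pair_prob_space m m ..
  note [measurable] = borel_measurable_integrable[OF f] borel_measurable_integrable[OF g]
  show ?thesis
    by (rule Fubini_integrable)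
       (auto intro!: integrable_mult_right integrable_mult_left integrable_norm f g simp: abs_mult)
qed

text \<open>The estimate \<open>1 - F\<^sub>n(z-)\<close> of the survival function. The product runs over indices, so this is
the Lynden-Bell product for samples without ties.\<close>

definition B :: "nat \<Rightarrow> sample \<Rightarrow> real \<Rightarrow> real" where
  "B n d z = (\<Prod>i<n. if obsX d i < z then 1 - 1 / risk n d (obsX d i) else 1)"

lemma B_conv: "B n d z = (\<Prod>i\<in>{i\<in>{..<n}. obsX d i < z}. 1 - 1 / risk n d (obsX d i))"
  unfolding B_def by (rule prod.inter_filter[symmetric]) simp

lemma B_agree: assumes "agree n z d d'" "u \<le> z" shows "B n d u = B n d' u"
  unfolding B_def
proof (intro prod.cong refl)
  fix i assume "i \<in> {..<n}"
  then have "obsX d i = obsX d' i \<or> z \<le> obsX d i \<and> z \<le> obsX d' i"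
    using assms(1) by (auto simp: agree_def)
  then show "(if obsX d i < u then 1 - 1 / risk n d (obsX d i) else 1) =
      (if obsX d' i < u then 1 - 1 / risk n d' (obsX d' i) else 1)"
    using assms(2) risk_agree[OF assms(1), of "obsX d i"] by auto
qed

text \<open>Nobody has entered by time \<open>z\<close>.\<close>

definition waiting :: "nat \<Rightarrow> sample \<Rightarrow> real \<Rightarrow> bool" where
  "waiting n d z \<longleftrightarrow> (\<forall>i<n. z < obsY d i)"

context left_truncation
begin

lemma measurable_B[measurable (raw)]:
  assumes [measurable]: "f \<in> M \<rightarrow>\<^sub>M D n" "g \<in> borel_measurable M"
  shows "(\<lambda>w. B n (f w) (g w)) \<in> borel_measurable M"
  unfolding B_def by measurable

lemma risk_at_obs: assumes "good n d" "i < n" shows "1 \<le> risk n d (obsX d i)"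
proof -
  have "(if obsY d i \<le> obsX d i \<and> obsX d i \<le> obsX d i then 1 else 0) \<le> risk n d (obsX d i)"
    unfolding risk_def by (rule member_le_sum) (use assms in auto)
  then show ?thesis using assms by (simp add: good_def)
qed

lemma B_factor: assumes "good n d" "i < n" shows "0 \<le> 1 - 1 / risk n d (obsX d i)" "1 - 1 / risk n d (obsX d i) \<le> 1"
  using risk_at_obs[OF assms] by auto

lemma B_nonneg: "good n d \<Longrightarrow> 0 \<le> B n d z"
  unfolding B_def by (intro prod_nonneg) (auto dest: B_factor)

lemma B_le_1: "good n d \<Longrightarrow> B n d z \<le> 1"
  unfolding B_def by (intro prod_le_1) (auto dest: B_factor)

lemma risk_pos_iff: "risk n d z > 0 \<longleftrightarrow> (\<exists>i<n. obsY d i \<le> z \<and> z \<le> obsX d i)"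
proof
  assume "risk n d z > 0"
  then show "\<exists>i<n. obsY d i \<le> z \<and> z \<le> obsX d i"
    unfolding risk_def by (rule contrapos_pp) (auto intro!: sum_nonpos simp: not_less)
next
  assume "\<exists>i<n. obsY d i \<le> z \<and> z \<le> obsX d i"
  then obtain i where i: "i < n" "obsY d i \<le> z \<and> z \<le> obsX d i" by blast
  have "(if obsY d i \<le> z \<and> z \<le> obsX d i then 1 else 0) \<le> risk n d z"
    unfolding risk_def by (rule member_le_sum) (use i in auto)
  then show "risk n d z > 0" using i by simp
qed

lemma risk_ge_1: "risk n d z > 0 \<Longrightarrow> risk n d z \<ge> 1"
proof -
  assume "risk n d z > 0"
  then obtain i where i: "i < n" "obsY d i \<le> z \<and> z \<le> obsX d i" by (auto simp: risk_pos_iff)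
  have "(if obsY d i \<le> z \<and> z \<le> obsX d i then 1 else 0) \<le> risk n d z"
    unfolding risk_def by (rule member_le_sum) (use i in auto)
  then show ?thesis using i by simp
qed

lemma B_waiting: assumes "good n d" "waiting n d z" shows "B n d z = 1" "risk n d z = 0"
proof -
  have "z < obsX d i" if "i < n" for i using assms that by (force simp: good_def waiting_def)
  then show "B n d z = 1" unfolding B_def by (intro prod.neutral) force
  have "\<not> risk n d z > 0" using assms(2) by (force simp: risk_pos_iff waiting_def)
  then show "risk n d z = 0" using risk_nonneg[of n d z] by simp
qed

text \<open>After the first entry, an empty risk set at \<open>z\<close> means that at the last death before \<open>z\<close> only one individual was at risk,
and the corresponding factor of the product vanishes.\<close>

lemma B_hole: assumes g: "good n d" and r: "risk n d z = 0" and w: "\<not> waiting n d z" shows "B n d z = 0"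
proof -
  let ?A = "{i. i < n \<and> obsX d i < z}"
  obtain i0 where "i0 < n" "obsY d i0 \<le> z" using w by (auto simp: waiting_def not_less)
  moreover have alive: "\<not> (obsY d j \<le> z \<and> z \<le> obsX d j)" if "j < n" for j
    using r risk_pos_iff[of n d z] that by auto
  ultimately have "i0 \<in> ?A" by force
  then have "?A \<noteq> {}" "finite ?A" by auto
  then obtain i where i: "i \<in> ?A" and max: "\<And>j. j \<in> ?A \<Longrightarrow> obsX d j \<le> obsX d i"
  proof -
    have "Max (obsX d ` ?A) \<in> obsX d ` ?A" by (rule Max_in) (use \<open>?A \<noteq> {}\<close> in auto)
    then obtain i where i: "i \<in> ?A" "Max (obsX d ` ?A) = obsX d i" unfolding image_iff by blast
    have "obsX d j \<le> obsX d i" if "j \<in> ?A" for j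
      unfolding i(2)[symmetric] using that by (intro Max_ge) auto
    with i(1) show ?thesis by (rule that)
  qed
  have single: "(obsY d j \<le> obsX d i \<and> obsX d i \<le> obsX d j) \<longleftrightarrow> j = i" if j: "j < n" for j
  proof
    assume *: "obsY d j \<le> obsX d i \<and> obsX d i \<le> obsX d j"
    have "obsX d j < z"
    proof (rule ccontr)
      assume "\<not> obsX d j < z"
      with * i alive[OF j] show False by auto
    qed
    then have "obsX d j \<le> obsX d i" using j max by auto
    with * have "obsX d j = obsX d i" by simp
    then show "j = i" using g i j by (auto simp: good_def dest: inj_onD)
  next
    assume "j = i" then show "obsY d j \<le> obsX d i \<and> obsX d i \<le> obsX d j"
      using g i by (auto simp: good_def)
  qed
  have "risk n d (obsX d i) = (\<Sum>j<n. if j = i then 1 else 0)"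
    unfolding risk_def by (intro sum.cong refl) (use single in auto)
  also have "\<dots> = 1" using i by simp
  finally show ?thesis
    unfolding B_def by (intro prod_zero) (use i in \<open>auto intro!: bexI[of _ i]\<close>)
qed

lemma B_cases: "good n d \<Longrightarrow> risk n d z = 0 \<Longrightarrow> B n d z = (if waiting n d z then 1 else 0)"
  using B_waiting B_hole by auto

lemma B_jumps:
  assumes g: "good n d"
  shows "B n d z = 1 + (\<Sum>i<n. if obsX d i < z then - (B n d (obsX d i) / risk n d (obsX d i)) else 0)"
proof -
  let ?A = "{i\<in>{..<n}. obsX d i < z}"
  let ?g = "\<lambda>A. \<Prod>i\<in>A. 1 - 1 / risk n d (obsX d i)"
  have inj: "inj_on (obsX d) ?A" using g by (auto simp: good_def inj_on_def)
  have "?g ?A - ?g {} = (\<Sum>i\<in>?A. ?g {j\<in>?A. obsX d j \<le> obsX d i} - ?g {j\<in>?A. obsX d j < obsX d i})"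
    by (rule telescope_by_rank[OF _ inj]) simp
  also have "\<dots> = (\<Sum>i\<in>?A. - (B n d (obsX d i) / risk n d (obsX d i)))"
  proof (intro sum.cong refl)
    fix i assume i: "i \<in> ?A"
    let ?L = "{j\<in>?A. obsX d j < obsX d i}"
    have L: "{j\<in>?A. obsX d j \<le> obsX d i} = insert i ?L"
      using i inj by (auto simp: inj_on_def order.order_iff_strict)
    have "?g ?L = B n d (obsX d i)"
      unfolding B_conv using i by (intro prod.cong) auto
    then show "?g {j\<in>?A. obsX d j \<le> obsX d i} - ?g ?L = - (B n d (obsX d i) / risk n d (obsX d i))"
      unfolding L by (subst prod.insert) (auto simp: algebra_simps)
  qed
  also have "\<dots> = (\<Sum>i<n. if obsX d i < z then - (B n d (obsX d i) / risk n d (obsX d i)) else 0)"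
    by (rule sum.inter_filter) simp
  finally show ?thesis by (simp add: B_conv)
qed

lemma has_integral_inverse_S_squared:
  assumes "S b > 0"
  shows "has_bochner_integral \<mu> (\<lambda>u. if u < b then 1 / (S u)\<^sup>2 else 0) (1 / S b - 1)"
    and "c < b \<Longrightarrow> has_bochner_integral \<mu> (\<lambda>u. if c < u \<and> u < b then 1 / (S u)\<^sup>2 else 0) (1 / S b - 1 / S c)"
proof -
  have "1 \<le> 1 / S b" using assms S_le_1[of b] by simp
  have "(\<integral>\<^sup>+u. ennreal (if u < b then 1 / (S u)\<^sup>2 else 0) \<partial>\<mu>) = ennreal (1 / S b - 1)"
    unfolding nn_integral_inverse_S_squared_below[OF assms, symmetric]
    by (intro nn_integral_cong) (auto split: split_indicator)
  then show "has_bochner_integral \<mu> (\<lambda>u. if u < b then 1 / (S u)\<^sup>2 else 0) (1 / S b - 1)"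
    by (intro has_bochner_integral_nn_integral) (use \<open>1 \<le> 1 / S b\<close> in auto)
  assume "c < b"
  then have "S b \<le> S c" by (intro S_antimono) simp
  then have "1 / S c \<le> 1 / S b" using assms by (intro divide_left_mono) (auto intro!: mult_pos_pos)
  have "(\<integral>\<^sup>+u. ennreal (if c < u \<and> u < b then 1 / (S u)\<^sup>2 else 0) \<partial>\<mu>) = ennreal (1 / S b - 1 / S c)"
    unfolding nn_integral_inverse_S_squared[OF less_imp_le[OF \<open>c < b\<close>] assms, symmetric]
    by (intro nn_integral_cong_AE, use AE_neq[of c] in eventually_elim) (auto split: split_indicator)
  then show "has_bochner_integral \<mu> (\<lambda>u. if c < u \<and> u < b then 1 / (S u)\<^sup>2 else 0) (1 / S b - 1 / S c)"
    by (intro has_bochner_integral_nn_integral) (use \<open>1 / S c \<le> 1 / S b\<close> in auto)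
qed

text \<open>Integration by parts for a step function divided by \<open>S\<close>. The statement is linear in the jumps, so only the
constant \<open>1\<close> and single steps have to be checked, and for these it is \<open>d(1/S) = dF / S\<^sup>2\<close>.\<close>

lemma jump_process_over_S:
  fixes x \<delta> :: "nat \<Rightarrow> real" and base :: real and n :: nat
  assumes z: "S z > 0"
  defines "q \<equiv> \<lambda>u. base + (\<Sum>i<n. if x i < u then \<delta> i else 0)"
  shows "integrable \<mu> (\<lambda>u. if u < z then q u / (S u)\<^sup>2 else 0)"
    and "q z / S z = base + (\<Sum>i<n. if x i < z then \<delta> i / S (x i) else 0) + (\<integral>u. (if u < z then q u / (S u)\<^sup>2 else 0) \<partial>\<mu>)"
proof -
  have "has_bochner_integral \<mu> (\<lambda>u. base * (if u < z then 1 / (S u)\<^sup>2 else 0)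
      + (\<Sum>i<n. \<delta> i * (if x i < u \<and> u < z then 1 / (S u)\<^sup>2 else 0)))
    (base * (1 / S z - 1) + (\<Sum>i<n. \<delta> i * (if x i < z then 1 / S z - 1 / S (x i) else 0)))"
  proof (intro has_bochner_integral_add has_bochner_integral_sum has_bochner_integral_mult_right)
    show "has_bochner_integral \<mu> (\<lambda>u. if u < z then 1 / (S u)\<^sup>2 else 0) (1 / S z - 1)"
      by (rule has_integral_inverse_S_squared[OF z])
    show "has_bochner_integral \<mu> (\<lambda>u. if x i < u \<and> u < z then 1 / (S u)\<^sup>2 else 0)
        (if x i < z then 1 / S z - 1 / S (x i) else 0)" for i
    proof (cases "x i < z")
      case True
      then show ?thesis using has_integral_inverse_S_squared(2)[OF z True] by simp
    next
      case False
      then have "(\<lambda>u. if x i < u \<and> u < z then 1 / (S u)\<^sup>2 else 0) = (\<lambda>u. 0)" by auto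
      then show ?thesis using False by (simp add: has_bochner_integral_zero)
    qed
  qed
  moreover have "(\<lambda>u. base * (if u < z then 1 / (S u)\<^sup>2 else 0)
      + (\<Sum>i<n. \<delta> i * (if x i < u \<and> u < z then 1 / (S u)\<^sup>2 else 0))) = (\<lambda>u. if u < z then q u / (S u)\<^sup>2 else 0)"
  proof
    fix u
    show "base * (if u < z then 1 / (S u)\<^sup>2 else 0)
      + (\<Sum>i<n. \<delta> i * (if x i < u \<and> u < z then 1 / (S u)\<^sup>2 else 0)) = (if u < z then q u / (S u)\<^sup>2 else 0)"
      by (auto simp: q_def add_divide_distrib sum_divide_distrib intro!: sum.cong)
  qed
  ultimately have *: "has_bochner_integral \<mu> (\<lambda>u. if u < z then q u / (S u)\<^sup>2 else 0)
     (base * (1 / S z - 1) + (\<Sum>i<n. \<delta> i * (if x i < z then 1 / S z - 1 / S (x i) else 0)))" by simp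
  then show "integrable \<mu> (\<lambda>u. if u < z then q u / (S u)\<^sup>2 else 0)"
    by (simp add: has_bochner_integral_iff)
  have "base + (\<Sum>i<n. if x i < z then \<delta> i / S (x i) else 0)
     + (base * (1 / S z - 1) + (\<Sum>i<n. \<delta> i * (if x i < z then 1 / S z - 1 / S (x i) else 0)))
     = base / S z + (\<Sum>i<n. (if x i < z then \<delta> i / S (x i) else 0) + \<delta> i * (if x i < z then 1 / S z - 1 / S (x i) else 0))"
    by (simp add: sum.distrib algebra_simps)
  also have "\<dots> = q z / S z"
    by (auto simp: q_def add_divide_distrib sum_divide_distrib algebra_simps intro!: sum.cong)
  finally show "q z / S z = base + (\<Sum>i<n. if x i < z then \<delta> i / S (x i) else 0) + (\<integral>u. (if u < z then q u / (S u)\<^sup>2 else 0) \<partial>\<mu>)"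
    using * by (simp add: has_bochner_integral_iff)
qed

text \<open>The ratio of estimated to true survival just before \<open>z\<close>.\<close>

definition W :: "nat \<Rightarrow> sample \<Rightarrow> real \<Rightarrow> real" where
  "W n d z = B n d z / S z"

lemma measurable_W[measurable (raw)]:
  assumes [measurable]: "f \<in> M \<rightarrow>\<^sub>M D n" "g \<in> borel_measurable M"
  shows "(\<lambda>w. W n (f w) (g w)) \<in> borel_measurable M"
  unfolding W_def by measurable

lemma W_nonneg: "good n d \<Longrightarrow> 0 \<le> W n d z"
  by (simp add: W_def B_nonneg S_nonneg)

text \<open>The ratio \<open>S\<^sub>n(z-)/S(z)\<close> minus one is, up to sign, the integral of the ratio against \<open>d(\<Lambda>\<^sub>n - \<Lambda>)\<close>. The measure
\<open>\<Lambda>\<close> is used in full, also where nobody is at risk, so the identity is exact.\<close>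

lemma W_identity:
  assumes g: "good n d" and z: "S z > 0"
  shows "integrable \<mu> (\<lambda>u. if u < z then W n d u / S u else 0)"
    and "W n d z = 1 - (\<Sum>i<n. if obsX d i < z then W n d (obsX d i) / risk n d (obsX d i) else 0)
        + (\<integral>u. (if u < z then W n d u / S u else 0) \<partial>\<mu>)"
proof -
  note J = jump_process_over_S[OF z, where n = n and x = "obsX d" and base = 1
      and \<delta> = "\<lambda>i. - (B n d (obsX d i) / risk n d (obsX d i))", folded B_jumps[OF g]]
  have eq: "W n d u / S u = B n d u / (S u)\<^sup>2" for u
    by (simp add: W_def power2_eq_square)
  show "integrable \<mu> (\<lambda>u. if u < z then W n d u / S u else 0)"
    unfolding eq by (rule J(1))
  have "(\<Sum>i<n. if obsX d i < z then - (B n d (obsX d i) / risk n d (obsX d i)) / S (obsX d i) else 0)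
      = - (\<Sum>i<n. if obsX d i < z then W n d (obsX d i) / risk n d (obsX d i) else 0)"
    unfolding sum_negf[symmetric] by (intro sum.cong refl) (simp add: W_def mult.commute)
  then show "W n d z = 1 - (\<Sum>i<n. if obsX d i < z then W n d (obsX d i) / risk n d (obsX d i) else 0)
        + (\<integral>u. (if u < z then W n d u / S u else 0) \<partial>\<mu>)"
    unfolding eq using J(2) by (simp add: W_def)
qed

lemma last_obs:
  assumes "good n d" "n > 0"
  obtains m where "S m > 0" "\<And>z. m < z \<Longrightarrow> B n d z = 0" "\<And>i. i < n \<Longrightarrow> obsX d i \<le> m"
proof -
  define m where "m = Max (obsX d ` {..<n})"
  have "m \<in> obsX d ` {..<n}" unfolding m_def by (rule Max_in) (use assms in auto)
  then obtain i where i: "i < n" "m = obsX d i" by auto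
  have le: "obsX d j \<le> m" if "j < n" for j unfolding m_def using that by (intro Max_ge) auto
  show ?thesis
  proof (rule that[of m])
    show "S m > 0" using assms i by (auto simp: good_def)
    show "obsX d i \<le> m" if "i < n" for i by (rule le[OF that])
    fix z assume z: "m < z"
    have "\<not> risk n d z > 0" using le z unfolding risk_pos_iff by force
    then have "risk n d z = 0" using risk_nonneg[of n d z] by simp
    moreover have "obsY d i \<le> z" using assms i z by (force simp: good_def)
    then have "\<not> waiting n d z" using i(1) by (auto simp: waiting_def not_less)
    ultimately show "B n d z = 0" using B_hole[OF assms(1)] by simp
  qed
qed

subsection \<open>Duhamel's equation\<close>

text \<open>With \<open>tail \<phi> z = \<integral> \<phi> dF\<close> over \<open>(z, \<infinity>)\<close>, the following \<open>\<Psi> \<phi>\<close> is the function \<open>\<psi>\<close> of the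
theorem.\<close>

definition tail :: "(real \<Rightarrow> real) \<Rightarrow> real \<Rightarrow> real" where
  "tail \<phi> z = (\<integral>x. (if z < x then \<phi> x else 0) \<partial>\<mu>)"

definition \<Psi> :: "(real \<Rightarrow> real) \<Rightarrow> real \<Rightarrow> real" where
  "\<Psi> \<phi> z = \<phi> z * S z - tail \<phi> z"

lemma measurable_tail[measurable]:
  assumes [measurable]: "\<phi> \<in> borel_measurable borel" shows "tail \<phi> \<in> borel_measurable borel"
  unfolding tail_def[abs_def] by measurable

lemma measurable_\<Psi>[measurable]:
  assumes [measurable]: "\<phi> \<in> borel_measurable borel" shows "\<Psi> \<phi> \<in> borel_measurable borel"
  unfolding \<Psi>_def[abs_def] by measurable

lemma tail_bound:
  assumes \<phi>: "integrable \<mu> \<phi>" shows "\<bar>tail \<phi> z\<bar> \<le> (\<integral>x. \<bar>\<phi> x\<bar> \<partial>\<mu>)"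
proof -
  note [measurable] = borel_measurable_integrable[OF \<phi>]
  have "norm (tail \<phi> z) \<le> (\<integral>x. \<bar>\<phi> x\<bar> \<partial>\<mu>)"
    unfolding tail_def
    by (rule order_trans[OF integral_norm_bound], rule integral_mono)
       (auto intro!: integrable_norm Bochner_Integration.integrable_bound[OF \<phi>] integrable_abs \<phi>)
  then show ?thesis by simp
qed

text \<open>The integral \<open>\<integral> \<phi> dF\<^sub>n\<close> for samples without ties.\<close>

definition pl_integral :: "(real \<Rightarrow> real) \<Rightarrow> nat \<Rightarrow> sample \<Rightarrow> real" where
  "pl_integral \<phi> n d = (\<Sum>i<n. \<phi> (obsX d i) * B n d (obsX d i) / risk n d (obsX d i))"

text \<open>Write \<open>\<phi> dF\<^sub>n = \<phi> S W d\<Lambda>\<^sub>n\<close> and \<open>\<psi> = \<phi> S - tail \<phi>\<close>. The terms with \<open>tail \<phi>\<close> become, by Fubini,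
the integral of \<open>\<phi>(x)\<close> against the integral of \<open>W d(\<Lambda>\<^sub>n - \<Lambda>)\<close> over \<open>(-\<infinity>, x)\<close>, which is
\<open>1 - W(x)\<close> by \<open>W_identity\<close>. Everything is integrable because \<open>W\<close> vanishes after the last death.\<close>

lemma duhamel:
  assumes g: "good n d" and n: "n > 0" and \<phi>: "integrable \<mu> \<phi>" and d[measurable]: "d \<in> space (D n)"
  shows "integrable \<mu> (\<lambda>z. \<Psi> \<phi> z * W n d z / S z)"
    and "pl_integral \<phi> n d - (\<integral>x. \<phi> x \<partial>\<mu>) = (\<Sum>i<n. \<Psi> \<phi> (obsX d i) * W n d (obsX d i) / risk n d (obsX d i))
      - (\<integral>z. \<Psi> \<phi> z * W n d z / S z \<partial>\<mu>)"
proof -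
  let ?V = "\<lambda>x. (\<integral>u. (if u < x then W n d u / S u else 0) \<partial>\<mu>)"
  interpret \<mu>\<mu>: pair_prob_space \<mu> \<mu> ..
  have [measurable]: "\<phi> \<in> borel_measurable borel" using borel_measurable_integrable[OF \<phi>] by simp
  obtain m where m: "S m > 0" "\<And>z. m < z \<Longrightarrow> B n d z = 0" "\<And>i. i < n \<Longrightarrow> obsX d i \<le> m"
    by (rule last_obs[OF g n]) blast
  have W0: "W n d z = 0" if "m < z" for z using m(2)[OF that] by (simp add: W_def)
  have Wle: "\<bar>W n d z\<bar> \<le> 1 / S m" for z
  proof (cases "m < z")
    case False
    then show ?thesis using m(1) S_antimono[of z m] B_nonneg[OF g, of z] B_le_1[OF g, of z] S_nonneg[of z]
      unfolding W_def by (auto intro!: frac_le)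
  qed (use W0 m(1) in auto)
  have WSle: "\<bar>W n d z / S z\<bar> \<le> 1 / S m * (1 / S m)" for z
  proof (cases "m < z")
    case False
    have "\<bar>W n d z\<bar> * (1 / S z) \<le> 1 / S m * (1 / S m)"
      using Wle[of z] m(1) S_antimono[of z m] False by (intro mult_mono) (auto intro!: frac_le)
    then show ?thesis by (simp add: S_nonneg)
  qed (use W0 m(1) in auto)
  have int_\<phi>W: "integrable \<mu> (\<lambda>z. \<phi> z * W n d z)"
  proof (rule Bochner_Integration.integrable_bound[OF integrable_mult_left[OF \<phi>, of "1 / S m"]])
    show "AE z in \<mu>. norm (\<phi> z * W n d z) \<le> norm (\<phi> z * (1 / S m))"
    proof (rule AE_I2)
      fix z
      have "\<bar>\<phi> z\<bar> * \<bar>W n d z\<bar> \<le> \<bar>\<phi> z\<bar> * \<bar>1 / S m\<bar>"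
        using Wle[of z] m(1) by (intro mult_left_mono) auto
      then show "norm (\<phi> z * W n d z) \<le> norm (\<phi> z * (1 / S m))"
        by (simp only: real_norm_def abs_mult)
    qed
  qed measurable
  have int_WS: "integrable \<mu> (\<lambda>z. W n d z / S z)"
    by (rule \<mu>.integrable_const_bound[where B = "1 / S m * (1 / S m)"]) (use WSle in auto)
  have int_tW: "integrable \<mu> (\<lambda>z. tail \<phi> z * (W n d z / S z))"
  proof (rule Bochner_Integration.integrable_bound[OF integrable_mult_right[OF int_WS, of "\<integral>x. \<bar>\<phi> x\<bar> \<partial>\<mu>"]])
    show "AE z in \<mu>. norm (tail \<phi> z * (W n d z / S z)) \<le> norm ((\<integral>x. \<bar>\<phi> x\<bar> \<partial>\<mu>) * (W n d z / S z))"
    proof (rule AE_I2)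
      fix z
      have "\<bar>tail \<phi> z\<bar> * \<bar>W n d z / S z\<bar> \<le> \<bar>\<integral>x. \<bar>\<phi> x\<bar> \<partial>\<mu>\<bar> * \<bar>W n d z / S z\<bar>"
        using tail_bound[OF \<phi>, of z] by (intro mult_right_mono) auto
      then show "norm (tail \<phi> z * (W n d z / S z)) \<le> norm ((\<integral>x. \<bar>\<phi> x\<bar> \<partial>\<mu>) * (W n d z / S z))"
        by (simp only: real_norm_def abs_mult)
    qed
  qed measurable
  have split: "AE z in \<mu>. \<Psi> \<phi> z * W n d z / S z = \<phi> z * W n d z - tail \<phi> z * (W n d z / S z)"
    using AE_S_pos by eventually_elim (simp add: \<Psi>_def field_simps)
  have int_diff: "integrable \<mu> (\<lambda>z. \<phi> z * W n d z - tail \<phi> z * (W n d z / S z))"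
    by (intro Bochner_Integration.integrable_diff int_\<phi>W int_tW)
  show int: "integrable \<mu> (\<lambda>z. \<Psi> \<phi> z * W n d z / S z)"
    by (subst integrable_cong_AE[OF _ _ split]) (use int_diff in auto)
  have pair: "integrable (\<mu> \<Otimes>\<^sub>M \<mu>) (\<lambda>p. \<phi> (fst p) * (W n d (snd p) / S (snd p)))"
    by (rule integrable_tensor[OF \<mu>.prob_space_axioms \<phi> int_WS])
  have pair_lt: "integrable (\<mu> \<Otimes>\<^sub>M \<mu>) (\<lambda>(z, x). if z < x then \<phi> x * (W n d z / S z) else 0)"
  proof -
    have "integrable (\<mu> \<Otimes>\<^sub>M \<mu>) (\<lambda>(z, x). \<phi> x * (W n d z / S z))"
      using \<mu>\<mu>.integrable_product_swap[OF pair] by (simp add: case_prod_beta')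
    then show ?thesis
      by (rule Bochner_Integration.integrable_bound) (auto simp: case_prod_beta')
  qed
  have fub: "(\<integral>z. tail \<phi> z * (W n d z / S z) \<partial>\<mu>) = (\<integral>x. \<phi> x * (?V x) \<partial>\<mu>)"
  proof -
    have "(\<integral>z. tail \<phi> z * (W n d z / S z) \<partial>\<mu>) = (\<integral>z. (\<integral>x. (if z < x then \<phi> x * (W n d z / S z) else 0) \<partial>\<mu>) \<partial>\<mu>)"
      unfolding tail_def integral_mult_left_zero[symmetric]
      by (intro Bochner_Integration.integral_cong refl) auto
    also have "\<dots> = (\<integral>x. (\<integral>z. (if z < x then \<phi> x * (W n d z / S z) else 0) \<partial>\<mu>) \<partial>\<mu>)"
      using \<mu>\<mu>.Fubini_integral[OF pair_lt] by simp
    also have "\<dots> = (\<integral>x. \<phi> x * (?V x) \<partial>\<mu>)"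
      unfolding integral_mult_right_zero[symmetric]
      by (intro Bochner_Integration.integral_cong refl) auto
    finally show ?thesis .
  qed
  let ?w = "\<lambda>i. W n d (obsX d i) / risk n d (obsX d i)"
  have int_gt: "integrable \<mu> (\<lambda>x. if c < x then \<phi> x else 0)" for c
    by (rule Bochner_Integration.integrable_bound[OF \<phi>]) auto
  have jumps_int: "integrable \<mu> (\<lambda>x. \<phi> x * (\<Sum>i<n. if obsX d i < x then ?w i else 0))"
    and jumps: "(\<Sum>i<n. ?w i * tail \<phi> (obsX d i)) = (\<integral>x. \<phi> x * (\<Sum>i<n. if obsX d i < x then ?w i else 0) \<partial>\<mu>)"
  proof -
    have eq: "(\<lambda>x. \<phi> x * (\<Sum>i<n. if obsX d i < x then ?w i else 0)) = (\<lambda>x. \<Sum>i<n. ?w i * (if obsX d i < x then \<phi> x else 0))"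
      by (auto simp: fun_eq_iff sum_distrib_left intro!: sum.cong)
    show "integrable \<mu> (\<lambda>x. \<phi> x * (\<Sum>i<n. if obsX d i < x then ?w i else 0))"
      unfolding eq by (intro Bochner_Integration.integrable_sum integrable_mult_right int_gt)
    show "(\<Sum>i<n. ?w i * tail \<phi> (obsX d i)) = (\<integral>x. \<phi> x * (\<Sum>i<n. if obsX d i < x then ?w i else 0) \<partial>\<mu>)"
      unfolding eq tail_def
      by (subst Bochner_Integration.integral_sum) (intro integrable_mult_right int_gt, simp)
  qed
  have int_cont: "integrable \<mu> (\<lambda>x. \<phi> x * (?V x))"
  proof -
    have "integrable \<mu> (\<lambda>x. \<integral>z. (if z < x then \<phi> x * (W n d z / S z) else 0) \<partial>\<mu>)"
      using \<mu>\<mu>.integrable_snd[OF pair_lt] by simp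
    moreover have "(\<integral>z. (if z < x then \<phi> x * (W n d z / S z) else 0) \<partial>\<mu>)
        = \<phi> x * (?V x)" for x
      unfolding integral_mult_right_zero[symmetric]
      by (intro Bochner_Integration.integral_cong refl) auto
    ultimately show ?thesis by simp
  qed
  have total: "(\<integral>x. \<phi> x * (\<Sum>i<n. if obsX d i < x then ?w i else 0) \<partial>\<mu>) + (\<integral>z. \<phi> z * W n d z \<partial>\<mu>)
      - (\<integral>x. \<phi> x * (?V x) \<partial>\<mu>) = (\<integral>x. \<phi> x \<partial>\<mu>)"
  proof -
    have "(\<integral>x. \<phi> x * (\<Sum>i<n. if obsX d i < x then ?w i else 0) \<partial>\<mu>) + (\<integral>z. \<phi> z * W n d z \<partial>\<mu>)
      - (\<integral>x. \<phi> x * (?V x) \<partial>\<mu>)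
      = (\<integral>x. \<phi> x * (\<Sum>i<n. if obsX d i < x then ?w i else 0) + \<phi> x * W n d x
         - \<phi> x * (?V x) \<partial>\<mu>)"
      by (subst Bochner_Integration.integral_diff, intro Bochner_Integration.integrable_add jumps_int int_\<phi>W, rule int_cont,
          subst Bochner_Integration.integral_add, rule jumps_int, rule int_\<phi>W, rule refl)
    also have "\<dots> = (\<integral>x. \<phi> x \<partial>\<mu>)"
    proof (rule integral_cong_AE)
      show "AE x in \<mu>. \<phi> x * (\<Sum>i<n. if obsX d i < x then ?w i else 0) + \<phi> x * W n d x
         - \<phi> x * (?V x) = \<phi> x"
        using AE_S_pos
      proof eventually_elim
        fix x assume "0 < S x"
        from W_identity(2)[OF g this]
        have "(\<Sum>i<n. if obsX d i < x then ?w i else 0) + W n d x - (?V x) = 1"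
          by simp
        then have "\<phi> x * ((\<Sum>i<n. if obsX d i < x then ?w i else 0) + W n d x - (?V x)) = \<phi> x"
          by simp
        then show "\<phi> x * (\<Sum>i<n. if obsX d i < x then ?w i else 0) + \<phi> x * W n d x
         - \<phi> x * (?V x) = \<phi> x"
          by (simp only: distrib_left right_diff_distrib)
      qed
    next
      show "(\<lambda>x. \<phi> x * (\<Sum>i<n. if obsX d i < x then ?w i else 0) + \<phi> x * W n d x
         - \<phi> x * (?V x)) \<in> borel_measurable \<mu>"
        by (intro borel_measurable_integrable Bochner_Integration.integrable_add
            Bochner_Integration.integrable_diff jumps_int int_\<phi>W int_cont)
    qed measurable
    finally show ?thesis .
  qed
  have sum_eq: "(\<Sum>i<n. \<Psi> \<phi> (obsX d i) * W n d (obsX d i) / risk n d (obsX d i))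
      = pl_integral \<phi> n d - (\<Sum>i<n. ?w i * tail \<phi> (obsX d i))"
    unfolding pl_integral_def sum_subtractf[symmetric]
  proof (intro sum.cong refl)
    fix i assume "i \<in> {..<n}"
    then have "S (obsX d i) > 0" using g by (auto simp: good_def)
    then show "\<Psi> \<phi> (obsX d i) * W n d (obsX d i) / risk n d (obsX d i) =
       \<phi> (obsX d i) * B n d (obsX d i) / risk n d (obsX d i) - ?w i * tail \<phi> (obsX d i)"
      by (simp add: \<Psi>_def W_def diff_divide_distrib right_diff_distrib mult_ac)
  qed
  have "(\<integral>z. \<Psi> \<phi> z * W n d z / S z \<partial>\<mu>) = (\<integral>z. \<phi> z * W n d z - tail \<phi> z * (W n d z / S z) \<partial>\<mu>)"
    by (rule integral_cong_AE[OF _ _ split]) measurable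
  also have "\<dots> = (\<integral>z. \<phi> z * W n d z \<partial>\<mu>) - (\<integral>z. tail \<phi> z * (W n d z / S z) \<partial>\<mu>)"
    by (rule Bochner_Integration.integral_diff[OF int_\<phi>W int_tW])
  finally show "pl_integral \<phi> n d - (\<integral>x. \<phi> x \<partial>\<mu>) = (\<Sum>i<n. \<Psi> \<phi> (obsX d i) * W n d (obsX d i) / risk n d (obsX d i))
      - (\<integral>z. \<Psi> \<phi> z * W n d z / S z \<partial>\<mu>)"
    using sum_eq jumps fub total by linarith
qed

end

section \<open>Moments of the counts\<close>

context left_truncation
begin

text \<open>The number of observations in \<open>E\<close>; the size of the risk set is a special case.\<close>

definition cnt :: "nat \<Rightarrow> (real \<times> real \<Rightarrow> bool) \<Rightarrow> sample \<Rightarrow> real" where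
  "cnt n E d = (\<Sum>i<n. if E (d i) then 1 else 0)"

lemma risk_cnt: "risk n d z = cnt n (\<lambda>p. snd p \<le> z \<and> z \<le> fst p) d"
  by (simp add: risk_def cnt_def obsX_def obsY_def)

lemma cnt_nonneg: "0 \<le> cnt n E d"
  unfolding cnt_def by (intro sum_nonneg) auto

lemma cnt_le: "cnt n E d \<le> n"
proof -
  have "cnt n E d \<le> (\<Sum>i<n. 1)" unfolding cnt_def by (intro sum_mono) auto
  then show ?thesis by simp
qed

lemma cnt_ge_1: "cnt n E d > 0 \<Longrightarrow> cnt n E d \<ge> 1"
proof -
  have "cnt n E d = real (\<Sum>i<n. if E (d i) then 1 else 0)"
    unfolding cnt_def of_nat_sum by (intro sum.cong) auto
  then obtain N where "cnt n E d = real N" by blast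
  then show "cnt n E d > 0 \<Longrightarrow> cnt n E d \<ge> 1" by (cases N) auto
qed

lemma measurable_pred_coord:
  assumes E[measurable]: "Measurable.pred (borel \<Otimes>\<^sub>M borel) E" and i: "i \<in> {..<n}"
  shows "Measurable.pred (D n) (\<lambda>d. E (d i))"
proof -
  have "(\<lambda>d. E (obsX d i, obsY d i)) \<in> D n \<rightarrow>\<^sub>M count_space UNIV"
    using i by (intro measurable_compose[OF _ E] measurable_Pair) measurable
  then show ?thesis by (simp add: obsX_def obsY_def)
qed

lemma measurable_cnt[measurable]:
  assumes [measurable]: "Measurable.pred (borel \<Otimes>\<^sub>M borel) E"
  shows "cnt n E \<in> borel_measurable (D n)"
proof -
  have "(\<lambda>d. if E (d i) then 1 else 0 :: real) \<in> borel_measurable (D n)" if "i \<in> {..<n}" for i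
    using measurable_pred_coord[OF assms that] by (intro measurable_If) (simp_all add: pred_def)
  then show ?thesis unfolding cnt_def[abs_def] by (rule borel_measurable_sum)
qed

lemma nn_integral_prod_D:
  assumes "\<And>i. i < n \<Longrightarrow> f i \<in> borel_measurable (borel \<Otimes>\<^sub>M borel)"
  shows "(\<integral>\<^sup>+d. (\<Prod>i<n. f i (d i)) \<partial>D n) = (\<Prod>i<n. integral\<^sup>N H (f i))"
proof -
  interpret product_sigma_finite "\<lambda>_. H" ..
  show ?thesis unfolding D_def
    by (rule product_nn_integral_prod) (use assms measurable_cong_sets[OF sets_H refl] in auto)
qed

lemma emeasure_H_pred:
  assumes [measurable]: "Measurable.pred (borel \<Otimes>\<^sub>M borel) E"
  shows "(\<integral>\<^sup>+q. (if E q then 1 else 0) \<partial>H) = ennreal (measure H {q. E q})"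
proof -
  have S: "{q. E q} \<in> sets H"
    using pred_sets2[of UNIV] assms unfolding sets_H pred_def by (simp add: space_pair_measure)
  have "(\<integral>\<^sup>+q. (if E q then 1 else 0) \<partial>H) = (\<integral>\<^sup>+q. indicator {q. E q} q \<partial>H)"
    by (intro nn_integral_cong) (auto split: split_indicator)
  also have "\<dots> = emeasure H {q. E q}" by (rule nn_integral_indicator[OF S])
  finally show ?thesis by (simp add: H.emeasure_eq_measure)
qed

lemma emeasure_H_pred_mix:
  assumes [measurable]: "Measurable.pred (borel \<Otimes>\<^sub>M borel) E" and t: "0 \<le> t"
  shows "(\<integral>\<^sup>+q. (if E q then ennreal t else 1) \<partial>H) = ennreal (1 - measure H {q. E q} + measure H {q. E q} * t)"
proof -
  let ?p = "measure H {q. E q}"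
  have S: "{q. E q} \<in> sets H"
    using assms unfolding sets_H pred_def by (simp add: space_pair_measure)
  have comp: "measure H {q. \<not> E q} = 1 - ?p"
    using H.prob_compl[OF S] by (simp add: Collect_neg_eq Compl_eq_Diff_UNIV)
  have "(\<integral>\<^sup>+q. (if E q then ennreal t else 1) \<partial>H)
      = (\<integral>\<^sup>+q. (if E q then 1 else 0) * ennreal t + (if \<not> E q then 1 else 0) \<partial>H)"
    by (intro nn_integral_cong) auto
  also have "\<dots> = ennreal ?p * ennreal t + ennreal (1 - ?p)"
    by (subst nn_integral_add, measurable, subst nn_integral_multc, measurable,
        subst emeasure_H_pred, measurable, subst emeasure_H_pred, measurable, simp add: comp)
  also have "\<dots> = ennreal (1 - ?p + ?p * t)"
    using t by (simp add: ennreal_mult[symmetric] ennreal_plus[symmetric] add.commute del: ennreal_plus)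
  finally show ?thesis .
qed

text \<open>The probability generating function of a binomial count. All further information on the law of counts is extracted from it
or from first and second moments.\<close>

lemma pgf:
  assumes E[measurable]: "Measurable.pred (borel \<Otimes>\<^sub>M borel) E" and t: "0 \<le> t"
  shows "(\<integral>\<^sup>+d. (\<Prod>i<n. if E (d i) then ennreal t else 1) \<partial>D n)
    = ennreal ((1 - measure H {q. E q} + measure H {q. E q} * t) ^ n)"
proof -
  have "(\<integral>\<^sup>+d. (\<Prod>i<n. if E (d i) then ennreal t else 1) \<partial>D n) = (\<Prod>i<n. \<integral>\<^sup>+q. (if E q then ennreal t else 1) \<partial>H)"
    by (rule nn_integral_prod_D) measurable
  also have "\<dots> = ennreal ((1 - measure H {q. E q} + measure H {q. E q} * t) ^ n)"
  proof -
    have "0 \<le> 1 - measure H {q. E q} + measure H {q. E q} * t"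
      using t H.prob_le_1[of "{q. E q}"] by (simp add: add_nonneg_nonneg)
    then show ?thesis
      unfolding emeasure_H_pred_mix[OF E t] prod_constant card_lessThan by (rule ennreal_power)
  qed
  finally show ?thesis .
qed

lemma prod_powr_cnt: "t > 0 \<Longrightarrow> (\<Prod>i<n. if E (d i) then ennreal t else 1) = ennreal (t powr cnt n E d)"
proof -
  assume t: "t > 0"
  have "(\<Prod>i<n. if E (d i) then ennreal t else 1) = (\<Prod>i<n. ennreal (t powr (if E (d i) then 1 else 0)))"
    using t by (intro prod.cong) auto
  also have "\<dots> = ennreal (t powr cnt n E d)"
    unfolding cnt_def using t by (subst prod_ennreal) (auto simp: powr_sum)
  finally show ?thesis .
qed

lemma prob_none:
  assumes E[measurable]: "Measurable.pred (borel \<Otimes>\<^sub>M borel) E"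
  shows "(\<integral>\<^sup>+d. (if \<forall>i<n. \<not> E (d i) then 1 else 0) \<partial>D n) = ennreal ((1 - measure H {q. E q}) ^ n)"
proof -
  have "(\<integral>\<^sup>+d. (if \<forall>i<n. \<not> E (d i) then 1 else 0) \<partial>D n) = (\<integral>\<^sup>+d. (\<Prod>i<n. if E (d i) then ennreal 0 else 1) \<partial>D n)"
    by (intro nn_integral_cong) (auto simp: prod_zero_iff intro!: prod.neutral)
  then show ?thesis using pgf[OF E, of 0 n] by simp
qed

text \<open>Since \<open>1/(N+1)\<close> is the integral of \<open>t\<^sup>N\<close> over the unit interval, the inverse moment is an
integral of the generating function.\<close>

lemma inverse_moment:
  assumes E[measurable]: "Measurable.pred (borel \<Otimes>\<^sub>M borel) E" and p: "measure H {q. E q} > 0"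
  shows "(\<integral>\<^sup>+d. ennreal (if cnt n E d > 0 then 1 / cnt n E d else 0) \<partial>D n) \<le> ennreal (2 / (Suc n * measure H {q. E q}))"
proof -
  let ?p = "measure H {q. E q}"
  interpret DL: pair_sigma_finite "D n" lborel ..
  have 1: "(\<integral>\<^sup>+t. indicator {0..1} t * ennreal (t powr cnt n E d) \<partial>lborel) = ennreal (1 / (cnt n E d + 1))" for d
    using nn_integral_has_integral_lebesgue[OF _ has_integral_powr_from_0[of "cnt n E d" 1]] cnt_nonneg[of n E d]
    by (simp add: indicator_mult_ennreal)
  have "(\<integral>\<^sup>+d. ennreal (1 / (cnt n E d + 1)) \<partial>D n) = (\<integral>\<^sup>+d. \<integral>\<^sup>+t. indicator {0..1} t * ennreal (t powr cnt n E d) \<partial>lborel \<partial>D n)"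
    by (simp add: 1)
  also have "\<dots> = (\<integral>\<^sup>+t. \<integral>\<^sup>+d. indicator {0..1} t * ennreal (t powr cnt n E d) \<partial>D n \<partial>lborel)"
    by (rule DL.Fubini'[symmetric]) measurable
  also have "\<dots> = (\<integral>\<^sup>+t. ennreal ((1 - ?p + ?p * t) ^ n) * indicator {0..1} t \<partial>lborel)"
  proof (rule nn_integral_cong_AE, use AE_lborel_singleton[of 0] in eventually_elim)
    fix t :: real assume "t \<noteq> 0"
    show "(\<integral>\<^sup>+d. indicator {0..1} t * ennreal (t powr cnt n E d) \<partial>D n) = ennreal ((1 - ?p + ?p * t) ^ n) * indicator {0..1} t"
    proof (cases "t \<in> {0..1}")
      case True
      with \<open>t \<noteq> 0\<close> have t: "t > 0" by simp
      then show ?thesis using True pgf[OF E, of t n] by (simp add: prod_powr_cnt)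
    qed simp
  qed
  also have "\<dots> = ennreal ((1 - ?p + ?p * 1) ^ Suc n / (Suc n * ?p) - (1 - ?p + ?p * 0) ^ Suc n / (Suc n * ?p))"
  proof (rule nn_integral_FTC_Icc[where F = "\<lambda>t. (1 - ?p + ?p * t) ^ Suc n / (Suc n * ?p)"])
    fix t :: real assume "t \<in> {0..1}"
    show "((\<lambda>t. (1 - ?p + ?p * t) ^ Suc n / (real (Suc n) * ?p)) has_real_derivative (1 - ?p + ?p * t) ^ n) (at t)"
      using p by (auto intro!: derivative_eq_intros simp del: of_nat_Suc power_Suc simp: field_simps)
  qed (use H.prob_le_1 in auto)
  also have "\<dots> \<le> ennreal (1 / (Suc n * ?p))"
    using p H.prob_le_1[of "{q. E q}"] by (intro ennreal_leI) (simp del: of_nat_Suc)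
  finally have 2: "(\<integral>\<^sup>+d. ennreal (1 / (cnt n E d + 1)) \<partial>D n) \<le> ennreal (1 / (Suc n * ?p))" .
  have "(\<integral>\<^sup>+d. ennreal (if cnt n E d > 0 then 1 / cnt n E d else 0) \<partial>D n)
      \<le> (\<integral>\<^sup>+d. ennreal 2 * ennreal (1 / (cnt n E d + 1)) \<partial>D n)"
  proof (rule nn_integral_mono)
    fix d
    have "(if cnt n E d > 0 then 1 / cnt n E d else 0) \<le> 2 * (1 / (cnt n E d + 1))"
      using cnt_ge_1[of n E d] cnt_nonneg[of n E d] by (auto simp: field_simps)
    then show "ennreal (if cnt n E d > 0 then 1 / cnt n E d else 0) \<le> ennreal 2 * ennreal (1 / (cnt n E d + 1))"
      by (subst ennreal_mult[symmetric]) (auto intro!: ennreal_leI simp: cnt_nonneg add_nonneg_nonneg)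
  qed
  also have "\<dots> \<le> ennreal 2 * ennreal (1 / (Suc n * ?p))"
    by (subst nn_integral_cmult, measurable) (intro mult_left_mono 2, simp)
  also have "\<dots> = ennreal (2 / (Suc n * ?p))"
    using p by (subst ennreal_mult[symmetric]) auto
  finally show ?thesis .
qed

lemma ennreal_cnt: "ennreal (cnt n E d) = (\<Sum>i<n. if E (d i) then 1 else 0)"
proof -
  have "(\<Sum>i<n. if E (d i) then 1 else 0) = (\<Sum>i<n. ennreal (if E (d i) then 1 else 0))"
    by (intro sum.cong) auto
  also have "\<dots> = ennreal (cnt n E d)" unfolding cnt_def by (rule sum_ennreal) auto
  finally show ?thesis by simp
qed

lemma cnt_first_moment:
  assumes E[measurable]: "Measurable.pred (borel \<Otimes>\<^sub>M borel) E"
  shows "(\<integral>\<^sup>+d. ennreal (cnt n E d) \<partial>D n) = ennreal (n * measure H {q. E q})"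
proof -
  have one: "(\<integral>\<^sup>+d. (if E (d i) then 1 else 0) \<partial>D n) = ennreal (measure H {q. E q})" if "i < n" for i
  proof -
    have "(\<integral>\<^sup>+d. (if E (d i) then 1 else 0) \<partial>D n) = (\<integral>\<^sup>+d. (\<Prod>j<n. if j = i then if E (d j) then 1 else 0 else 1) \<partial>D n)"
      using that by (intro nn_integral_cong) (simp add: prod.delta)
    also have "\<dots> = (\<Prod>j<n. \<integral>\<^sup>+q. (if j = i then if E q then 1 else 0 else 1) \<partial>H)"
      by (rule nn_integral_prod_D) measurable
    also have "\<dots> = (\<Prod>j<n. if j = i then \<integral>\<^sup>+q. (if E q then 1 else 0) \<partial>H else 1)"
      by (intro prod.cong refl) (auto simp: H.emeasure_space_1[simplified])
    also have "\<dots> = ennreal (measure H {q. E q})"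
      using that by (simp add: prod.delta emeasure_H_pred)
    finally show ?thesis .
  qed
  have "(\<integral>\<^sup>+d. ennreal (cnt n E d) \<partial>D n) = (\<integral>\<^sup>+d. (\<Sum>i<n. if E (d i) then 1 else 0) \<partial>D n)"
    by (simp only: ennreal_cnt)
  also have "\<dots> = (\<Sum>i<n. \<integral>\<^sup>+d. (if E (d i) then 1 else 0) \<partial>D n)"
    by (rule nn_integral_sum, intro measurable_If)
       (use measurable_pred_coord[OF E] in \<open>simp_all add: pred_def\<close>)
  also have "\<dots> = (\<Sum>i<n. ennreal (measure H {q. E q}))"
    by (intro sum.cong refl one) auto
  also have "\<dots> = ennreal (n * measure H {q. E q})"
    by (simp add: ennreal_mult ennreal_of_nat_eq_real_of_nat)
  finally show ?thesis .
qed

text \<open>The bound \<open>n\<close> is crude: the variance is \<open>n p (1 - p)\<close>.\<close>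

lemma cnt_second_moment:
  assumes E[measurable]: "Measurable.pred (borel \<Otimes>\<^sub>M borel) E"
  shows "(\<integral>d. (cnt n E d - n * measure H {q. E q})\<^sup>2 \<partial>D n) \<le> n"
proof -
  let ?p = "measure H {q. E q}"
  define e where "e i d = (if E (d i) then 1 else 0 :: real)" for i and d :: sample
  have e_meas[measurable]: "e i \<in> borel_measurable (D n)" if "i < n" for i
    unfolding e_def[abs_def] using measurable_pred_coord[OF E, of i n] that
    by (intro measurable_If) (simp_all add: pred_def)
  have ee_meas: "(\<lambda>d. e i d * e j d) \<in> borel_measurable (D n)" if "i < n" "j < n" for i j
    by (intro borel_measurable_times e_meas that)
  have int_e: "integrable (D n) (\<lambda>d. e i d * e j d)" if "i < n" "j < n" for i j
    by (rule D.integrable_const_bound[where B = 1, OF _ ee_meas[OF that]]) (simp add: e_def)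
  have mixed: "(\<integral>d. e i d * e j d \<partial>D n) = ?p * ?p" if "i < n" "j < n" "i \<noteq> j" for i j
  proof -
    have "(\<integral>\<^sup>+d. ennreal (e i d * e j d) \<partial>D n) = (\<integral>\<^sup>+d. (\<Prod>k<n. if k = i \<or> k = j then if E (d k) then 1 else 0 else 1) \<partial>D n)"
    proof (rule nn_integral_cong)
      fix d :: sample
      have "(\<Prod>k<n. if k = i \<or> k = j then if E (d k) then 1 else 0 else 1)
         = (\<Prod>k<n. (if k = i then if E (d k) then 1 else 0 else 1) * (if k = j then if E (d k) then 1 else (0::ennreal) else 1))"
        using that by (intro prod.cong) auto
      then show "ennreal (e i d * e j d) = (\<Prod>k<n. if k = i \<or> k = j then if E (d k) then 1 else 0 else 1)"
        using that by (simp add: prod.distrib prod.delta e_def)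
    qed
    also have "\<dots> = (\<Prod>k<n. \<integral>\<^sup>+q. (if k = i \<or> k = j then if E q then 1 else 0 else 1) \<partial>H)"
      by (rule nn_integral_prod_D) measurable
    also have "\<dots> = (\<Prod>k<n. (if k = i then \<integral>\<^sup>+q. (if E q then 1 else 0) \<partial>H else 1) * (if k = j then \<integral>\<^sup>+q. (if E q then 1 else 0) \<partial>H else 1))"
      using that by (intro prod.cong refl) (auto simp: H.emeasure_space_1[simplified])
    also have "\<dots> = ennreal (?p * ?p)"
      using that by (simp add: prod.distrib prod.delta emeasure_H_pred ennreal_mult)
    finally show ?thesis
      by (subst integral_eq_nn_integral[OF ee_meas[OF that(1,2)]]) (simp_all add: e_def)
  qed
  have single: "(\<integral>d. e i d * e i d \<partial>D n) \<le> 1" if "i < n" for i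
    using integral_mono[OF int_e[OF that that] D.integrable_const[of n "1"], of ] D.prob_space[of n]
    by (auto simp: e_def)
  have first: "(\<integral>d. cnt n E d \<partial>D n) = n * ?p"
    by (subst integral_eq_nn_integral) (auto simp: cnt_first_moment cnt_nonneg)
  have int_cnt: "integrable (D n) (cnt n E)"
    by (rule D.integrable_const_bound[where B = n]) (use cnt_nonneg cnt_le in auto)
  have sq_eq: "(cnt n E d)\<^sup>2 = (\<Sum>i<n. \<Sum>j<n. e i d * e j d)" for d
    by (simp add: cnt_def e_def power2_eq_square sum_product)
  have int_sq: "integrable (D n) (\<lambda>d. (cnt n E d)\<^sup>2)"
    unfolding sq_eq by (intro Bochner_Integration.integrable_sum int_e) auto
  have "(\<integral>d. (cnt n E d)\<^sup>2 \<partial>D n) = (\<Sum>i<n. \<Sum>j<n. \<integral>d. e i d * e j d \<partial>D n)"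
    unfolding sq_eq using int_e
    by (subst Bochner_Integration.integral_sum) (auto intro!: Bochner_Integration.integrable_sum sum.cong Bochner_Integration.integral_sum)
  also have "\<dots> \<le> (\<Sum>i<n. \<Sum>j<n. ?p * ?p + (if i = j then 1 else 0))"
    using mixed single by (intro sum_mono) (auto simp: add_increasing)
  also have "\<dots> = (n * ?p)\<^sup>2 + n"
    by (simp add: sum.distrib power2_eq_square algebra_simps)
  finally have second: "(\<integral>d. (cnt n E d)\<^sup>2 \<partial>D n) \<le> (n * ?p)\<^sup>2 + n" .
  have "(\<integral>d. (cnt n E d - n * ?p)\<^sup>2 \<partial>D n) = (\<integral>d. (cnt n E d)\<^sup>2 - 2 * (n * ?p) * cnt n E d + (n * ?p)\<^sup>2 \<partial>D n)"
    by (simp add: power2_eq_square algebra_simps)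
  also have "\<dots> = (\<integral>d. (cnt n E d)\<^sup>2 \<partial>D n) - 2 * (n * ?p) * (n * ?p) + (n * ?p)\<^sup>2"
    using int_sq int_cnt D.prob_space[of n] by (simp add: first)
  also have "\<dots> \<le> n" using second by (simp add: power2_eq_square algebra_simps)
  finally show ?thesis .
qed

text \<open>Where the empirical frequency \<open>N/n\<close> is at least \<open>p/2\<close>, the denominator costs a factor \<open>2/p\<close> and Chebyshev's bound remains.
Elsewhere \<open>N \<ge> 1\<close> bounds the quotient by \<open>n\<close>, and the event \<open>N < n p / 2\<close> has exponentially small probability by
Markov's inequality for \<open>2\<^sup>-\<^sup>N\<close>.\<close>

lemma relative_deviation:
  assumes E[measurable]: "Measurable.pred (borel \<Otimes>\<^sub>M borel) E" and p: "measure H {q. E q} = p" "p > 0" and n: "n > 0"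
  shows "(\<integral>\<^sup>+d. ennreal (if cnt n E d > 0 then (cnt n E d / n - p)\<^sup>2 / (cnt n E d / n) else 0) \<partial>D n)
    \<le> ennreal (2 / (p * n) + n * exp (- (n * (p / 2 * (1 - ln 2)))))"
proof -
  have p1: "p \<le> 1" using H.prob_le_1 p by metis
  have pw: "ennreal (if cnt n E d > 0 then (cnt n E d / n - p)\<^sup>2 / (cnt n E d / n) else 0)
     \<le> ennreal (2 / (p * n\<^sup>2) * (cnt n E d - n * p)\<^sup>2)
        + ennreal (n * 2 powr (n * p / 2)) * ennreal ((1/2) powr (cnt n E d))" for d
  proof (cases "cnt n E d > 0")
    case False then show ?thesis by simp
  next
    case True
    let ?c = "cnt n E d"
    have c: "1 \<le> ?c" "?c \<le> n" using cnt_ge_1[OF True] cnt_le by auto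
    have "(?c / n - p)\<^sup>2 / (?c / n) \<le> 2 / (p * n\<^sup>2) * (?c - n * p)\<^sup>2 + n * (2 powr (n * p / 2) * (1/2) powr ?c)"
    proof (cases "?c < n * p / 2")
      case True
      have "(?c / n - p)\<^sup>2 \<le> 1\<^sup>2"
      proof (rule abs_le_square_iff[THEN iffD1])
        have "0 \<le> ?c / n" "?c / n \<le> 1" using c n by auto
        then show "\<bar>?c / n - p\<bar> \<le> \<bar>1\<bar>" using p(2) p1 by linarith
      qed
      then have "(?c / n - p)\<^sup>2 / (?c / n) \<le> 1 / (1 / n)"
        using c n by (intro frac_le) (auto simp: divide_right_mono)
      also have "\<dots> \<le> n * (2 powr (n * p / 2) * (1/2) powr ?c)"
      proof -
        have "2 powr (n * p / 2) * (1/2) powr ?c = 2 powr (n * p / 2 - ?c)"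
          by (simp add: powr_diff powr_divide)
        also have "\<dots> \<ge> 1" using True by (intro ge_one_powr_ge_zero) auto
        finally show ?thesis using n by simp
      qed
      finally show ?thesis using p n by (simp add: add_increasing)
    next
      case False
      then have "(?c / n - p)\<^sup>2 / (?c / n) \<le> (?c / n - p)\<^sup>2 / (p / 2)"
        using c n p by (intro divide_left_mono) (auto simp: field_simps)
      also have "\<dots> = 2 / (p * n\<^sup>2) * (?c - n * p)\<^sup>2"
        using n p by (simp add: field_simps power2_eq_square)
      finally show ?thesis by (simp add: add_increasing2)
    qed
    then show ?thesis using True p by (simp add: ennreal_plus[symmetric] ennreal_mult[symmetric] mult.assoc ennreal_leI del: ennreal_plus)
  qed
  have "(\<integral>\<^sup>+d. ennreal (if cnt n E d > 0 then (cnt n E d / n - p)\<^sup>2 / (cnt n E d / n) else 0) \<partial>D n)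
    \<le> (\<integral>\<^sup>+d. ennreal (2 / (p * n\<^sup>2) * (cnt n E d - n * p)\<^sup>2)
        + ennreal (n * 2 powr (n * p / 2)) * ennreal ((1/2) powr (cnt n E d)) \<partial>D n)"
    by (rule nn_integral_mono) (rule pw)
  also have "\<dots> = (\<integral>\<^sup>+d. ennreal (2 / (p * n\<^sup>2) * (cnt n E d - n * p)\<^sup>2) \<partial>D n)
        + ennreal (n * 2 powr (n * p / 2)) * (\<integral>\<^sup>+d. ennreal ((1/2) powr (cnt n E d)) \<partial>D n)"
    by (subst nn_integral_add, measurable, subst nn_integral_cmult) auto
  also have "(\<integral>\<^sup>+d. ennreal ((1/2) powr (cnt n E d)) \<partial>D n) = ennreal ((1 - p + p * (1/2)) ^ n)"
    using pgf[OF E, of "1/2" n] p by (simp add: prod_powr_cnt[of "1/2"] del: ennreal_half)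
  also have "(\<integral>\<^sup>+d. ennreal (2 / (p * n\<^sup>2) * (cnt n E d - n * p)\<^sup>2) \<partial>D n) \<le> ennreal (2 / (p * n))"
  proof -
    have int: "integrable (D n) (\<lambda>d. (cnt n E d - n * p)\<^sup>2)"
    proof (rule D.integrable_const_bound[where B = "(2 * real n)\<^sup>2"])
      have "norm ((cnt n E d - n * p)\<^sup>2) \<le> (2 * real n)\<^sup>2" for d
      proof -
        have "real n * p \<le> real n * 1" using p1 by (intro mult_left_mono) auto
        then have "\<bar>cnt n E d - n * p\<bar> \<le> \<bar>2 * real n\<bar>"
          using cnt_nonneg[of n E d] cnt_le[of n E d] mult_nonneg_nonneg[of "real n" p] p(2) by linarith
        then have "(cnt n E d - n * p)\<^sup>2 \<le> (2 * real n)\<^sup>2" using abs_le_square_iff by blast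
        then show ?thesis by simp
      qed
      then show "AE d in D n. norm ((cnt n E d - n * p)\<^sup>2) \<le> (2 * real n)\<^sup>2" by simp
    qed measurable
    have "(\<integral>\<^sup>+d. ennreal (2 / (p * n\<^sup>2) * (cnt n E d - n * p)\<^sup>2) \<partial>D n)
        = ennreal (\<integral>d. 2 / (p * n\<^sup>2) * (cnt n E d - n * p)\<^sup>2 \<partial>D n)"
      by (rule nn_integral_eq_integral) (use int p in auto)
    also have "\<dots> = ennreal (2 / (p * n\<^sup>2) * (\<integral>d. (cnt n E d - n * p)\<^sup>2 \<partial>D n))" by simp
    also have "\<dots> \<le> ennreal (2 / (p * n\<^sup>2) * n)"
      using cnt_second_moment[OF E, of n] p by (intro ennreal_leI mult_left_mono) auto
    also have "2 / (p * n\<^sup>2) * n = 2 / (p * n)" using n by (simp add: power2_eq_square)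
    finally show ?thesis .
  qed
  also have "ennreal (n * 2 powr (n * p / 2)) * ennreal ((1 - p + p * (1/2)) ^ n)
      \<le> ennreal (n * exp (- (n * (p / 2 * (1 - ln 2)))))"
  proof -
    have "(1 - p + p * (1/2)) ^ n \<le> exp (- (p / 2)) ^ n"
      using exp_ge_add_one_self[of "- (p/2)"] p1 by (intro power_mono) auto
    then have "n * 2 powr (n * p / 2) * (1 - p + p * (1/2)) ^ n \<le> n * 2 powr (n * p / 2) * exp (- (p / 2)) ^ n"
      by (intro mult_left_mono) auto
    also have "\<dots> = n * exp (- (n * (p / 2 * (1 - ln 2))))"
      by (simp add: powr_def exp_of_nat_mult[symmetric] exp_add[symmetric] algebra_simps)
    finally show ?thesis using p1 by (subst ennreal_mult[symmetric]) (auto intro!: ennreal_leI)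
  qed
  finally show ?thesis using p by (simp add: ennreal_plus[symmetric] del: ennreal_plus)
qed

lemma relative_deviation_lim:
  assumes "p > (0::real)" shows "(\<lambda>n. 2 / (p * real n) + real n * exp (- (real n * (p / 2 * (1 - ln 2))))) \<longlonglongrightarrow> 0"
proof -
  define c where "c = p / 2 * (1 - ln 2)"
  have "c > 0" using assms ln_2_less_1 by (simp add: c_def)
  then have "(\<lambda>n. of_nat n * exp (- c) ^ n) \<longlonglongrightarrow> 0"
    by (intro powser_times_n_limit_0) simp
  then have "(\<lambda>n. real n * exp (- (real n * c))) \<longlonglongrightarrow> 0"
    by (simp add: exp_of_nat_mult[symmetric])
  moreover have "(\<lambda>n. 2 / p * (1 / real n)) \<longlonglongrightarrow> 2 / p * 0"
    by (intro tendsto_mult tendsto_const lim_1_over_n)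
  ultimately have "(\<lambda>n. 2 / p * (1 / real n) + real n * exp (- (real n * c))) \<longlonglongrightarrow> 2 / p * 0 + 0"
    by (intro tendsto_add)
  then show ?thesis by (simp add: c_def)
qed

lemma C_eq_prob: "measure H {q. snd q \<le> z \<and> z \<le> fst q} = C z"
proof -
  have "ennreal (measure H {q. snd q \<le> z \<and> z \<le> fst q}) = (\<integral>\<^sup>+q. (if snd q \<le> z \<and> z \<le> fst q then 1 else 0) \<partial>H)"
    by (rule emeasure_H_pred[symmetric]) measurable
  also have "\<dots> = (\<integral>\<^sup>+y. \<integral>\<^sup>+x. (if y \<le> x then if y \<le> z \<and> z \<le> x then 1 else 0 else 0) * ennreal (1 / \<alpha>) \<partial>\<mu> \<partial>\<nu>)"
    by (subst nn_integral_H) (auto simp only: fst_conv snd_conv, measurable)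
  also have "\<dots> = (\<integral>\<^sup>+y. (if y \<le> z then 1 else 0) * (ennreal (S z) * ennreal (1 / \<alpha>)) \<partial>\<nu>)"
  proof (rule nn_integral_cong)
    fix y
    have "(\<integral>\<^sup>+x. (if y \<le> x then if y \<le> z \<and> z \<le> x then 1 else 0 else 0) * ennreal (1 / \<alpha>) \<partial>\<mu>)
        = (\<integral>\<^sup>+x. (if z \<le> x then 1 else 0) * ((if y \<le> z then 1 else 0) * ennreal (1 / \<alpha>)) \<partial>\<mu>)"
      by (intro nn_integral_cong) auto
    also have "\<dots> = (if y \<le> z then 1 else 0) * (ennreal (S z) * ennreal (1 / \<alpha>))"
      by (subst nn_integral_multc) (auto simp: nn_integral_S_above)
    finally show "(\<integral>\<^sup>+x. (if y \<le> x then if y \<le> z \<and> z \<le> x then 1 else 0 else 0) * ennreal (1 / \<alpha>) \<partial>\<mu>)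
        = (if y \<le> z then 1 else 0) * (ennreal (S z) * ennreal (1 / \<alpha>))" .
  qed
  also have "\<dots> = (\<integral>\<^sup>+y. indicator {..z} y \<partial>\<nu>) * (ennreal (S z) * ennreal (1 / \<alpha>))"
    by (subst nn_integral_multc[symmetric]) (auto intro!: nn_integral_cong split: split_indicator)
  also have "\<dots> = ennreal (C z)"
    using \<alpha>_pos by (simp add: \<nu>.emeasure_eq_measure G_def cdf_def C_def
        ennreal_mult[symmetric] S_nonneg)
  finally show ?thesis using C_nonneg by simp
qed

lemma C_le_1: "C z \<le> 1" using C_eq_prob[of z] H.prob_le_1 by metis

text \<open>The distribution function of an observed entry time.\<close>

definition Gs :: "real \<Rightarrow> real" where "Gs z = measure H {q. snd q \<le> z}"

lemma entry_set[measurable]: "{q::real \<times> real. snd q \<le> z} \<in> sets (borel \<Otimes>\<^sub>M borel)"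
  using borel_measurable_le[of snd "borel \<Otimes>\<^sub>M borel :: (real \<times> real) measure" "\<lambda>_. z"]
  by (simp add: space_pair_measure)

lemma Gs_mono: "x \<le> y \<Longrightarrow> Gs x \<le> Gs y"
  unfolding Gs_def by (intro H.finite_measure_mono) (auto simp: sets_H)

lemma Gs_le_1: "Gs z \<le> 1" unfolding Gs_def by (rule H.prob_le_1)

lemma Gs_ge_C: "C z \<le> Gs z"
  unfolding Gs_def C_eq_prob[symmetric] by (intro H.finite_measure_mono) (auto simp: sets_H)

lemma risk_first_moment: "(\<integral>\<^sup>+d. ennreal (risk n d z) \<partial>D n) = ennreal (n * C z)"
  unfolding risk_cnt C_eq_prob[symmetric] by (rule cnt_first_moment) measurable

lemma inverse_risk_moment:
  assumes "C z > 0"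
  shows "(\<integral>\<^sup>+d. ennreal (1 / risk n d z) \<partial>D n) \<le> ennreal (2 / (Suc n * C z))"
proof -
  have "(\<integral>\<^sup>+d. ennreal (1 / risk n d z) \<partial>D n) = (\<integral>\<^sup>+d. ennreal (if risk n d z > 0 then 1 / risk n d z else 0) \<partial>D n)"
    using risk_nonneg[of n _ z] by (intro nn_integral_cong) (auto simp: order.order_iff_strict)
  also have "\<dots> \<le> ennreal (2 / (Suc n * C z))"
    unfolding risk_cnt C_eq_prob[of z, symmetric]
    by (rule inverse_moment) (use assms in \<open>auto simp: C_eq_prob\<close>)
  finally show ?thesis .
qed

lemma prob_waiting: "(\<integral>\<^sup>+d. (if waiting n d z then 1 else 0) \<partial>D n) = ennreal ((1 - Gs z) ^ n)"
proof -
  have "waiting n d z \<longleftrightarrow> (\<forall>i<n. \<not> snd (d i) \<le> z)" for d by (auto simp: waiting_def obsY_def not_le)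
  then show ?thesis unfolding Gs_def using prob_none[of "\<lambda>q. snd q \<le> z" n] by simp
qed

end

section \<open>Integrability of the influence function\<close>

text \<open>The two integrability conditions of the theorem. With the convention \<open>1/0 = \<infinity>\<close> for extended nonnegative
reals, the second one contains the statement that \<open>G > 0\<close> almost everywhere with respect to \<open>\<mu>\<close>.\<close>

locale truncated_integrand = left_truncation \<mu> \<nu> for \<mu> \<nu> :: "real measure" +
  fixes \<phi> :: "real \<Rightarrow> real"
  assumes \<phi>_measurable[measurable]: "\<phi> \<in> borel_measurable borel"
    and \<phi>_weighted: "(\<integral>\<^sup>+x. ennreal ((\<phi> x)\<^sup>2) / ennreal (G x) \<partial>\<mu>) < \<infinity>"
    and one_weighted: "(\<integral>\<^sup>+x. 1 / ennreal (G x) \<partial>\<mu>) < \<infinity>"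
begin

lemma AE_G_pos: "AE x in \<mu>. G x > 0"
proof -
  have "AE x in \<mu>. 1 / ennreal (G x) \<noteq> \<infinity>"
    by (rule nn_integral_PInf_AE) (use one_weighted in auto)
  then show ?thesis
  proof eventually_elim
    fix x assume *: "1 / ennreal (G x) \<noteq> \<infinity>"
    show "G x > 0"
    proof (rule ccontr)
      assume "\<not> G x > 0"
      then have "ennreal (G x) = 0" using G_nonneg[of x] by simp
      with * show False by (simp add: ennreal_divide_zero)
    qed
  qed
qed

lemma AE_C_pos: "AE x in \<mu>. C x > 0"
  using AE_G_pos AE_S_pos by eventually_elim (simp add: C_def \<alpha>_pos)

lemma finite_inverse_G: "(\<integral>\<^sup>+x. ennreal (1 / G x) \<partial>\<mu>) < \<infinity>"
proof -
  have "(\<integral>\<^sup>+x. ennreal (1 / G x) \<partial>\<mu>) = (\<integral>\<^sup>+x. 1 / ennreal (G x) \<partial>\<mu>)"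
  proof (rule nn_integral_cong_AE, use AE_G_pos in eventually_elim)
    fix x assume "G x > 0"
    then show "ennreal (1 / G x) = 1 / ennreal (G x)" using divide_ennreal[of 1 "G x"] by simp
  qed
  then show ?thesis using one_weighted by simp
qed

lemma finite_square_over_G: "(\<integral>\<^sup>+x. ennreal ((\<phi> x)\<^sup>2 / G x) \<partial>\<mu>) < \<infinity>"
proof -
  have "(\<integral>\<^sup>+x. ennreal ((\<phi> x)\<^sup>2 / G x) \<partial>\<mu>) = (\<integral>\<^sup>+x. ennreal ((\<phi> x)\<^sup>2) / ennreal (G x) \<partial>\<mu>)"
  proof (rule nn_integral_cong_AE, use AE_G_pos in eventually_elim)
    fix x assume "G x > 0"
    then show "ennreal ((\<phi> x)\<^sup>2 / G x) = ennreal ((\<phi> x)\<^sup>2) / ennreal (G x)"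
      using divide_ennreal[of "(\<phi> x)\<^sup>2" "G x"] by simp
  qed
  then show ?thesis using \<phi>_weighted by simp
qed

lemma finite_square: "(\<integral>\<^sup>+x. ennreal ((\<phi> x)\<^sup>2) \<partial>\<mu>) < \<infinity>"
proof (rule le_less_trans[OF nn_integral_mono_AE finite_square_over_G], use AE_G_pos in eventually_elim)
  fix x assume "G x > 0"
  then have "(\<phi> x)\<^sup>2 * 1 \<le> (\<phi> x)\<^sup>2 * (1 / G x)"
    using G_le_1[of x] by (intro mult_left_mono) auto
  then show "ennreal ((\<phi> x)\<^sup>2) \<le> ennreal ((\<phi> x)\<^sup>2 / G x)" by (intro ennreal_leI) simp
qed

lemma integrable_\<phi>: "integrable \<mu> \<phi>"
proof -
  have "integrable \<mu> (\<lambda>x. (\<phi> x)\<^sup>2)"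
    by (rule integrableI_nonneg) (use finite_square in auto)
  then have "integrable \<mu> (\<lambda>x. 1 + (\<phi> x)\<^sup>2)" by simp
  then show ?thesis
  proof (rule Bochner_Integration.integrable_bound)
    show "AE x in \<mu>. norm (\<phi> x) \<le> norm (1 + (\<phi> x)\<^sup>2)"
    proof (rule AE_I2)
      fix x
      have "0 \<le> (\<bar>\<phi> x\<bar> - 1)\<^sup>2" by simp
      then have "2 * \<bar>\<phi> x\<bar> \<le> 1 + (\<phi> x)\<^sup>2" by (simp add: power2_eq_square algebra_simps)
      then show "norm (\<phi> x) \<le> norm (1 + (\<phi> x)\<^sup>2)" by simp
    qed
  qed measurable
qed

abbreviation "T \<equiv> tail \<phi>"
abbreviation "\<psi> \<equiv> \<Psi> \<phi>"

text \<open>A point well inside both supports. To its left \<open>S\<close> is bounded below, to its right \<open>G\<close> is.\<close>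

lemma reference_point: obtains z where "S z > 0" "G z > 0"
proof -
  have "AE x in \<mu>. S x > 0 \<and> G x > 0" using AE_S_pos AE_G_pos by eventually_elim simp
  then have "\<exists>x. S x > 0 \<and> G x > 0"
    using \<mu>.AE_contr by (metis (mono_tags, lifting) eventually_mono)
  then show ?thesis using that by blast
qed

text \<open>Hardy's inequality by the Schur test: the Cauchy-Schwarz inequality with the weights \<open>S\<^bsup>1/4\<^esup>\<close> and \<open>S\<^bsup>-1/4\<^esup>\<close>,
followed by Tonelli. All integrands are nonnegative, so finiteness of the left-hand side is part of the result.\<close>

lemma hardy: "(\<integral>\<^sup>+z. ennreal ((T z)\<^sup>2 / (S z)\<^sup>2) \<partial>\<mu>) \<le> 4 * (\<integral>\<^sup>+x. ennreal ((\<phi> x)\<^sup>2) \<partial>\<mu>)"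
proof -
  let ?a = "\<lambda>z x. (if z < x then ennreal ((\<phi> x)\<^sup>2 * S x powr (1/2)) else 0)"
  interpret \<mu>\<mu>: pair_prob_space \<mu> \<mu> ..
  have pw: "ennreal ((T z)\<^sup>2 / (S z)\<^sup>2) \<le> (\<integral>\<^sup>+x. (?a z x)
      * ennreal (2 * S z powr (-3/2)) \<partial>\<mu>)" if z: "S z > 0" for z
  proof -
    let ?f = "\<lambda>x. if z < x then ennreal (\<bar>\<phi> x\<bar> * S x powr (1/4)) else 0"
    let ?g = "\<lambda>x. if z < x then ennreal (S x powr (-1/4)) else 0"
    have "ennreal (\<bar>T z\<bar>) \<le> (\<integral>\<^sup>+x. ?f x * ?g x \<partial>\<mu>)"
    proof -
      have "ennreal (\<bar>T z\<bar>) \<le> (\<integral>\<^sup>+x. ennreal (norm (if z < x then \<phi> x else 0)) \<partial>\<mu>)"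
        unfolding tail_def real_norm_def[symmetric]
        by (rule integral_norm_bound_ennreal)
          (rule Bochner_Integration.integrable_bound[OF integrable_\<phi>], auto)
      also have "\<dots> = (\<integral>\<^sup>+x. ?f x * ?g x \<partial>\<mu>)"
      proof (rule nn_integral_cong_AE, use AE_S_pos in eventually_elim)
        fix x assume x: "S x > 0"
        have "\<bar>\<phi> x\<bar> * S x powr (1/4) * S x powr (-1/4) = \<bar>\<phi> x\<bar>"
        proof -
          have "S x powr (1/4) * S x powr (-1/4) = S x powr (1/4 + - 1/4)"
            by (rule powr_add[symmetric])
          also have "\<dots> = 1" using x by simp
          finally show ?thesis by (simp only: mult.assoc mult_1_right)
        qed
        moreover have "ennreal (\<bar>\<phi> x\<bar> * S x powr (1/4)) * ennreal (S x powr (-1/4)) = ennreal (\<bar>\<phi> x\<bar> * S x powr (1/4) * S x powr (-1/4))"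
          by (rule ennreal_mult[symmetric]) auto
        ultimately show "ennreal (norm (if z < x then \<phi> x else 0)) = ?f x * ?g x" by simp
      qed
      finally show ?thesis .
    qed
    then have "(ennreal (\<bar>T z\<bar>))\<^sup>2 \<le> (\<integral>\<^sup>+x. ?f x * ?g x \<partial>\<mu>)\<^sup>2"
      by (rule power_mono) simp
    also have "\<dots> \<le> (\<integral>\<^sup>+x. (?f x)\<^sup>2 \<partial>\<mu>) * (\<integral>\<^sup>+x. (?g x)\<^sup>2 \<partial>\<mu>)"
      by (rule Cauchy_Schwarz_nn_integral) measurable
    also have "(\<integral>\<^sup>+x. (?f x)\<^sup>2 \<partial>\<mu>) = (\<integral>\<^sup>+x. (?a z x) \<partial>\<mu>)"
    proof (rule nn_integral_cong)
      fix x
      have "(\<bar>\<phi> x\<bar> * S x powr (1/4))\<^sup>2 = (\<phi> x)\<^sup>2 * (S x powr (1/4) * S x powr (1/4))"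
        by (simp only: power_mult_distrib power2_abs) (simp only: power2_eq_square)
      also have "S x powr (1/4) * S x powr (1/4) = S x powr (1/2)"
        unfolding powr_add[symmetric] by (rule arg_cong[where f = "\<lambda>a. S x powr a"]) simp
      finally have "(ennreal (\<bar>\<phi> x\<bar> * S x powr (1/4)))\<^sup>2 = ennreal ((\<phi> x)\<^sup>2 * S x powr (1/2))"
        by (subst ennreal_power) auto
      then show "(?f x)\<^sup>2 = (?a z x)" by simp
    qed
    finally have first: "(ennreal (\<bar>T z\<bar>))\<^sup>2 \<le> (\<integral>\<^sup>+x. (?a z x) \<partial>\<mu>)
        * (\<integral>\<^sup>+x. (?g x)\<^sup>2 \<partial>\<mu>)" .
    have "(\<integral>\<^sup>+x. (?g x)\<^sup>2 \<partial>\<mu>) \<le> (\<integral>\<^sup>+x. indicator {z..} x * ennreal (S x powr (-1/2)) \<partial>\<mu>)"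
    proof (rule nn_integral_mono)
      fix x
      have "(S x powr (-1/4))\<^sup>2 = S x powr (-1/2)"
        unfolding power2_eq_square powr_add[symmetric] by (rule arg_cong[where f = "\<lambda>a. S x powr a"]) simp
      then have "(ennreal (S x powr (-1/4)))\<^sup>2 = ennreal (S x powr (-1/2))"
        by (subst ennreal_power) auto
      then show "(?g x)\<^sup>2 \<le> indicator {z..} x * ennreal (S x powr (-1/2))" by (auto split: split_indicator)
    qed
    also have "\<dots> = ennreal (2 * S z powr (1/2))" by (rule nn_integral_S_powr_above)
    finally have "(ennreal (\<bar>T z\<bar>))\<^sup>2 \<le> (\<integral>\<^sup>+x. (?a z x) \<partial>\<mu>)
        * ennreal (2 * S z powr (1/2))" by (intro order_trans[OF first] mult_left_mono) auto
    then have "(ennreal (\<bar>T z\<bar>))\<^sup>2 * ennreal (1 / (S z)\<^sup>2) \<le> (\<integral>\<^sup>+x. (?a z x) \<partial>\<mu>)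
        * ennreal (2 * S z powr (1/2)) * ennreal (1 / (S z)\<^sup>2)" by (rule mult_right_mono) simp
    moreover have "(ennreal (\<bar>T z\<bar>))\<^sup>2 * ennreal (1 / (S z)\<^sup>2) = ennreal ((T z)\<^sup>2 / (S z)\<^sup>2)"
    proof -
      have "(ennreal \<bar>T z\<bar>)\<^sup>2 = ennreal ((T z)\<^sup>2)" by (subst ennreal_power) auto
      then show ?thesis by (simp only:) (subst ennreal_mult[symmetric]; simp)
    qed
    moreover have "ennreal (2 * S z powr (1/2)) * ennreal (1 / (S z)\<^sup>2) = ennreal (2 * S z powr (-3/2))"
    proof -
      have "1 / (S z)\<^sup>2 = S z powr (-2)"
        using z by (simp add: powr_minus inverse_eq_divide)
      then have "S z powr (1/2) * (1 / (S z)\<^sup>2) = S z powr (1/2) * S z powr (-2)" by (simp only:)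
      also have "\<dots> = S z powr (-3/2)"
        unfolding powr_add[symmetric] by (rule arg_cong[where f = "\<lambda>a. S z powr a"]) simp
      finally have "2 * S z powr (1/2) * (1 / (S z)\<^sup>2) = 2 * S z powr (-3/2)" by (simp only: mult.assoc)
      then show ?thesis by (subst ennreal_mult[symmetric]) auto
    qed
    ultimately have "ennreal ((T z)\<^sup>2 / (S z)\<^sup>2) \<le> (\<integral>\<^sup>+x. (?a z x) \<partial>\<mu>)
        * ennreal (2 * S z powr (-3/2))" by (simp only: mult.assoc)
    also have "\<dots> = (\<integral>\<^sup>+x. (?a z x) * ennreal (2 * S z powr (-3/2)) \<partial>\<mu>)"
      by (rule nn_integral_multc[symmetric]) measurable
    finally show ?thesis .
  qed
  have "(\<integral>\<^sup>+z. ennreal ((T z)\<^sup>2 / (S z)\<^sup>2) \<partial>\<mu>) \<le> (\<integral>\<^sup>+z. \<integral>\<^sup>+x. (?a z x)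
      * ennreal (2 * S z powr (-3/2)) \<partial>\<mu> \<partial>\<mu>)"
    by (rule nn_integral_mono_AE, use AE_S_pos in eventually_elim) (rule pw)
  also have "\<dots> = (\<integral>\<^sup>+x. \<integral>\<^sup>+z. (?a z x)
      * ennreal (2 * S z powr (-3/2)) \<partial>\<mu> \<partial>\<mu>)"
    by (rule \<mu>\<mu>.Fubini') measurable
  also have "\<dots> \<le> (\<integral>\<^sup>+x. 4 * ennreal ((\<phi> x)\<^sup>2) \<partial>\<mu>)"
  proof (rule nn_integral_mono_AE, use AE_S_pos in eventually_elim)
    fix x assume x: "S x > 0"
    have "(\<integral>\<^sup>+z. (?a z x) * ennreal (2 * S z powr (-3/2)) \<partial>\<mu>)
       = (\<integral>\<^sup>+z. ennreal (2 * (\<phi> x)\<^sup>2 * S x powr (1/2)) * (indicator {..<x} z * ennreal (S z powr (-3/2))) \<partial>\<mu>)"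
    proof (rule nn_integral_cong)
      fix z
      have "ennreal ((\<phi> x)\<^sup>2 * S x powr (1/2)) * ennreal (2 * S z powr (-3/2))
          = ennreal (2 * (\<phi> x)\<^sup>2 * S x powr (1/2) * S z powr (-3/2))"
        by (subst ennreal_mult[symmetric]) (auto simp: mult_ac)
      also have "\<dots> = ennreal (2 * (\<phi> x)\<^sup>2 * S x powr (1/2)) * ennreal (S z powr (-3/2))"
        by (rule ennreal_mult) auto
      finally show "(?a z x) * ennreal (2 * S z powr (-3/2))
        = ennreal (2 * (\<phi> x)\<^sup>2 * S x powr (1/2)) * (indicator {..<x} z * ennreal (S z powr (-3/2)))"
        by (auto split: split_indicator)
    qed
    also have "\<dots> \<le> ennreal (2 * (\<phi> x)\<^sup>2 * S x powr (1/2)) * ennreal (2 * S x powr (-1/2))"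
      by (subst nn_integral_cmult, measurable) (intro mult_left_mono nn_integral_S_powr_below x, simp)
    also have "\<dots> = ennreal (4 * (\<phi> x)\<^sup>2)"
    proof -
      have "S x powr (1/2) * S x powr (-1/2) = S x powr (1/2 + - 1/2)" by (rule powr_add[symmetric])
      also have "\<dots> = 1" using x by simp
      finally have "2 * (\<phi> x)\<^sup>2 * S x powr (1/2) * (2 * S x powr (-1/2)) = 4 * (\<phi> x)\<^sup>2"
        by (simp only: mult_ac) 
      then show ?thesis by (subst ennreal_mult[symmetric]) auto
    qed
    also have "\<dots> = 4 * ennreal ((\<phi> x)\<^sup>2)" by (subst ennreal_mult) auto
    finally show "(\<integral>\<^sup>+z. (?a z x) * ennreal (2 * S z powr (-3/2)) \<partial>\<mu>)
       \<le> 4 * ennreal ((\<phi> x)\<^sup>2)" .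
  qed
  also have "\<dots> = 4 * (\<integral>\<^sup>+x. ennreal ((\<phi> x)\<^sup>2) \<partial>\<mu>)" by (rule nn_integral_cmult) measurable
  finally show ?thesis .
qed

text \<open>Up to a constant the integrand is \<open>\<psi>\<^sup>2 / (G S\<^sup>2)\<close>, and \<open>\<psi>/S = \<phi> - tail \<phi> / S\<close>. To the left of the reference point
\<open>b\<close> the second term is bounded and \<open>1/G\<close> is integrable; to the right \<open>1/G\<close> is bounded and Hardy's inequality applies.\<close>

lemma finite_information: "(\<integral>\<^sup>+z. ennreal ((\<psi> z)\<^sup>2 / (C z * S z)) \<partial>\<mu>) < \<infinity>"
proof -
  obtain b where b: "S b > 0" "G b > 0" by (rule reference_point)
  define c where "c = (\<integral>x. \<bar>\<phi> x\<bar> \<partial>\<mu>)"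
  have T: "\<bar>T z\<bar> \<le> c" for z unfolding c_def by (rule tail_bound[OF integrable_\<phi>])
  have pw: "(\<psi> z)\<^sup>2 / (C z * S z) \<le> 2 * \<alpha> * ((\<phi> z)\<^sup>2 / G z) + 2 * \<alpha> * c\<^sup>2 / (S b)\<^sup>2 * (1 / G z)
      + 2 * \<alpha> / G b * ((T z)\<^sup>2 / (S z)\<^sup>2)" if z: "S z > 0" "G z > 0" for z
  proof -
    have "(\<psi> z)\<^sup>2 \<le> 2 * (\<phi> z * S z)\<^sup>2 + 2 * (T z)\<^sup>2"
      using zero_le_power2[of "\<phi> z * S z + T z"] by (simp add: \<Psi>_def power2_eq_square algebra_simps)
    then have "(\<psi> z)\<^sup>2 / (G z * (S z)\<^sup>2) \<le> (2 * (\<phi> z * S z)\<^sup>2 + 2 * (T z)\<^sup>2) / (G z * (S z)\<^sup>2)"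
      using z by (intro divide_right_mono) auto
    also have "\<dots> = 2 * ((\<phi> z)\<^sup>2 / G z) + 2 * ((T z)\<^sup>2 / (G z * (S z)\<^sup>2))"
      using z by (simp add: field_simps)
    also have "(T z)\<^sup>2 / (G z * (S z)\<^sup>2) \<le> c\<^sup>2 / (S b)\<^sup>2 * (1 / G z) + 1 / G b * ((T z)\<^sup>2 / (S z)\<^sup>2)"
    proof (cases "z \<le> b")
      case True
      have "(T z)\<^sup>2 \<le> c\<^sup>2" using T[of z] by (simp add: abs_le_square_iff[symmetric])
      then have "(T z)\<^sup>2 / (S z)\<^sup>2 \<le> c\<^sup>2 / (S b)\<^sup>2"
        using b S_antimono[OF True] by (intro frac_le) (auto intro: power_mono)
      then have "(T z)\<^sup>2 / (S z)\<^sup>2 * (1 / G z) \<le> c\<^sup>2 / (S b)\<^sup>2 * (1 / G z)"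
        using z by (intro mult_right_mono) auto
      then have "(T z)\<^sup>2 / (G z * (S z)\<^sup>2) \<le> c\<^sup>2 / (S b)\<^sup>2 * (1 / G z)" by (simp add: mult.commute)
      then show ?thesis using b by (intro add_increasing2) auto
    next
      case False
      then have "1 / G z \<le> 1 / G b" using b G_mono[of b z] by (intro divide_left_mono) auto
      then have "1 / G z * ((T z)\<^sup>2 / (S z)\<^sup>2) \<le> 1 / G b * ((T z)\<^sup>2 / (S z)\<^sup>2)"
        by (intro mult_right_mono) auto
      then show ?thesis using z by (intro add_increasing) auto
    qed
    finally have *: "(\<psi> z)\<^sup>2 / (G z * (S z)\<^sup>2) \<le> 2 * ((\<phi> z)\<^sup>2 / G z) + 2 * (c\<^sup>2 / (S b)\<^sup>2 * (1 / G z) + 1 / G b * ((T z)\<^sup>2 / (S z)\<^sup>2))"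
      by simp
    have "(\<psi> z)\<^sup>2 / (C z * S z) = \<alpha> * ((\<psi> z)\<^sup>2 / (G z * (S z)\<^sup>2))"
      using \<alpha>_pos by (simp add: C_def power2_eq_square mult_ac)
    also have "\<dots> \<le> \<alpha> * (2 * ((\<phi> z)\<^sup>2 / G z) + 2 * (c\<^sup>2 / (S b)\<^sup>2 * (1 / G z) + 1 / G b * ((T z)\<^sup>2 / (S z)\<^sup>2)))"
      using * \<alpha>_pos by (intro mult_left_mono) auto
    finally show ?thesis by (simp add: algebra_simps)
  qed
  have "(\<integral>\<^sup>+z. ennreal ((\<psi> z)\<^sup>2 / (C z * S z)) \<partial>\<mu>) \<le> (\<integral>\<^sup>+z. ennreal (2 * \<alpha>) * ennreal ((\<phi> z)\<^sup>2 / G z)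
      + ennreal (2 * \<alpha> * c\<^sup>2 / (S b)\<^sup>2) * ennreal (1 / G z) + ennreal (2 * \<alpha> / G b) * ennreal ((T z)\<^sup>2 / (S z)\<^sup>2) \<partial>\<mu>)"
  proof (rule nn_integral_mono_AE, use AE_S_pos AE_G_pos in eventually_elim)
    fix z assume z: "S z > 0" "G z > 0"
    show "ennreal ((\<psi> z)\<^sup>2 / (C z * S z)) \<le> ennreal (2 * \<alpha>) * ennreal ((\<phi> z)\<^sup>2 / G z)
      + ennreal (2 * \<alpha> * c\<^sup>2 / (S b)\<^sup>2) * ennreal (1 / G z) + ennreal (2 * \<alpha> / G b) * ennreal ((T z)\<^sup>2 / (S z)\<^sup>2)"
      using pw[OF z] \<alpha>_pos z b
      by (simp only: ennreal_mult[symmetric] ennreal_plus[symmetric] zero_le_power2 divide_nonneg_nonneg less_imp_le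
          mult_nonneg_nonneg zero_le_numeral add_nonneg_nonneg zero_le_one ennreal_leI)
  qed
  also have "\<dots> = ennreal (2 * \<alpha>) * (\<integral>\<^sup>+z. ennreal ((\<phi> z)\<^sup>2 / G z) \<partial>\<mu>)
      + ennreal (2 * \<alpha> * c\<^sup>2 / (S b)\<^sup>2) * (\<integral>\<^sup>+z. ennreal (1 / G z) \<partial>\<mu>)
      + ennreal (2 * \<alpha> / G b) * (\<integral>\<^sup>+z. ennreal ((T z)\<^sup>2 / (S z)\<^sup>2) \<partial>\<mu>)"
    by (simp add: nn_integral_add nn_integral_cmult)
  also have "\<dots> < \<infinity>"
  proof -
    have "4 * (\<integral>\<^sup>+x. ennreal ((\<phi> x)\<^sup>2) \<partial>\<mu>) < \<infinity>"
      using finite_square by (simp add: ennreal_mult_less_top)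
    from le_less_trans[OF hardy this] show ?thesis
      using finite_square_over_G finite_inverse_G by (simp add: ennreal_mult_less_top)
  qed
  finally show ?thesis .
qed

end

context left_truncation
begin

section \<open>A supermartingale bound\<close>

text \<open>The number of individuals that have entered by time \<open>z\<close>.\<close>

definition entered :: "nat \<Rightarrow> sample \<Rightarrow> real \<Rightarrow> real" where
  "entered n d z = cnt n (\<lambda>p. snd p \<le> z) d"

text \<open>For fixed \<open>z\<close>, the number of individuals entering by time \<open>z\<close> that survive to time \<open>u\<close>. As a function of \<open>u\<close> it only
decreases, while the risk set may also grow; at \<open>u = z\<close> both coincide.\<close>

definition alive :: "nat \<Rightarrow> sample \<Rightarrow> real \<Rightarrow> real \<Rightarrow> real" where
  "alive n d z u = (\<Sum>i<n. if obsY d i \<le> z \<and> u \<le> obsX d i then 1 else 0)"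

lemma measurable_alive[measurable (raw)]:
  assumes [measurable]: "f \<in> M \<rightarrow>\<^sub>M D n" "g \<in> borel_measurable M"
  shows "(\<lambda>w. alive n (f w) z (g w)) \<in> borel_measurable M"
  unfolding alive_def by measurable

lemma measurable_waiting[measurable (raw)]:
  assumes [measurable]: "f \<in> M \<rightarrow>\<^sub>M D n" "g \<in> borel_measurable M"
  shows "Measurable.pred M (\<lambda>w. waiting n (f w) (g w))"
proof -
  have "waiting n d z \<longleftrightarrow> (\<forall>i\<in>{..<n}. z < obsY d i)" for d z by (auto simp: waiting_def)
  then show ?thesis by simp
qed

lemma alive_agree: assumes "agree n v d d'" "u \<le> v" shows "alive n d z u = alive n d' z u"
  unfolding alive_def
proof (intro sum.cong refl)
  fix i assume "i \<in> {..<n}"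
  then have "obsY d i = obsY d' i \<and> (obsX d i = obsX d' i \<or> v \<le> obsX d i \<and> v \<le> obsX d' i)"
    using assms(1) by (auto simp: agree_def)
  then show "(if obsY d i \<le> z \<and> u \<le> obsX d i then 1 else 0) =
      (if obsY d' i \<le> z \<and> u \<le> obsX d' i then 1 else (0::real))"
    using assms(2) by force
qed

lemma waiting_agree: "agree n v d d' \<Longrightarrow> waiting n d z = waiting n d' z"
  by (auto simp: agree_def waiting_def)

lemma alive_at: "alive n d z z = risk n d z"
  by (simp add: alive_def risk_def)

lemma alive_waiting: "good n d \<Longrightarrow> waiting n d u \<Longrightarrow> alive n d z u = entered n d z"
  unfolding alive_def entered_def cnt_def waiting_def obsY_def[symmetric]
  by (intro sum.cong refl) (force simp: good_def)

lemma alive_ge_1: "alive n d z u > 0 \<Longrightarrow> alive n d z u \<ge> 1"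
proof -
  have "alive n d z u = real (\<Sum>i<n. if obsY d i \<le> z \<and> u \<le> obsX d i then 1 else 0)"
    unfolding alive_def of_nat_sum by (intro sum.cong) auto
  then obtain N where "alive n d z u = real N" by blast
  then show "alive n d z u > 0 \<Longrightarrow> alive n d z u \<ge> 1" by (cases N) auto
qed

lemma alive_nonneg: "0 \<le> alive n d z u" unfolding alive_def by (intro sum_nonneg) auto

text \<open>For fixed \<open>z\<close> the process \<open>u \<mapsto> Q n d z u / S u\<close> is a supermartingale on \<open>u \<le> z\<close> after the first entry.\<close>

definition Q :: "nat \<Rightarrow> sample \<Rightarrow> real \<Rightarrow> real \<Rightarrow> real" where
  "Q n d z u = (B n d u)\<^sup>2 / alive n d z u"

lemma measurable_Q[measurable (raw)]:
  assumes [measurable]: "f \<in> M \<rightarrow>\<^sub>M D n" "g \<in> borel_measurable M"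
  shows "(\<lambda>w. Q n (f w) z (g w)) \<in> borel_measurable M"
  unfolding Q_def by measurable

lemma Q_nonneg: "0 \<le> Q n d z u"
  unfolding Q_def by (simp add: alive_nonneg)

lemma Q_le_1: "good n d \<Longrightarrow> Q n d z u \<le> 1"
proof (cases "alive n d z u > 0")
  case True
  assume g: "good n d"
  have "(B n d u)\<^sup>2 \<le> 1\<^sup>2" using B_nonneg[OF g] B_le_1[OF g] by (intro power_mono) auto
  then show ?thesis using alive_ge_1[OF True] unfolding Q_def by simp
next
  case False
  then show ?thesis using alive_nonneg[of n d z u] by (simp add: Q_def)
qed

text \<open>At a death with \<open>k\<close> at risk and \<open>r \<ge> k\<close> alive, \<open>Q\<close> is multiplied by \<open>(1 - 1/k)\<^sup>2 r / (r - 1) \<le> 1 - 1/k\<close>, that is, it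
drops by at least \<open>Q/k\<close>. This is the drop that \<open>d(1/S)\<close> compensates on average.\<close>

lemma Q_jumps:
  assumes g: "good n d"
  obtains \<delta> where "\<And>u. u \<le> z \<Longrightarrow> Q n d z u = 1 / entered n d z + (\<Sum>i<n. if obsX d i < u then \<delta> i else 0)"
    and "\<And>i. i < n \<Longrightarrow> obsX d i < z \<Longrightarrow> \<delta> i \<le> - (Q n d z (obsX d i) / risk n d (obsX d i))"
proof -
  define P where "P A = (\<Prod>i\<in>A. 1 - 1 / risk n d (obsX d i))" for A
  define R where "R A = (\<Sum>i\<in>{..<n} - A. if obsY d i \<le> z then 1 else 0 :: real)" for A
  define f where "f A = (P A)\<^sup>2 / R A" for A
  define L where "L u = {i\<in>{..<n}. obsX d i < u}" for u
  have QL: "Q n d z u = f (L u)" for u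
  proof -
    have "alive n d z u = R (L u)"
    proof -
      have "R (L u) = (\<Sum>i\<in>{i\<in>{..<n}. u \<le> obsX d i}. if obsY d i \<le> z then 1 else 0)"
        unfolding R_def L_def by (intro sum.cong) auto
      also have "\<dots> = (\<Sum>i<n. if u \<le> obsX d i then if obsY d i \<le> z then 1 else 0 else 0)"
        by (rule sum.inter_filter) simp
      also have "\<dots> = alive n d z u" unfolding alive_def by (intro sum.cong) auto
      finally show ?thesis by simp
    qed
    then show ?thesis by (simp add: Q_def f_def P_def L_def B_conv)
  qed
  define \<delta> where "\<delta> i = f (insert i (L (obsX d i))) - f (L (obsX d i))" for i
  show ?thesis
  proof (rule that[of \<delta>])
    fix u
    have inj: "inj_on (obsX d) (L u)" using g by (auto simp: good_def inj_on_def L_def)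
    have "f (L u) - f {} = (\<Sum>i\<in>L u. f {j\<in>L u. obsX d j \<le> obsX d i} - f {j\<in>L u. obsX d j < obsX d i})"
      by (rule telescope_by_rank[OF _ inj]) (simp add: L_def)
    also have "\<dots> = (\<Sum>i\<in>L u. \<delta> i)"
    proof (intro sum.cong refl)
      fix i assume i: "i \<in> L u"
      have "{j\<in>L u. obsX d j \<le> obsX d i} = insert i (L (obsX d i))"
        using i inj by (auto simp: inj_on_def order.order_iff_strict L_def)
      moreover have "{j\<in>L u. obsX d j < obsX d i} = L (obsX d i)"
        using i by (auto simp: L_def)
      ultimately show "f {j\<in>L u. obsX d j \<le> obsX d i} - f {j\<in>L u. obsX d j < obsX d i} = \<delta> i"
        by (simp add: \<delta>_def)
    qed
    also have "\<dots> = (\<Sum>i<n. if obsX d i < u then \<delta> i else 0)"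
      unfolding L_def by (rule sum.inter_filter) simp
    finally show "Q n d z u = 1 / entered n d z + (\<Sum>i<n. if obsX d i < u then \<delta> i else 0)"
      by (simp add: QL f_def P_def R_def entered_def cnt_def obsY_def)
  next
    fix i assume i: "i < n" "obsX d i < z"
    let ?A = "L (obsX d i)" and ?k = "risk n d (obsX d i)"
    have k1: "1 \<le> ?k" by (rule risk_at_obs[OF g i(1)])
    have iA: "i \<notin> ?A" by (simp add: L_def)
    have Ri: "R ?A = 1 + R (insert i ?A)"
    proof -
      have eq: "{..<n} - ?A = insert i ({..<n} - insert i ?A)" using i iA by auto
      have "obsY d i \<le> obsX d i" using g i by (simp add: good_def)
      then have "obsY d i \<le> z" using i by simp
      then show ?thesis unfolding R_def by (subst eq, subst sum.insert) simp_all
    qed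
    have kR: "?k \<le> R ?A"
    proof -
      have "?k = (\<Sum>j\<in>{..<n} - ?A. if obsY d j \<le> obsX d i \<and> obsX d i \<le> obsX d j then 1 else 0)"
        unfolding risk_def by (rule sum.mono_neutral_right) (auto simp: L_def)
      also have "\<dots> \<le> R ?A" unfolding R_def using i by (intro sum_mono) auto
      finally show ?thesis .
    qed
    have P_ins: "P (insert i ?A) = P ?A * (1 - 1 / ?k)"
      unfolding P_def using iA by (subst prod.insert) (auto simp: L_def)
    have "f (insert i ?A) \<le> f ?A * (1 - 1 / ?k)"
    \<comment> \<open>If only one individual is left then \<open>k = r = 1\<close> and both sides vanish.\<close>
    proof (cases "R ?A = 1")
      case True
      then have "?k = 1" using kR k1 by simp
      then show ?thesis by (simp add: f_def P_ins)
    next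
      case False
      define r where "r = R ?A"
      have r: "?k \<le> r" "r > 1" "R (insert i ?A) = r - 1" using False Ri kR k1 by (auto simp: r_def)
      have "(1 - 1 / ?k)\<^sup>2 / (r - 1) \<le> (1 - 1 / ?k) / r"
      proof -
        have "r / ?k \<ge> 1" using r(1) k1 by simp
        then have "(1 - 1 / ?k) * r \<le> r - 1" by (simp add: algebra_simps)
        then have "(1 - 1 / ?k) * ((1 - 1 / ?k) * r) \<le> (1 - 1 / ?k) * (r - 1)"
          using k1 by (intro mult_left_mono) auto
        then have "(1 - 1 / ?k)\<^sup>2 * r \<le> (1 - 1 / ?k) * (r - 1)"
          by (simp only: power2_eq_square mult.assoc)
        then show ?thesis using r(2) by (simp add: divide_le_eq mult.commute pos_le_divide_eq)
      qed
      then have "(P ?A)\<^sup>2 * ((1 - 1 / ?k)\<^sup>2 / (r - 1)) \<le> (P ?A)\<^sup>2 * ((1 - 1 / ?k) / r)"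
        by (intro mult_left_mono) auto
      then show ?thesis by (simp add: f_def P_ins r(3) r_def[symmetric] power_mult_distrib)
    qed
    then show "\<delta> i \<le> - (Q n d z (obsX d i) / ?k)"
      unfolding \<delta>_def QL by (simp add: algebra_simps)
  qed
qed

lemma predictable_Q:
  "predictable n (\<lambda>u d. if \<not> waiting n d b \<and> u < z then Q n d z u / (risk n d u * S u) else 0)"
  unfolding predictable_def
proof (intro allI impI)
  fix u d d' assume a: "agree n u d d'"
  then show "(if \<not> waiting n d b \<and> u < z then Q n d z u / (risk n d u * S u) else 0) =
      (if \<not> waiting n d' b \<and> u < z then Q n d' z u / (risk n d' u * S u) else 0)"
    by (simp add: Q_def waiting_agree[OF a] B_agree[OF a] alive_agree[OF a] risk_agree[OF a])
qed

text \<open>The growth of \<open>1/S\<close> before the first entry is not compensated by deaths. Since somebody enters by time \<open>b\<close>, it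
amounts to at most the factor \<open>1 / S b\<close>.\<close>

lemma Q_pathwise:
  assumes g: "good n d" and z: "S z > 0" and b: "S b > 0" and w: "\<not> waiting n d b"
    and d[measurable]: "d \<in> space (D n)"
  shows "Q n d z z / S z \<le> 1 / entered n d z * (1 / S b)
     - mart n (\<lambda>u d. if \<not> waiting n d b \<and> u < z then Q n d z u / (risk n d u * S u) else 0) d"
proof -
  obtain \<delta> where \<delta>: "\<And>u. u \<le> z \<Longrightarrow> Q n d z u = 1 / entered n d z + (\<Sum>i<n. if obsX d i < u then \<delta> i else 0)"
    and \<delta>_le: "\<And>i. i < n \<Longrightarrow> obsX d i < z \<Longrightarrow> \<delta> i \<le> - (Q n d z (obsX d i) / risk n d (obsX d i))"
    using Q_jumps[OF g] by blast
  let ?k = "\<lambda>u. if u < z then Q n d z u / (risk n d u * S u) else 0"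
  let ?q = "\<lambda>u. if u < z then Q n d z u / (S u)\<^sup>2 else 0"
  have q_eq: "?q = (\<lambda>u. if u < z then (1 / entered n d z + (\<Sum>i<n. if obsX d i < u then \<delta> i else 0)) / (S u)\<^sup>2 else 0)"
    using \<delta> by auto
  note J = jump_process_over_S[OF z, where n = n and x = "obsX d" and \<delta> = \<delta> and base = "1 / entered n d z"]
  have q_int: "integrable \<mu> ?q" using J(1) q_eq by simp
  have J2: "Q n d z z / S z = 1 / entered n d z + (\<Sum>i<n. if obsX d i < z then \<delta> i / S (obsX d i) else 0) + (\<integral>u. ?q u \<partial>\<mu>)"
    using J(2) q_eq \<delta>[of z] by simp
  have jumps: "(\<Sum>i<n. if obsX d i < z then \<delta> i / S (obsX d i) else 0) \<le> - (\<Sum>i<n. ?k (obsX d i))"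
    unfolding sum_negf[symmetric]
  proof (rule sum_mono)
    fix i assume i: "i \<in> {..<n}"
    show "(if obsX d i < z then \<delta> i / S (obsX d i) else 0) \<le> - ?k (obsX d i)"
      using divide_right_mono[OF \<delta>_le[of i], of "S (obsX d i)"] i S_nonneg by auto
  qed
  have ent: "0 \<le> 1 / entered n d z" by (simp add: entered_def cnt_nonneg)
  have hi: "has_bochner_integral \<mu> (\<lambda>u. if u < b then 1 / (S u)\<^sup>2 else 0) (1 / S b - 1)"
    by (rule has_integral_inverse_S_squared(1)[OF b])
  have kr_int: "integrable \<mu> (\<lambda>u. ?k u * risk n d u / S u)"
  proof (rule Bochner_Integration.integrable_bound[OF q_int])
    show "AE u in \<mu>. norm (?k u * risk n d u / S u) \<le> norm (?q u)"
      by (rule AE_I2) (auto simp: power2_eq_square)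
  qed measurable
  have "(\<integral>u. ?q u \<partial>\<mu>) \<le> (\<integral>u. 1 / entered n d z * (if u < b then 1 / (S u)\<^sup>2 else 0) + ?k u * risk n d u / S u \<partial>\<mu>)"
  proof (rule integral_mono[OF q_int])
    show "integrable \<mu> (\<lambda>u. 1 / entered n d z * (if u < b then 1 / (S u)\<^sup>2 else 0) + ?k u * risk n d u / S u)"
      using hi by (intro Bochner_Integration.integrable_add integrable_mult_right kr_int) (simp add: has_bochner_integral_iff)
    fix u
    show "?q u \<le> 1 / entered n d z * (if u < b then 1 / (S u)\<^sup>2 else 0) + ?k u * risk n d u / S u"
    proof (cases "risk n d u = 0 \<and> u < z")
      case True
      show ?thesis
      proof (cases "waiting n d u")
        case wu: True
        have "u < b" using w wu unfolding waiting_def by force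
        then show ?thesis using True wu B_waiting(1)[OF g wu] alive_waiting[OF g wu]
          by (simp add: Q_def)
      next
        case False
        then have "B n d u = 0" using B_hole[OF g] True by simp
        then show ?thesis using True ent by (simp add: Q_def)
      qed
    next
      case False
      then have "?q u = ?k u * risk n d u / S u" by (auto simp: power2_eq_square)
      then show ?thesis using ent by auto
    qed
  qed
  also have "\<dots> = 1 / entered n d z * (1 / S b - 1) + (\<integral>u. ?k u * risk n d u / S u \<partial>\<mu>)"
    using hi kr_int by (subst Bochner_Integration.integral_add) (auto simp: has_bochner_integral_iff)
  finally have "Q n d z z / S z \<le> 1 / entered n d z * (1 / S b) - ((\<Sum>i<n. ?k (obsX d i)) - (\<integral>u. ?k u * risk n d u / S u \<partial>\<mu>))"
    using J2 jumps by (simp add: right_diff_distrib)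
  then show ?thesis using w by (simp add: mart_def)
qed

text \<open>Taking expectations in the pathwise bound leaves the inverse moment of the number of entries by time \<open>z\<close>. The point is that the
bound holds for all \<open>z\<close> with the same dependence on \<open>n\<close>, however small \<open>S z\<close> is.\<close>

lemma supermartingale_bound:
  assumes z: "S z > 0" and b: "S b > 0" and Gs: "Gs z > 0"
  shows "(\<integral>\<^sup>+d. ennreal (if waiting n d b then 0 else (B n d z)\<^sup>2 / (S z * risk n d z)) \<partial>D n)
     \<le> ennreal (2 / (S b * (Suc n * Gs z)))"
proof -
  let ?k = "\<lambda>u d. if \<not> waiting n d b \<and> u < z then Q n d z u / (risk n d u * S u) else 0"
  have k[measurable]: "(\<lambda>(u, d). ?k u d) \<in> borel_measurable (borel \<Otimes>\<^sub>M D n)" by measurable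
  have fin: "(\<integral>\<^sup>+d. \<integral>\<^sup>+u. ennreal (\<bar>?k u d\<bar> * risk n d u / S u) \<partial>\<mu> \<partial>D n) < \<infinity>"
  proof -
    have "(\<integral>\<^sup>+d. \<integral>\<^sup>+u. ennreal (\<bar>?k u d\<bar> * risk n d u / S u) \<partial>\<mu> \<partial>D n)
      \<le> (\<integral>\<^sup>+d. \<integral>\<^sup>+u. ennreal (1 / (S z)\<^sup>2) \<partial>\<mu> \<partial>D n)"
    proof (rule nn_integral_mono_AE, use AE_good in eventually_elim, rule nn_integral_mono, rule ennreal_leI)
      fix d u assume g: "good n d"
      show "\<bar>?k u d\<bar> * risk n d u / S u \<le> 1 / (S z)\<^sup>2"
      proof (cases "u < z \<and> risk n d u \<noteq> 0 \<and> \<not> waiting n d b")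
        case True
        then have Su: "S z \<le> S u" by (intro S_antimono) simp
        have "\<bar>?k u d\<bar> * risk n d u / S u = Q n d z u / (S u)\<^sup>2"
          using True by (simp add: abs_mult risk_nonneg S_nonneg Q_nonneg power2_eq_square)
        also have "\<dots> \<le> 1 / (S z)\<^sup>2"
          using Q_le_1[OF g] Su z by (intro frac_le) (auto intro: power_mono)
        finally show ?thesis .
      qed (use z in auto)
    qed
    also have "\<dots> < \<infinity>" by (simp add: D.emeasure_space_1 \<mu>.emeasure_space_1[simplified])
    finally show ?thesis .
  qed
  have mi: "integrable (D n) (mart n ?k)" and m0: "(\<integral>d. mart n ?k d \<partial>D n) = 0"
    by (rule integrable_mart[OF k predictable_Q fin], rule integral_mart[OF k predictable_Q fin])
  let ?N = "\<lambda>d. if entered n d z > 0 then 1 / entered n d z else 0"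
  have N_eq: "?N d = 1 / entered n d z" for d
    using cnt_nonneg[of n "\<lambda>p. snd p \<le> z" d] by (auto simp: entered_def order.order_iff_strict)
  have [measurable]: "(\<lambda>d. entered n d z) \<in> borel_measurable (D n)"
    unfolding entered_def by measurable
  have N_int: "integrable (D n) (\<lambda>d. 1 / entered n d z)"
  proof (rule D.integrable_const_bound[where B = 1])
    show "AE d in D n. norm (1 / entered n d z) \<le> 1"
      using cnt_ge_1[of n "\<lambda>p. snd p \<le> z"] cnt_nonneg[of n "\<lambda>p. snd p \<le> z"]
      by (intro AE_I2, subst N_eq[symmetric]) (auto simp: entered_def)
  qed measurable
  let ?X = "\<lambda>d. if waiting n d b then 0 else (B n d z)\<^sup>2 / (S z * risk n d z)"
  have le: "AE d in D n. ?X d \<le> 1 / entered n d z * (1 / S b) - mart n ?k d"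
  proof (rule AE_mp[OF AE_good AE_I2], rule impI)
    fix d assume d: "d \<in> space (D n)" and g: "good n d"
    show "?X d \<le> 1 / entered n d z * (1 / S b) - mart n ?k d"
    proof (cases "waiting n d b")
      case True
      then have "mart n ?k d = 0" by (simp add: mart_def)
      then show ?thesis using True b by (simp add: entered_def cnt_nonneg)
    next
      case False
      have "(B n d z)\<^sup>2 / (S z * risk n d z) = Q n d z z / S z" by (simp add: Q_def alive_at mult.commute)
      then show ?thesis using Q_pathwise[OF g z b False d] False by simp
    qed
  qed
  have X0: "AE d in D n. 0 \<le> ?X d" by (rule AE_I2) (auto simp: risk_nonneg S_nonneg)
  have rhs_int: "integrable (D n) (\<lambda>d. 1 / entered n d z * (1 / S b) - mart n ?k d)"
    by (intro Bochner_Integration.integrable_diff integrable_mult_left N_int mi)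
  have "(\<integral>\<^sup>+d. ennreal (?X d) \<partial>D n) \<le> (\<integral>\<^sup>+d. ennreal (1 / entered n d z * (1 / S b) - mart n ?k d) \<partial>D n)"
    by (rule nn_integral_mono_AE, use le in eventually_elim) (rule ennreal_leI)
  also have "\<dots> = ennreal (\<integral>d. 1 / entered n d z * (1 / S b) - mart n ?k d \<partial>D n)"
    by (rule nn_integral_eq_integral[OF rhs_int]) (use le X0 in eventually_elim, linarith)
  also have "(\<integral>d. 1 / entered n d z * (1 / S b) - mart n ?k d \<partial>D n) = (\<integral>d. 1 / entered n d z \<partial>D n) * (1 / S b)"
    by (subst Bochner_Integration.integral_diff[OF integrable_mult_left[OF N_int] mi], subst m0)
       (simp only: integral_mult_left_zero diff_zero)
  also have "ennreal \<dots> \<le> ennreal (2 / (Suc n * Gs z) * (1 / S b))"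
  proof (intro ennreal_leI mult_right_mono)
    have "ennreal (\<integral>d. 1 / entered n d z \<partial>D n) = (\<integral>\<^sup>+d. ennreal (1 / entered n d z) \<partial>D n)"
      by (rule nn_integral_eq_integral[OF N_int, symmetric]) (simp add: entered_def cnt_nonneg)
    also have "\<dots> = (\<integral>\<^sup>+d. ennreal (?N d) \<partial>D n)" by (simp only: N_eq)
    also have "\<dots> \<le> ennreal (2 / (Suc n * Gs z))"
      unfolding entered_def Gs_def by (rule inverse_moment) (use Gs in \<open>auto simp: Gs_def\<close>)
    finally show "(\<integral>d. 1 / entered n d z \<partial>D n) \<le> 2 / (Suc n * Gs z)"
      using Gs by (subst (asm) ennreal_le_iff) auto
  qed (use b in simp)
  finally show ?thesis by (simp add: mult_ac)
qed

end

lemma square_diff_le: "(a - b)\<^sup>2 \<le> 2 * a\<^sup>2 + 2 * b\<^sup>2" for a b :: real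
  using zero_le_power2[of "a + b"] by (simp add: power2_eq_square algebra_simps)

section \<open>Consistency and negligible remainders\<close>

context left_truncation
begin

lemma borel_measurable_Gs[measurable]: "Gs \<in> borel_measurable borel"
  by (rule borel_measurable_mono) (auto simp: mono_def Gs_mono)

text \<open>The contribution of the times before the first entry to the error of \<open>W\<close>.\<close>

definition hole :: "nat \<Rightarrow> sample \<Rightarrow> real \<Rightarrow> real" where
  "hole n d z = (\<integral>u. (if u < z \<and> waiting n d u then 1 / (S u)\<^sup>2 else 0) \<partial>\<mu>)"

text \<open>The convention \<open>x / 0 = 0\<close> makes this integrand vanish when nobody is at risk, as it should.\<close>

abbreviation "kW n z \<equiv> (\<lambda>u d. if u < z then W n d u / risk n d u else 0)"

lemma predictable_kW: "predictable n (kW n z)"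
  unfolding predictable_def W_def using B_agree risk_agree by (metis order_refl)

lemma W_error:
  assumes g: "good n d" and z: "S z > 0" and d[measurable]: "d \<in> space (D n)"
  shows "W n d z - 1 = hole n d z - mart n (kW n z) d" and "0 \<le> hole n d z" and "hole n d z \<le> 1 / S z"
    and "ennreal (hole n d z) = (\<integral>\<^sup>+u. ennreal (if u < z \<and> waiting n d u then 1 / (S u)\<^sup>2 else 0) \<partial>\<mu>)"
proof -
  have hi: "has_bochner_integral \<mu> (\<lambda>u. if u < z then 1 / (S u)\<^sup>2 else 0) (1 / S z - 1)"
    by (rule has_integral_inverse_S_squared(1)[OF z])
  have hole_int: "integrable \<mu> (\<lambda>u. if u < z \<and> waiting n d u then 1 / (S u)\<^sup>2 else 0)"
    by (rule Bochner_Integration.integrable_bound[of \<mu> "\<lambda>u. if u < z then 1 / (S u)\<^sup>2 else 0"])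
       (use hi in \<open>auto simp: has_bochner_integral_iff\<close>)
  show "0 \<le> hole n d z" unfolding hole_def by (rule Bochner_Integration.integral_nonneg) auto
  have "hole n d z \<le> (\<integral>u. (if u < z then 1 / (S u)\<^sup>2 else 0) \<partial>\<mu>)"
    unfolding hole_def by (rule integral_mono[OF hole_int]) (use hi in \<open>auto simp: has_bochner_integral_iff\<close>)
  also have "\<dots> \<le> 1 / S z" using hi by (simp add: has_bochner_integral_iff)
  finally show "hole n d z \<le> 1 / S z" .
  show "ennreal (hole n d z) = (\<integral>\<^sup>+u. ennreal (if u < z \<and> waiting n d u then 1 / (S u)\<^sup>2 else 0) \<partial>\<mu>)"
    unfolding hole_def by (rule nn_integral_eq_integral[OF hole_int, symmetric]) auto
  have eq: "(if u < z then W n d u / S u else 0) = kW n z u d * risk n d u / S u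
      + (if u < z \<and> waiting n d u then 1 / (S u)\<^sup>2 else 0)" for u
    using B_cases[OF g, of u] B_waiting[OF g, of u] by (cases "risk n d u = 0") (auto simp: W_def power2_eq_square)
  have "integrable \<mu> (\<lambda>u. (if u < z then W n d u / S u else 0) - (if u < z \<and> waiting n d u then 1 / (S u)\<^sup>2 else 0))"
    by (intro Bochner_Integration.integrable_diff W_identity(1)[OF g z] hole_int)
  then have k_int: "integrable \<mu> (\<lambda>u. kW n z u d * risk n d u / S u)" unfolding eq by simp
  have "(\<integral>u. (if u < z then W n d u / S u else 0) \<partial>\<mu>) = (\<integral>u. kW n z u d * risk n d u / S u \<partial>\<mu>) + hole n d z"
    unfolding eq hole_def by (rule Bochner_Integration.integral_add[OF k_int hole_int])
  then show "W n d z - 1 = hole n d z - mart n (kW n z) d"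
    using W_identity(2)[OF g z] by (simp add: mart_def)
qed

lemma W_le: "good n d \<Longrightarrow> W n d u \<le> 1 / S u"
  unfolding W_def using B_le_1 S_nonneg by (simp add: divide_right_mono)

end

context truncated_integrand
begin

lemma AE_Gs_pos: "AE u in \<mu>. Gs u > 0"
  using AE_C_pos by eventually_elim (meson Gs_ge_C less_le_trans)

lemma waiting_lim: "(\<lambda>n. \<integral>\<^sup>+u. ennreal ((1 - Gs u) ^ n) \<partial>\<mu>) \<longlonglongrightarrow> 0"
proof -
  have "(\<lambda>n. \<integral>\<^sup>+u. ennreal ((1 - Gs u) ^ n) \<partial>\<mu>) \<longlonglongrightarrow> (\<integral>\<^sup>+u. 0 \<partial>\<mu>)"
  proof (rule nn_integral_dominated_convergence[where w = "\<lambda>_. 1"])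
    show "AE u in \<mu>. ennreal ((1 - Gs u) ^ n) \<le> 1" for n
      using Gs_le_1 by (intro AE_I2) (auto intro!: power_le_one simp: Gs_def)
    show "AE u in \<mu>. (\<lambda>n. ennreal ((1 - Gs u) ^ n)) \<longlonglongrightarrow> 0"
      using AE_Gs_pos
    proof eventually_elim
      fix u assume "Gs u > 0"
      then have "(\<lambda>n. (1 - Gs u) ^ n) \<longlonglongrightarrow> 0" using Gs_le_1[of u] by (intro LIMSEQ_realpow_zero) auto
      then show "(\<lambda>n. ennreal ((1 - Gs u) ^ n)) \<longlonglongrightarrow> 0"
        using tendsto_ennrealI by fastforce
    qed
  qed (auto simp: \<mu>.emeasure_space_1[simplified])
  then show ?thesis by simp
qed

text \<open>Both terms of \<open>W_error\<close> tend to zero in mean square. For the stochastic integral the crude bound \<open>W \<le> 1 / S z\<close> before \<open>z\<close> and the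
inverse moment of the risk set suffice, since \<open>1/G\<close> is integrable; the other term is controlled by the probability
that nobody has entered yet.\<close>

lemma consistency:
  assumes z: "S z > 0"
  shows "(\<lambda>n. \<integral>\<^sup>+d. ennreal ((W n d z - 1)\<^sup>2) \<partial>D n) \<longlonglongrightarrow> 0"
proof -
  let ?a = "\<lambda>n d u. ennreal (1 / (S z)^3) * (if u < z then ennreal (1 / risk n d u) else 0)"
  let ?\<gamma> = "\<lambda>n. (\<integral>\<^sup>+u. ennreal ((1 - Gs u) ^ n) \<partial>\<mu>)"
  let ?c = "\<lambda>n. ennreal (1 / (S z)^3 * (2 * \<alpha> / (Suc n * S z)))"
  let ?e = "\<lambda>n d u. ennreal (if u < z \<and> waiting n d u then 1 / (S u)\<^sup>2 else 0)"
  let ?i = "\<lambda>n d u. ennreal (1 / (S z)^3) * (if waiting n d u then 1 else 0)"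
  define K where "K = (\<integral>\<^sup>+u. ennreal (1 / G u) \<partial>\<mu>)"
  have K: "K < \<infinity>" unfolding K_def by (rule finite_inverse_G)
  have m: "(\<integral>\<^sup>+d. ennreal ((mart n (kW n z) d)\<^sup>2) \<partial>D n) \<le> ?c n * K" for n
  proof -
    have meas[measurable]: "(\<lambda>(u, d). kW n z u d) \<in> borel_measurable (borel \<Otimes>\<^sub>M D n)" by measurable
    have "(\<integral>\<^sup>+d. ennreal ((mart n (kW n z) d)\<^sup>2) \<partial>D n) \<le> (\<integral>\<^sup>+d. \<integral>\<^sup>+u. ennreal ((kW n z u d)\<^sup>2 * risk n d u / S u) \<partial>\<mu> \<partial>D n)"
      by (rule mart_second_moment[OF meas predictable_kW])
    also have "\<dots> \<le> (\<integral>\<^sup>+d. \<integral>\<^sup>+u. ?a n d u \<partial>\<mu> \<partial>D n)"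
    proof (rule nn_integral_mono_AE, use AE_good in eventually_elim, rule nn_integral_mono)
      fix d u assume g: "good n d"
      have "(kW n z u d)\<^sup>2 * risk n d u / S u \<le> 1 / (S z)^3 * (1 / risk n d u)" if "u < z"
      proof (cases "risk n d u = 0")
        case False
        then have r: "risk n d u > 0" using risk_nonneg[of n d u] by simp
        have Su: "S z \<le> S u" using that by (intro S_antimono) simp
        have W1: "W n d u \<le> 1 / S z" using W_le[OF g, of u] Su z by (meson frac_le order_trans order_refl zero_le_one)
        have "(kW n z u d)\<^sup>2 * risk n d u / S u = (W n d u)\<^sup>2 * (1 / S u) * (1 / risk n d u)"
          using that r by (simp add: power2_eq_square)
        also have "\<dots> \<le> (1 / S z)\<^sup>2 * (1 / S z) * (1 / risk n d u)"
          using W1 W_nonneg[OF g] Su z r by (intro mult_right_mono mult_mono power_mono) (auto intro!: frac_le)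
        also have "(1 / S z)\<^sup>2 * (1 / S z) = 1 / (S z)^3" by (simp add: power2_eq_square power3_eq_cube)
        finally show ?thesis .
      qed simp
      then show "ennreal ((kW n z u d)\<^sup>2 * risk n d u / S u) \<le> ?a n d u"
        using z by (auto simp: ennreal_mult[symmetric] risk_nonneg intro!: ennreal_leI)
    qed
    also have "\<dots> = (\<integral>\<^sup>+u. \<integral>\<^sup>+d. ?a n d u \<partial>D n \<partial>\<mu>)"
      by (rule D\<mu>.Fubini'[symmetric]) measurable
    also have "\<dots> \<le> (\<integral>\<^sup>+u. ?c n * ennreal (1 / G u) \<partial>\<mu>)"
    proof (rule nn_integral_mono_AE, use AE_C_pos AE_G_pos AE_S_pos in eventually_elim)
      fix u assume u: "C u > 0" "G u > 0" "S u > 0"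
      show "(\<integral>\<^sup>+d. ?a n d u \<partial>D n)
         \<le> ?c n * ennreal (1 / G u)"
      proof (cases "u < z")
        case True
        have "(\<integral>\<^sup>+d. ?a n d u \<partial>D n)
            = ennreal (1 / (S z)^3) * (\<integral>\<^sup>+d. ennreal (1 / risk n d u) \<partial>D n)"
          using True by (simp add: nn_integral_cmult)
        also have "\<dots> \<le> ennreal (1 / (S z)^3) * ennreal (2 / (Suc n * C u))"
          by (intro mult_left_mono inverse_risk_moment u) simp
        also have "\<dots> = ennreal (1 / (S z)^3 * (2 / (Suc n * C u)))"
          using z u by (subst ennreal_mult[symmetric]) auto
        also have "\<dots> \<le> ennreal (1 / (S z)^3 * (2 * \<alpha> / (Suc n * S z)) * (1 / G u))"
        proof (rule ennreal_leI)
          have "2 / (Suc n * C u) = 2 * \<alpha> / (Suc n * (G u * S u))"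
            using \<alpha>_pos by (simp add: C_def)
          also have "\<dots> \<le> 2 * \<alpha> / (Suc n * (G u * S z))"
            using True S_antimono[of u z] u z \<alpha>_pos by (intro frac_le mult_left_mono) auto
          also have "\<dots> = 2 * \<alpha> / (Suc n * S z) * (1 / G u)" by (simp add: mult_ac)
          finally have "1 / (S z)^3 * (2 / (Suc n * C u)) \<le> 1 / (S z)^3 * (2 * \<alpha> / (Suc n * S z) * (1 / G u))"
            using z by (intro mult_left_mono) auto
          then show "1 / (S z)^3 * (2 / (Suc n * C u)) \<le> 1 / (S z)^3 * (2 * \<alpha> / (Suc n * S z)) * (1 / G u)"
            by (simp only: mult.assoc)
        qed
        also have "\<dots> = ?c n * ennreal (1 / G u)"
          using z u \<alpha>_pos by (intro ennreal_mult) auto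
        finally show ?thesis .
      qed simp
    qed
    also have "\<dots> = ?c n * K"
      unfolding K_def by (rule nn_integral_cmult) measurable
    finally show ?thesis .
  qed
  have h: "(\<integral>\<^sup>+d. ennreal ((hole n d z)\<^sup>2) \<partial>D n) \<le> ennreal (1 / (S z)^3) * (?\<gamma> n)" for n
  proof -
    have "(\<integral>\<^sup>+d. ennreal ((hole n d z)\<^sup>2) \<partial>D n)
       \<le> (\<integral>\<^sup>+d. \<integral>\<^sup>+u. ?i n d u \<partial>\<mu> \<partial>D n)"
    proof (rule nn_integral_mono_AE, rule AE_mp[OF AE_good AE_I2], rule impI)
      fix d assume d[measurable]: "d \<in> space (D n)" and g: "good n d"
      note e = W_error[OF g z d]
      have "ennreal ((hole n d z)\<^sup>2) \<le> ennreal (1 / S z * hole n d z)"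
        using e(2,3) by (intro ennreal_leI) (simp add: power2_eq_square mult_right_mono del: times_divide_eq_left)
      also have "\<dots> = ennreal (1 / S z) * (\<integral>\<^sup>+u. ?e n d u \<partial>\<mu>)"
        unfolding e(4)[symmetric] using e(2) z by (intro ennreal_mult) auto
      also have "\<dots> = (\<integral>\<^sup>+u. ennreal (1 / S z) * ?e n d u \<partial>\<mu>)"
        by (rule nn_integral_cmult[symmetric]) measurable
      also have "\<dots> \<le> (\<integral>\<^sup>+u. ?i n d u \<partial>\<mu>)"
      proof (rule nn_integral_mono)
        fix u
        have "1 / S z * (1 / (S u)\<^sup>2) \<le> 1 / (S z)^3" if "u < z"
        proof -
          have "1 / S z * (1 / (S u)\<^sup>2) \<le> 1 / S z * (1 / (S z)\<^sup>2)"
            using that z S_antimono[of u z] by (intro mult_left_mono frac_le power_mono) auto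
          then show ?thesis by (simp add: power2_eq_square power3_eq_cube)
        qed
        then show "ennreal (1 / S z) * ?e n d u
          \<le> ?i n d u"
          using z by (auto simp: ennreal_mult[symmetric] S_nonneg mult.commute intro!: ennreal_leI)
      qed
      finally show "ennreal ((hole n d z)\<^sup>2) \<le> (\<integral>\<^sup>+u. ?i n d u \<partial>\<mu>)" .
    qed
    also have "\<dots> = (\<integral>\<^sup>+u. \<integral>\<^sup>+d. ?i n d u \<partial>D n \<partial>\<mu>)"
      by (rule D\<mu>.Fubini'[symmetric]) measurable
    also have "\<dots> = ennreal (1 / (S z)^3) * (?\<gamma> n)"
      by (simp add: nn_integral_cmult prob_waiting)
    finally show ?thesis .
  qed
  have bound: "(\<integral>\<^sup>+d. ennreal ((W n d z - 1)\<^sup>2) \<partial>D n) \<le>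
      2 * (ennreal (1 / (S z)^3) * (?\<gamma> n))
      + 2 * (?c n * K)" for n
  proof -
    have [measurable]: "(\<lambda>(u, d). kW n z u d) \<in> borel_measurable (borel \<Otimes>\<^sub>M D n)" by measurable
    have [measurable]: "(\<lambda>d. hole n d z) \<in> borel_measurable (D n)" unfolding hole_def by measurable
    have "(\<integral>\<^sup>+d. ennreal ((W n d z - 1)\<^sup>2) \<partial>D n)
      \<le> (\<integral>\<^sup>+d. 2 * ennreal ((hole n d z)\<^sup>2) + 2 * ennreal ((mart n (kW n z) d)\<^sup>2) \<partial>D n)"
    proof (rule nn_integral_mono_AE, rule AE_mp[OF AE_good AE_I2], rule impI)
      fix d assume d: "d \<in> space (D n)" and g: "good n d"
      have "(W n d z - 1)\<^sup>2 \<le> 2 * (hole n d z)\<^sup>2 + 2 * (mart n (kW n z) d)\<^sup>2"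
        unfolding W_error(1)[OF g z d] using zero_le_power2[of "hole n d z + mart n (kW n z) d"]
        by (simp add: power2_eq_square algebra_simps)
      then have "ennreal ((W n d z - 1)\<^sup>2) \<le> ennreal (2 * (hole n d z)\<^sup>2 + 2 * (mart n (kW n z) d)\<^sup>2)"
        by (rule ennreal_leI)
      also have "\<dots> = 2 * ennreal ((hole n d z)\<^sup>2) + 2 * ennreal ((mart n (kW n z) d)\<^sup>2)"
        by (subst ennreal_plus) (auto simp: ennreal_mult)
      finally show "ennreal ((W n d z - 1)\<^sup>2) \<le> 2 * ennreal ((hole n d z)\<^sup>2) + 2 * ennreal ((mart n (kW n z) d)\<^sup>2)" .
    qed
    also have "\<dots> = 2 * (\<integral>\<^sup>+d. ennreal ((hole n d z)\<^sup>2) \<partial>D n) + 2 * (\<integral>\<^sup>+d. ennreal ((mart n (kW n z) d)\<^sup>2) \<partial>D n)"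
      by (subst nn_integral_add) (auto simp: nn_integral_cmult)
    also have "\<dots> \<le> 2 * (ennreal (1 / (S z)^3) * (?\<gamma> n))
      + 2 * (?c n * K)"
      by (intro add_mono mult_left_mono h m) auto
    finally show ?thesis .
  qed
  have lim1: "(\<lambda>n. 2 * (ennreal (1 / (S z)^3) * (?\<gamma> n))) \<longlonglongrightarrow> 2 * (ennreal (1 / (S z)^3) * 0)"
    by (intro ennreal_tendsto_cmult waiting_lim) auto
  have lim2: "(\<lambda>n. 2 * (?c n * K)) \<longlonglongrightarrow> 2 * 0"
  proof (intro ennreal_tendsto_cmult)
    obtain k where k: "K = ennreal k" "0 \<le> k" using K by (cases K) auto
    have "(\<lambda>n. 1 / (S z)^3 * (2 * \<alpha> / S z) * k * (1 / real (Suc n))) \<longlonglongrightarrow> 1 / (S z)^3 * (2 * \<alpha> / S z) * k * 0"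
      by (intro tendsto_mult tendsto_const LIMSEQ_Suc[OF lim_1_over_n])
    from tendsto_ennrealI[OF this]
    have "(\<lambda>n. ennreal (1 / (S z)^3 * (2 * \<alpha> / S z) * k * (1 / real (Suc n)))) \<longlonglongrightarrow> ennreal 0"
      by (simp only: mult_zero_right)
    moreover have "?c n * K = ennreal (1 / (S z)^3 * (2 * \<alpha> / S z) * k * (1 / real (Suc n)))" for n
    proof -
      have "?c n * K = ennreal (1 / (S z)^3 * (2 * \<alpha> / (Suc n * S z)) * k)"
        unfolding k using k(2) z \<alpha>_pos by (intro ennreal_mult[symmetric]) auto
      then show ?thesis by (simp add: mult_ac del: of_nat_Suc)
    qed
    ultimately show "(\<lambda>n. ?c n * K) \<longlonglongrightarrow> 0" by simp
  qed simp
  show ?thesis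
  proof (rule tendsto_sandwich[OF _ _ tendsto_const])
    show "\<forall>\<^sub>F n in sequentially. (\<integral>\<^sup>+d. ennreal ((W n d z - 1)\<^sup>2) \<partial>D n) \<le>
      2 * (ennreal (1 / (S z)^3) * (?\<gamma> n))
      + 2 * (?c n * K)"
      using bound by simp
    show "(\<lambda>n. 2 * (ennreal (1 / (S z)^3) * (?\<gamma> n))
      + 2 * (?c n * K)) \<longlonglongrightarrow> 0"
      using tendsto_add[OF lim1 lim2] by simp
  qed simp
qed

text \<open>The isometry bounds the normalised second moment of the first remainder by an integral against \<open>\<psi>\<^sup>2 d\<Lambda>\<close>; this is its
integrand, on the event that somebody enters by time \<open>b\<close>.\<close>

definition mean_sq_dev :: "nat \<Rightarrow> real \<Rightarrow> real \<Rightarrow> ennreal" where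
  "mean_sq_dev n b u = (\<integral>\<^sup>+d. ennreal (if waiting n d b then 0 else (n * W n d u / risk n d u - 1 / C u)\<^sup>2 * (risk n d u / n)) \<partial>D n)"

text \<open>The dominating function. By \<open>(x - y)\<^sup>2 \<le> 2x\<^sup>2 + 2y\<^sup>2\<close> the bound splits into the supermartingale bound and the first moment of the
risk set. The former is of order \<open>1/C\<close> because \<open>G / G\<^sup>*\<close> is bounded, where \<open>G\<^sup>*\<close> is the distribution function
of an observed entry time; this ratio is estimated separately on the two sides of \<open>b\<close>.\<close>

lemma mean_sq_dev_bound:
  assumes b: "S b > 0" "G b > 0"
  obtains K where "0 \<le> K" "\<And>n u. S u > 0 \<Longrightarrow> G u > 0 \<Longrightarrow> mean_sq_dev n b u \<le> ennreal (K / C u)"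
proof -
  define \<kappa> where "\<kappa> = 1 / S b + 1 / (\<alpha> * C b)"
  have Cb: "C b > 0" using b \<alpha>_pos by (simp add: C_def)
  have \<kappa>: "0 \<le> \<kappa>" using b Cb \<alpha>_pos by (simp add: \<kappa>_def)
  show ?thesis
  proof (rule that[of "4 * \<kappa> / S b + 2"])
    show "0 \<le> 4 * \<kappa> / S b + 2" using \<kappa> b by simp
    fix n u assume u: "S u > 0" "G u > 0"
    then have Cu: "C u > 0" using \<alpha>_pos by (simp add: C_def)
    then have Gsu: "Gs u > 0" using Gs_ge_C[of u] by simp
    show "mean_sq_dev n b u \<le> ennreal ((4 * \<kappa> / S b + 2) / C u)"
    proof (cases "n = 0")
      case True
      then show ?thesis by (simp add: mean_sq_dev_def cong: if_cong)
    next
      case False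
      then have n: "real n > 0" by simp
      have ratio: "G u / (\<alpha> * Gs u) \<le> \<kappa>"
      proof (cases "u \<le> b")
        case True
        have "G u * S b \<le> G u * S u" using S_antimono[OF True] u by (intro mult_left_mono) auto
        also have "\<dots> = \<alpha> * C u" using \<alpha>_pos by (simp add: C_def)
        also have "\<dots> \<le> \<alpha> * Gs u" using Gs_ge_C \<alpha>_pos by (intro mult_left_mono) auto
        finally have "G u / (\<alpha> * Gs u) \<le> 1 / S b"
          using b Gsu \<alpha>_pos by (simp add: divide_le_eq pos_le_divide_eq mult_ac)
        moreover have "0 \<le> 1 / (\<alpha> * C b)" using \<alpha>_pos Cb by simp
        ultimately show ?thesis unfolding \<kappa>_def by linarith
      next
        case False
        then have "C b \<le> Gs u" using Gs_ge_C[of b] Gs_mono[of b u] by simp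
        then have "G u / (\<alpha> * Gs u) \<le> 1 / (\<alpha> * C b)"
          using Cb \<alpha>_pos G_le_1[of u] by (intro frac_le mult_left_mono) auto
        moreover have "0 \<le> 1 / S b" using b by simp
        ultimately show ?thesis unfolding \<kappa>_def by linarith
      qed
      let ?X = "\<lambda>d. if waiting n d b then 0 else (B n d u)\<^sup>2 / (S u * risk n d u)"
      have pw: "ennreal (if waiting n d b then 0 else (n * W n d u / risk n d u - 1 / C u)\<^sup>2 * (risk n d u / n))
         \<le> ennreal (2 * n / S u) * ennreal (?X d) + ennreal (2 / (n * (C u)\<^sup>2)) * ennreal (risk n d u)" for d
      proof (cases "waiting n d b")
        case False
        have "(n * W n d u / risk n d u - 1 / C u)\<^sup>2 \<le> 2 * (n * W n d u / risk n d u)\<^sup>2 + 2 * (1 / C u)\<^sup>2"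
          by (rule square_diff_le)
        then have "(n * W n d u / risk n d u - 1 / C u)\<^sup>2 * (risk n d u / n)
           \<le> (2 * (n * W n d u / risk n d u)\<^sup>2 + 2 * (1 / C u)\<^sup>2) * (risk n d u / n)"
          by (rule mult_right_mono) (simp add: risk_nonneg)
        also have "\<dots> = 2 * n / S u * ?X d + 2 / (n * (C u)\<^sup>2) * risk n d u"
          using False n by (cases "risk n d u = 0") (simp_all add: W_def power2_eq_square field_simps)
        finally have *: "(n * W n d u / risk n d u - 1 / C u)\<^sup>2 * (risk n d u / n)
           \<le> 2 * n / S u * ?X d + 2 / (n * (C u)\<^sup>2) * risk n d u" .
        have X0: "0 \<le> ?X d" by (simp add: risk_nonneg S_nonneg)
        have "ennreal ((n * W n d u / risk n d u - 1 / C u)\<^sup>2 * (risk n d u / n))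
          \<le> ennreal (2 * n / S u * ?X d + 2 / (n * (C u)\<^sup>2) * risk n d u)"
          by (rule ennreal_leI[OF *])
        also have "\<dots> = ennreal (2 * n / S u * ?X d) + ennreal (2 / (n * (C u)\<^sup>2) * risk n d u)"
          using X0 u by (intro ennreal_plus mult_nonneg_nonneg risk_nonneg) auto
        also have "ennreal (2 * n / S u * ?X d) = ennreal (2 * n / S u) * ennreal (?X d)"
          using X0 u by (intro ennreal_mult) auto
        also have "ennreal (2 / (n * (C u)\<^sup>2) * risk n d u) = ennreal (2 / (n * (C u)\<^sup>2)) * ennreal (risk n d u)"
          by (intro ennreal_mult risk_nonneg) auto
        finally show ?thesis using False by simp
      qed simp
      have "mean_sq_dev n b u \<le> (\<integral>\<^sup>+d. ennreal (2 * n / S u) * ennreal (?X d) + ennreal (2 / (n * (C u)\<^sup>2)) * ennreal (risk n d u) \<partial>D n)"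
        unfolding mean_sq_dev_def by (rule nn_integral_mono) (rule pw)
      also have "\<dots> = ennreal (2 * n / S u) * (\<integral>\<^sup>+d. ennreal (?X d) \<partial>D n) + ennreal (2 / (n * (C u)\<^sup>2)) * ennreal (n * C u)"
        by (subst nn_integral_add, measurable, subst nn_integral_cmult, measurable, subst nn_integral_cmult, measurable)
           (simp add: risk_first_moment)
      also have "\<dots> \<le> ennreal (2 * n / S u) * ennreal (2 / (S b * (Suc n * Gs u))) + ennreal (2 / (n * (C u)\<^sup>2)) * ennreal (n * C u)"
        by (intro add_right_mono mult_left_mono supermartingale_bound u b Gsu) simp
      also have "\<dots> = ennreal (2 * n / S u * (2 / (S b * (Suc n * Gs u))) + 2 / (n * (C u)\<^sup>2) * (n * C u))"
        using u b Gsu Cu by (subst (1 2) ennreal_mult[symmetric]) (auto intro!: ennreal_plus[symmetric])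
      also have "\<dots> \<le> ennreal ((4 * \<kappa> / S b + 2) / C u)"
      proof (rule ennreal_leI)
        have "2 / (n * (C u)\<^sup>2) * (n * C u) = 2 / C u" using n Cu by (simp add: power2_eq_square)
        moreover have "2 * n / S u * (2 / (S b * (Suc n * Gs u))) \<le> 4 * \<kappa> / S b / C u"
        proof -
          have "2 * n / S u * (2 / (S b * (Suc n * Gs u))) = (n / Suc n) * (4 / S b * (1 / (S u * Gs u)))"
            by (simp add: mult_ac del: of_nat_Suc)
          also have "\<dots> \<le> 1 * (4 / S b * (1 / (S u * Gs u)))"
            using u b Gsu by (intro mult_right_mono) auto
          also have "1 / (S u * Gs u) = G u / (\<alpha> * Gs u) * (1 / C u)"
            using u Gsu \<alpha>_pos by (simp add: C_def)
          also have "1 * (4 / S b * (G u / (\<alpha> * Gs u) * (1 / C u))) \<le> 1 * (4 / S b * (\<kappa> * (1 / C u)))"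
            using ratio b Cu by (intro mult_left_mono mult_right_mono) auto
          finally show ?thesis by simp
        qed
        ultimately show "2 * n / S u * (2 / (S b * (Suc n * Gs u))) + 2 / (n * (C u)\<^sup>2) * (n * C u) \<le> (4 * \<kappa> / S b + 2) / C u"
          by (simp add: add_divide_distrib del: of_nat_Suc)
      qed
      finally show ?thesis .
    qed
  qed
qed

text \<open>The deviation \<open>W/c - 1/C\<close>, with \<open>c\<close> the empirical frequency at risk, is controlled by \<open>W - 1\<close> and \<open>c - C\<close>. The factor \<open>1/c\<close> is harmless
where \<open>c \<ge> C/2\<close>; elsewhere \<open>W\<close> is bounded by \<open>1 / S u\<close>, and \<open>(c - C)\<^sup>2 / c\<close> is negligible by \<open>relative_deviation\<close>.\<close>

lemma mean_sq_dev_lim: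
  assumes u: "S u > 0" "G u > 0"
  shows "(\<lambda>n. mean_sq_dev n b u) \<longlonglongrightarrow> 0"
proof -
  let ?c1 = "ennreal (4 / C u)"
  let ?c2 = "ennreal (10 / ((S u)\<^sup>2 * (C u)\<^sup>2))"
  have Cu: "C u > 0" using u \<alpha>_pos by (simp add: C_def)
  define r where "r n = ennreal (2 / (C u * real n) + real n * exp (- (real n * (C u / 2 * (1 - ln 2)))))" for n
  have rlim: "r \<longlonglongrightarrow> 0"
    unfolding r_def[abs_def] using tendsto_ennrealI[OF relative_deviation_lim[OF Cu]] by simp
  let ?w = "\<lambda>n. \<integral>\<^sup>+d. ennreal ((W n d u - 1)\<^sup>2) \<partial>D n"
  let ?R = "\<lambda>n d. if risk n d u > 0 then (risk n d u / n - C u)\<^sup>2 / (risk n d u / n) else 0"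
  have bound: "mean_sq_dev n b u \<le> ?c1 * ?w n + ?c2 * r n" if n: "n > 0" for n
  proof -
    have rel: "(\<integral>\<^sup>+d. ennreal (?R n d) \<partial>D n) \<le> r n"
      unfolding r_def risk_cnt by (rule relative_deviation) (use Cu n in \<open>auto simp: C_eq_prob\<close>)
    have "mean_sq_dev n b u \<le> (\<integral>\<^sup>+d. ?c1 * ennreal ((W n d u - 1)\<^sup>2)
        + ?c2 * ennreal (?R n d) \<partial>D n)"
      unfolding mean_sq_dev_def
    proof (rule nn_integral_mono_AE, use AE_good in eventually_elim)
      fix d assume g: "good n d"
      define w where "w = W n d u"
      define c where "c = risk n d u / n"
      have c0: "0 \<le> c" by (simp add: c_def risk_nonneg)
      have w0: "0 \<le> w" "w \<le> 1 / S u" unfolding w_def by (rule W_nonneg[OF g], rule W_le[OF g])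
      have R0: "0 \<le> ?R n d" by (simp add: risk_nonneg)
      have main: "(n * w / risk n d u - 1 / C u)\<^sup>2 * c \<le> 4 / C u * (w - 1)\<^sup>2 + 10 / ((S u)\<^sup>2 * (C u)\<^sup>2) * ?R n d"
      proof (cases "risk n d u > 0")
        case False
        then have "risk n d u = 0" using risk_nonneg[of n d u] by simp
        then show ?thesis using Cu by (simp add: c_def)
      next
        case True
        then have c: "c > 0" using n by (simp add: c_def)
        define \<rho> where "\<rho> = (c - C u)\<^sup>2 / c"
        have R: "?R n d = \<rho>" using True by (simp add: \<rho>_def c_def)
        have \<rho>0: "0 \<le> \<rho>" using c by (simp add: \<rho>_def)
        have nw: "n * w / risk n d u = w / c" using True n by (simp add: c_def)
        have "w / c - 1 / C u = (C u * (w - 1) + (C u - c)) / (C u * c)"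
          using c Cu by (simp add: field_simps)
        then have "(n * w / risk n d u - 1 / C u)\<^sup>2 * c = ((C u * (w - 1) + (C u - c)) / (C u * c))\<^sup>2 * c"
          by (simp only: nw)
        also have "\<dots> = (C u * (w - 1) + (C u - c))\<^sup>2 / ((C u)\<^sup>2 * c)"
          using c by (simp add: power_divide power_mult_distrib power2_eq_square[of c])
        also have "\<dots> \<le> (2 * (C u * (w - 1))\<^sup>2 + 2 * (c - C u)\<^sup>2) / ((C u)\<^sup>2 * c)"
        proof (intro divide_right_mono)
          show "(C u * (w - 1) + (C u - c))\<^sup>2 \<le> 2 * (C u * (w - 1))\<^sup>2 + 2 * (c - C u)\<^sup>2"
            using zero_le_power2[of "C u * (w - 1) - (C u - c)"]
            unfolding power2_eq_square by (simp add: algebra_simps)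
        qed (use c in simp)
        also have "\<dots> = 2 * ((w - 1)\<^sup>2 / c) + 2 / (C u)\<^sup>2 * \<rho>"
          unfolding power_mult_distrib using c Cu by (simp add: \<rho>_def add_divide_distrib)
        also have "2 / (C u)\<^sup>2 * \<rho> \<le> 2 / ((S u)\<^sup>2 * (C u)\<^sup>2) * \<rho>"
        proof (rule mult_right_mono[OF _ \<rho>0])
          have "(S u)\<^sup>2 * (C u)\<^sup>2 \<le> 1 * (C u)\<^sup>2"
            using S_le_1[of u] u by (intro mult_right_mono power_le_one) auto
          then show "2 / (C u)\<^sup>2 \<le> 2 / ((S u)\<^sup>2 * (C u)\<^sup>2)" using u Cu by (intro divide_left_mono) auto
        qed
        also have "(w - 1)\<^sup>2 / c \<le> 2 / C u * (w - 1)\<^sup>2 + 4 / ((S u)\<^sup>2 * (C u)\<^sup>2) * \<rho>"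
        proof (cases "c \<ge> C u / 2")
          case True
          then have "(w - 1)\<^sup>2 / c \<le> (w - 1)\<^sup>2 / (C u / 2)" using Cu by (intro divide_left_mono) (auto intro!: mult_pos_pos c)
          also have "\<dots> = 2 / C u * (w - 1)\<^sup>2" by simp
          finally show ?thesis using \<rho>0 by (simp add: add_increasing2)
        next
          case False
          have "1 \<le> 1 / S u" using u S_le_1[of u] by simp
          then have "\<bar>w - 1\<bar> \<le> \<bar>1 / S u\<bar>" using w0 by linarith
          then have w2: "(w - 1)\<^sup>2 \<le> (1 / S u)\<^sup>2" by (simp only: abs_le_square_iff)
          have "(C u / 2)\<^sup>2 \<le> (c - C u)\<^sup>2"
            using False Cu by (simp only: abs_le_square_iff[symmetric])
          then have "1 \<le> 4 / (C u)\<^sup>2 * (c - C u)\<^sup>2" using Cu by (simp add: field_simps power2_eq_square)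
          then have "(w - 1)\<^sup>2 * 1 \<le> (1 / S u)\<^sup>2 * (4 / (C u)\<^sup>2 * (c - C u)\<^sup>2)"
            using w2 by (intro mult_mono) auto
          then have "(w - 1)\<^sup>2 / c \<le> (1 / S u)\<^sup>2 * (4 / (C u)\<^sup>2 * (c - C u)\<^sup>2) / c"
            using c by (intro divide_right_mono) auto
          also have "\<dots> = 4 / ((S u)\<^sup>2 * (C u)\<^sup>2) * \<rho>" by (simp add: \<rho>_def power_divide)
          finally show ?thesis using Cu by (simp add: add_increasing)
        qed
        finally show ?thesis unfolding R by (simp add: add_divide_distrib distrib_right)
      qed
      have "ennreal (if waiting n d b then 0 else (n * W n d u / risk n d u - 1 / C u)\<^sup>2 * (risk n d u / n))
        \<le> ennreal ((n * w / risk n d u - 1 / C u)\<^sup>2 * c)"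
        unfolding w_def c_def by (intro ennreal_leI) (auto simp: risk_nonneg)
      also have "\<dots> \<le> ennreal (4 / C u * (w - 1)\<^sup>2 + 10 / ((S u)\<^sup>2 * (C u)\<^sup>2) * ?R n d)"
        by (rule ennreal_leI[OF main])
      also have "\<dots> = ennreal (4 / C u * (w - 1)\<^sup>2) + ennreal (10 / ((S u)\<^sup>2 * (C u)\<^sup>2) * ?R n d)"
        using Cu R0 by (intro ennreal_plus mult_nonneg_nonneg) auto
      also have "ennreal (4 / C u * (w - 1)\<^sup>2) = ?c1 * ennreal ((w - 1)\<^sup>2)"
        using Cu by (intro ennreal_mult) auto
      also have "ennreal (10 / ((S u)\<^sup>2 * (C u)\<^sup>2) * ?R n d) = ?c2 * ennreal (?R n d)"
        using R0 by (intro ennreal_mult) auto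
      finally show "ennreal (if waiting n d b then 0 else (n * W n d u / risk n d u - 1 / C u)\<^sup>2 * (risk n d u / n))
        \<le> ?c1 * ennreal ((W n d u - 1)\<^sup>2) + ?c2 * ennreal (?R n d)"
        by (simp only: w_def)
    qed
    also have "\<dots> = ?c1 * ?w n + ?c2 * (\<integral>\<^sup>+d. ennreal (?R n d) \<partial>D n)"
      by (subst nn_integral_add, measurable, subst nn_integral_cmult, measurable, subst nn_integral_cmult, measurable)
    also have "\<dots> \<le> ?c1 * ?w n + ?c2 * r n"
      by (intro add_left_mono mult_left_mono rel) simp
    finally show ?thesis .
  qed
  show ?thesis
  proof (rule tendsto_sandwich[OF _ _ tendsto_const])
    show "\<forall>\<^sub>F n in sequentially. mean_sq_dev n b u \<le> ?c1 * ?w n + ?c2 * r n"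
      using eventually_gt_at_top[of 0] by eventually_elim (rule bound)
    have "(\<lambda>n. ?c1 * ?w n + ?c2 * r n) \<longlonglongrightarrow>
       ?c1 * 0 + ?c2 * 0"
      by (intro tendsto_add ennreal_tendsto_cmult consistency u rlim) auto
    then show "(\<lambda>n. ?c1 * ?w n + ?c2 * r n) \<longlonglongrightarrow> 0" by simp
  qed simp
qed

end

lemma one_le_ennrealI: "1 \<le> x \<Longrightarrow> 1 \<le> ennreal x"
  by (metis ennreal_1 ennreal_leI)

text \<open>Both \<open>(1 - c)\<^sup>n \<le> exp (- n c)\<close> and \<open>\<surd>x \<le> 1 + x \<le> exp x\<close> are used, the latter for \<open>x = n c\<close>.\<close>

lemma sqrt_geometric_bound:
  fixes c :: real assumes "0 < c" "c \<le> 1"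
  shows "sqrt (real n) * (1 - c) ^ n \<le> 1 / sqrt c"
proof -
  have "(1 - c) ^ n \<le> exp (- c) ^ n"
    using exp_ge_add_one_self[of "- c"] assms by (intro power_mono) auto
  also have "\<dots> = 1 / exp (n * c)"
    unfolding exp_of_nat_mult[symmetric] by (simp add: exp_minus inverse_eq_divide)
  finally have 1: "(1 - c) ^ n \<le> 1 / exp (n * c)" .
  have "sqrt (n * c) \<le> 1 + n * c"
    using assms by (intro real_le_lsqrt) (auto simp: power2_eq_square algebra_simps)
  also have "\<dots> \<le> exp (n * c)" by (rule exp_ge_add_one_self)
  finally have 2: "sqrt (n * c) \<le> exp (n * c)" .
  have "sqrt (n * c) * (1 - c) ^ n \<le> exp (n * c) * (1 / exp (n * c))"
    using 1 2 assms by (intro mult_mono) auto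
  then have "sqrt (n * c) * (1 - c) ^ n \<le> 1" by simp
  then show ?thesis using assms by (simp add: real_sqrt_mult field_simps)
qed

context truncated_integrand
begin

text \<open>The integrand of the first remainder, multiplied by \<open>n\<close>. Restricting to the event that somebody enters by time \<open>b\<close> keeps it predictable,
because entry times count as known.\<close>

definition h :: "nat \<Rightarrow> real \<Rightarrow> real \<Rightarrow> sample \<Rightarrow> real" where
  "h n b u d = (if waiting n d b then 0 else \<psi> u * (n * W n d u / risk n d u - 1 / C u))"

lemma measurable_h[measurable]: "(\<lambda>(u, d). h n b u d) \<in> borel_measurable (borel \<Otimes>\<^sub>M D n)"
  unfolding h_def[abs_def] by measurable

lemma predictable_h: "predictable n (h n b)"
  unfolding predictable_def
proof (intro allI impI)
  fix u d d' assume a: "agree n u d d'"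
  then show "h n b u d = h n b u d'"
    by (simp add: h_def W_def waiting_agree[OF a] B_agree[OF a] risk_agree[OF a])
qed

lemma first_remainder:
  assumes b: "S b > 0" "G b > 0"
  shows "(\<lambda>n. \<integral>\<^sup>+d. ennreal ((mart n (h n b) d)\<^sup>2 / n) \<partial>D n) \<longlonglongrightarrow> 0"
proof -
  let ?w = "\<lambda>u. ennreal ((\<psi> u)\<^sup>2 / S u)"
  let ?e = "\<lambda>n d u. ennreal (1 / n) * ennreal ((h n b u d)\<^sup>2 * risk n d u / S u)"
  obtain K where K: "0 \<le> K" "\<And>n u. S u > 0 \<Longrightarrow> G u > 0 \<Longrightarrow> mean_sq_dev n b u \<le> ennreal (K / C u)"
    using mean_sq_dev_bound[OF b] by blast
  have [measurable]: "mean_sq_dev n b \<in> borel_measurable borel" for n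
    unfolding mean_sq_dev_def[abs_def] by measurable
  have bound: "(\<integral>\<^sup>+d. ennreal ((mart n (h n b) d)\<^sup>2 / n) \<partial>D n) \<le> (\<integral>\<^sup>+u. ?w u * mean_sq_dev n b u \<partial>\<mu>)" for n
  proof -
    have "(\<integral>\<^sup>+d. ennreal ((mart n (h n b) d)\<^sup>2 / n) \<partial>D n) = (\<integral>\<^sup>+d. ennreal (1 / n) * ennreal ((mart n (h n b) d)\<^sup>2) \<partial>D n)"
      by (intro nn_integral_cong) (simp add: ennreal_mult[symmetric])
    also have "\<dots> = ennreal (1 / n) * (\<integral>\<^sup>+d. ennreal ((mart n (h n b) d)\<^sup>2) \<partial>D n)"
      by (rule nn_integral_cmult) measurable
    also have "\<dots> \<le> ennreal (1 / n) * (\<integral>\<^sup>+d. \<integral>\<^sup>+u. ennreal ((h n b u d)\<^sup>2 * risk n d u / S u) \<partial>\<mu> \<partial>D n)"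
      by (intro mult_left_mono mart_second_moment predictable_h) auto
    also have "\<dots> = (\<integral>\<^sup>+d. \<integral>\<^sup>+u. ?e n d u \<partial>\<mu> \<partial>D n)"
      by (subst nn_integral_cmult[symmetric], measurable, intro nn_integral_cong nn_integral_cmult[symmetric]) measurable
    also have "\<dots> = (\<integral>\<^sup>+u. \<integral>\<^sup>+d. ?e n d u \<partial>D n \<partial>\<mu>)"
      by (rule D\<mu>.Fubini'[symmetric]) measurable
    also have "\<dots> = (\<integral>\<^sup>+u. ?w u * mean_sq_dev n b u \<partial>\<mu>)"
    proof (rule nn_integral_cong)
      fix u
      have "?e n d u = ?w u
        * ennreal (if waiting n d b then 0 else (n * W n d u / risk n d u - 1 / C u)\<^sup>2 * (risk n d u / n))" for d
        using S_nonneg[of u] risk_nonneg[of n d u]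
        by (subst (1 2) ennreal_mult[symmetric]) (auto simp: h_def power_mult_distrib mult_ac)
      then show "(\<integral>\<^sup>+d. ?e n d u \<partial>D n) = ?w u * mean_sq_dev n b u"
        unfolding mean_sq_dev_def by (subst nn_integral_cmult[symmetric]) auto
    qed
    finally show ?thesis .
  qed
  have lim: "(\<lambda>n. \<integral>\<^sup>+u. ?w u * mean_sq_dev n b u \<partial>\<mu>) \<longlonglongrightarrow> (\<integral>\<^sup>+u. 0 \<partial>\<mu>)"
  proof (rule nn_integral_dominated_convergence[where w = "\<lambda>u. ennreal K * ennreal ((\<psi> u)\<^sup>2 / (C u * S u))"])
    show "AE u in \<mu>. ?w u * mean_sq_dev n b u \<le> ennreal K * ennreal ((\<psi> u)\<^sup>2 / (C u * S u))" for n
      using AE_S_pos AE_G_pos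
    proof eventually_elim
      fix u assume u: "S u > 0" "G u > 0"
      have "?w u * mean_sq_dev n b u \<le> ?w u * ennreal (K / C u)"
        by (intro mult_left_mono K u) simp
      also have "\<dots> = ennreal K * ennreal ((\<psi> u)\<^sup>2 / (C u * S u))"
        using u K C_nonneg by (subst (1 2) ennreal_mult[symmetric]) (auto simp: mult_ac)
      finally show "?w u * mean_sq_dev n b u \<le> ennreal K * ennreal ((\<psi> u)\<^sup>2 / (C u * S u))" .
    qed
    show "(\<integral>\<^sup>+u. ennreal K * ennreal ((\<psi> u)\<^sup>2 / (C u * S u)) \<partial>\<mu>) < \<infinity>"
      using finite_information by (subst nn_integral_cmult) (auto simp: ennreal_mult_less_top)
    show "AE u in \<mu>. (\<lambda>n. ?w u * mean_sq_dev n b u) \<longlonglongrightarrow> 0"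
      using AE_S_pos AE_G_pos
    proof eventually_elim
      fix u assume u: "S u > 0" "G u > 0"
      have "(\<lambda>n. ?w u * mean_sq_dev n b u) \<longlonglongrightarrow> ?w u * 0"
        by (intro ennreal_tendsto_cmult mean_sq_dev_lim u) simp
      then show "(\<lambda>n. ?w u * mean_sq_dev n b u) \<longlonglongrightarrow> 0" by simp
    qed
  qed measurable
  show ?thesis
    by (rule tendsto_sandwich[OF _ _ tendsto_const, where h = "\<lambda>n. \<integral>\<^sup>+u. ?w u * mean_sq_dev n b u \<partial>\<mu>"])
       (use bound lim in simp_all)
qed

text \<open>A bound for the second remainder, which comes from the times before the first entry.\<close>

definition early :: "nat \<Rightarrow> real \<Rightarrow> sample \<Rightarrow> ennreal" where
  "early n b d = (\<integral>\<^sup>+u. (if u < b \<and> waiting n d u then ennreal (\<bar>\<psi> u\<bar> / (S u)\<^sup>2) else 0) \<partial>\<mu>)"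

lemma measurable_early[measurable]: "early n b \<in> borel_measurable (D n)"
  unfolding early_def[abs_def] by measurable

text \<open>The probability that nobody has entered by time \<open>u\<close> is at most \<open>(1 - C u)\<^sup>n\<close>. The factor \<open>\<surd>n\<close> is absorbed at the price of
\<open>1/\<surd>C\<close>, and \<open>|\<psi>| / \<surd>C \<le> 1 + \<psi>\<^sup>2 / C\<close> is integrable on \<open>(-\<infinity>, b)\<close>.\<close>

lemma second_remainder:
  assumes b: "S b > 0"
  shows "(\<lambda>n. \<integral>\<^sup>+d. ennreal (sqrt n) * early n b d \<partial>D n) \<longlonglongrightarrow> 0"
proof -
  let ?a = "\<lambda>u. (if u < b then ennreal (\<bar>\<psi> u\<bar> / (S u)\<^sup>2) else 0)"
  let ?g = "\<lambda>n u. ennreal (sqrt n * (1 - Gs u) ^ n)"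
  let ?e = "\<lambda>n d u. ennreal (sqrt n) * (if u < b \<and> waiting n d u then ennreal (\<bar>\<psi> u\<bar> / (S u)\<^sup>2) else 0)"
  let ?w = "\<lambda>u. ennreal (1 / (S b)\<^sup>2) * (1 + ennreal ((\<psi> u)\<^sup>2 / (C u * S u)))"
  have eq: "(\<integral>\<^sup>+d. ennreal (sqrt n) * early n b d \<partial>D n)
     = (\<integral>\<^sup>+u. (?a u) * ?g n u \<partial>\<mu>)" for n
  proof -
    have "(\<integral>\<^sup>+d. ennreal (sqrt n) * early n b d \<partial>D n)
       = (\<integral>\<^sup>+d. \<integral>\<^sup>+u. ?e n d u \<partial>\<mu> \<partial>D n)"
      unfolding early_def by (intro nn_integral_cong nn_integral_cmult[symmetric]) measurable
    also have "\<dots> = (\<integral>\<^sup>+u. \<integral>\<^sup>+d. ?e n d u \<partial>D n \<partial>\<mu>)"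
      by (rule D\<mu>.Fubini'[symmetric]) measurable
    also have "\<dots> = (\<integral>\<^sup>+u. (?a u) * ?g n u \<partial>\<mu>)"
    proof (rule nn_integral_cong)
      fix u
      have "(\<integral>\<^sup>+d. ?e n d u \<partial>D n)
        = (\<integral>\<^sup>+d. (?a u) * ennreal (sqrt n) * (if waiting n d u then 1 else 0) \<partial>D n)"
        by (intro nn_integral_cong) (auto simp: mult_ac)
      also have "\<dots> = (?a u) * ennreal (sqrt n) * ennreal ((1 - Gs u) ^ n)"
        by (subst nn_integral_cmult) (auto simp: prob_waiting)
      also have "?g n u = ennreal (sqrt n) * ennreal ((1 - Gs u) ^ n)"
        using Gs_le_1[of u] by (intro ennreal_mult) auto
      then have "(?a u) * ennreal (sqrt n) * ennreal ((1 - Gs u) ^ n)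
         = (?a u) * ?g n u"
        by (simp only: mult.assoc)
      finally show "(\<integral>\<^sup>+d. ?e n d u \<partial>D n)
        = (?a u) * ?g n u" .
    qed
    finally show ?thesis .
  qed
  have "(\<lambda>n. \<integral>\<^sup>+u. (?a u) * ?g n u \<partial>\<mu>) \<longlonglongrightarrow> (\<integral>\<^sup>+u. 0 \<partial>\<mu>)"
  proof (rule nn_integral_dominated_convergence[where w = "\<lambda>u. ?w u"])
    show "AE u in \<mu>. (?a u) * ?g n u
      \<le> ?w u" for n
      using AE_S_pos AE_C_pos
    proof eventually_elim
      fix u assume u: "S u > 0" "C u > 0"
      show "(?a u) * ?g n u
      \<le> ?w u"
      proof (cases "u < b")
        case True
        have "sqrt n * (1 - Gs u) ^ n \<le> sqrt n * (1 - C u) ^ n"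
          using Gs_ge_C[of u] Gs_le_1[of u] by (intro mult_left_mono power_mono) auto
        also have "\<dots> \<le> 1 / sqrt (C u)" by (rule sqrt_geometric_bound[OF u(2) C_le_1])
        finally have "\<bar>\<psi> u\<bar> * (sqrt n * (1 - Gs u) ^ n) \<le> \<bar>\<psi> u\<bar> * (1 / sqrt (C u))"
          by (intro mult_left_mono) auto
        also have "\<dots> \<le> 1 + (\<psi> u)\<^sup>2 / C u"
        proof -
          have "0 \<le> (\<bar>\<psi> u\<bar> / sqrt (C u) - 1)\<^sup>2" by simp
          then have "2 * (\<bar>\<psi> u\<bar> / sqrt (C u)) \<le> 1 + (\<bar>\<psi> u\<bar> / sqrt (C u))\<^sup>2"
            unfolding power2_diff by simp
          moreover have "(\<bar>\<psi> u\<bar> / sqrt (C u))\<^sup>2 = (\<psi> u)\<^sup>2 / C u" using u by (simp add: power_divide)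
          moreover have "0 \<le> \<bar>\<psi> u\<bar> / sqrt (C u)" using u by simp
          ultimately show ?thesis by simp
        qed
        also have "(\<psi> u)\<^sup>2 / C u \<le> (\<psi> u)\<^sup>2 / (C u * S u)"
          using u S_le_1[of u] by (intro divide_left_mono) (auto simp: mult_left_le)
        finally have 1: "\<bar>\<psi> u\<bar> * (sqrt n * (1 - Gs u) ^ n) \<le> 1 + (\<psi> u)\<^sup>2 / (C u * S u)" by simp
        have "1 / (S u)\<^sup>2 \<le> 1 / (S b)\<^sup>2"
          using True S_antimono[of u b] b by (intro frac_le power_mono) auto
        then have "1 / (S u)\<^sup>2 * (\<bar>\<psi> u\<bar> * (sqrt n * (1 - Gs u) ^ n)) \<le> 1 / (S b)\<^sup>2 * (1 + (\<psi> u)\<^sup>2 / (C u * S u))"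
          using 1 Gs_le_1[of u] b by (intro mult_mono) auto
        then have "ennreal (\<bar>\<psi> u\<bar> / (S u)\<^sup>2 * (sqrt n * (1 - Gs u) ^ n)) \<le> ennreal (1 / (S b)\<^sup>2 * (1 + (\<psi> u)\<^sup>2 / (C u * S u)))"
          by (intro ennreal_leI) (simp add: mult_ac)
        also have "ennreal (\<bar>\<psi> u\<bar> / (S u)\<^sup>2 * (sqrt n * (1 - Gs u) ^ n)) = ennreal (\<bar>\<psi> u\<bar> / (S u)\<^sup>2) * ?g n u"
          using Gs_le_1[of u] by (intro ennreal_mult) auto
        also have "ennreal (1 / (S b)\<^sup>2 * (1 + (\<psi> u)\<^sup>2 / (C u * S u))) = ?w u"
        proof -
          have "ennreal (1 / (S b)\<^sup>2 * (1 + (\<psi> u)\<^sup>2 / (C u * S u))) = ennreal (1 / (S b)\<^sup>2) * ennreal (1 + (\<psi> u)\<^sup>2 / (C u * S u))"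
            using u by (intro ennreal_mult) auto
          moreover have "ennreal (1 + (\<psi> u)\<^sup>2 / (C u * S u)) = 1 + ennreal ((\<psi> u)\<^sup>2 / (C u * S u))"
            using u by (subst ennreal_plus) auto
          ultimately show ?thesis by simp
        qed
        finally show ?thesis using True by simp
      qed simp
    qed
    show "(\<integral>\<^sup>+u. ?w u \<partial>\<mu>) < \<infinity>"
      using finite_information
      by (subst nn_integral_cmult, measurable, subst nn_integral_add, measurable)
         (simp add: ennreal_mult_less_top \<mu>.emeasure_space_1[simplified])
    show "AE u in \<mu>. (\<lambda>n. (?a u) * ?g n u) \<longlonglongrightarrow> 0"
      using AE_Gs_pos
    proof eventually_elim
      fix u assume g: "Gs u > 0"
      have "(\<lambda>n. sqrt n * (1 - Gs u) ^ n) \<longlonglongrightarrow> 0"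
      proof (rule tendsto_sandwich[OF _ _ tendsto_const])
        show "(\<lambda>n. of_nat n * (1 - Gs u) ^ n) \<longlonglongrightarrow> 0"
          using g Gs_le_1[of u] by (intro powser_times_n_limit_0) simp
        show "\<forall>\<^sub>F n in sequentially. sqrt n * (1 - Gs u) ^ n \<le> of_nat n * (1 - Gs u) ^ n"
          using eventually_ge_at_top[of 1]
        proof eventually_elim
          fix n :: nat assume "1 \<le> n"
          then have "sqrt n \<le> n" by (intro real_le_lsqrt) (auto simp: power2_eq_square)
          then show "sqrt n * (1 - Gs u) ^ n \<le> of_nat n * (1 - Gs u) ^ n"
            using Gs_le_1[of u] by (intro mult_right_mono) auto
        qed
      qed (use Gs_le_1[of u] in auto)
      from tendsto_ennrealI[OF this]
      have "(\<lambda>n. ?g n u) \<longlonglongrightarrow> 0" by simp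
      then have "(\<lambda>n. (?a u) * ?g n u)
         \<longlonglongrightarrow> (?a u) * 0"
        by (intro ennreal_tendsto_cmult) auto
      then show "(\<lambda>n. (?a u) * ?g n u) \<longlonglongrightarrow> 0"
        by simp
    qed
  qed measurable
  then show ?thesis by (simp add: eq)
qed

subsection \<open>The linear part\<close>

text \<open>The influence function in terms of an observed pair (lifetime, entry time).\<close>

definition infl :: "real \<times> real \<Rightarrow> real" where
  "infl p = \<psi> (fst p) / C (fst p) - (\<integral>u. (if snd p \<le> u \<and> u \<le> fst p then \<psi> u / (C u * S u) else 0) \<partial>\<mu>)"

lemma measurable_infl[measurable]: "infl \<in> borel_measurable (borel \<Otimes>\<^sub>M borel)"
  unfolding infl_def[abs_def] by measurable

text \<open>The expected risk set is \<open>n C\<close>, which cancels the denominator; what remains is \<open>\<integral> |\<psi>| / S dF\<close>, and this is controlled by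
\<open>\<integral> \<psi>\<^sup>2 / (C S) dF\<close>.\<close>

lemma linear_finite: "(\<integral>\<^sup>+d. \<integral>\<^sup>+u. ennreal (\<bar>\<psi> u / C u\<bar> * risk n d u / S u) \<partial>\<mu> \<partial>D n) < \<infinity>"
proof -
  let ?e = "\<lambda>d u. ennreal (\<bar>\<psi> u / C u\<bar> * risk n d u / S u)"
  let ?q = "\<lambda>u. (\<psi> u)\<^sup>2 / (C u * S u)"
  have "(\<integral>\<^sup>+d. \<integral>\<^sup>+u. ?e d u \<partial>\<mu> \<partial>D n)
      = (\<integral>\<^sup>+u. \<integral>\<^sup>+d. ?e d u \<partial>D n \<partial>\<mu>)"
    by (rule D\<mu>.Fubini'[symmetric]) measurable
  also have "\<dots> \<le> (\<integral>\<^sup>+u. ennreal (real n) * (1 + ennreal (1 / \<alpha>) * ennreal ((?q u))) \<partial>\<mu>)"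
  proof (rule nn_integral_mono_AE, use AE_S_pos AE_C_pos in eventually_elim)
    fix u assume u: "S u > 0" "C u > 0"
    have "(\<integral>\<^sup>+d. ?e d u \<partial>D n) = (\<integral>\<^sup>+d. ennreal (\<bar>\<psi> u\<bar> / (C u * S u)) * ennreal (risk n d u) \<partial>D n)"
      using u by (intro nn_integral_cong) (subst ennreal_mult[symmetric], auto simp: risk_nonneg)
    also have "\<dots> = ennreal (\<bar>\<psi> u\<bar> / (C u * S u)) * ennreal (n * C u)"
      by (subst nn_integral_cmult) (auto simp: risk_first_moment)
    also have "\<dots> = ennreal (n * (\<bar>\<psi> u\<bar> / S u))"
      using u by (subst ennreal_mult[symmetric]) auto
    also have "\<dots> \<le> ennreal (n * (1 + 1 / \<alpha> * ((?q u))))"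
    proof (intro ennreal_leI mult_left_mono)
      have "0 \<le> (\<bar>\<psi> u\<bar> / S u - 1)\<^sup>2" by simp
      then have "2 * (\<bar>\<psi> u\<bar> / S u) \<le> 1 + (\<bar>\<psi> u\<bar> / S u)\<^sup>2" unfolding power2_diff by simp
      moreover have "0 \<le> \<bar>\<psi> u\<bar> / S u" using u by simp
      moreover have "(\<bar>\<psi> u\<bar> / S u)\<^sup>2 \<le> 1 / \<alpha> * ((?q u))"
      proof -
        have "\<alpha> * (C u * S u) = G u * S u * S u" using \<alpha>_pos by (simp add: C_def)
        also have "\<dots> \<le> 1 * S u * S u" using G_le_1 u by (intro mult_right_mono) auto
        finally have "(\<psi> u)\<^sup>2 / (S u * S u) \<le> (\<psi> u)\<^sup>2 / (\<alpha> * (C u * S u))"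
          using u \<alpha>_pos by (intro divide_left_mono) auto
        then show ?thesis by (simp add: power_divide power2_eq_square)
      qed
      ultimately show "\<bar>\<psi> u\<bar> / S u \<le> 1 + 1 / \<alpha> * ((?q u))" by simp
    qed simp
    also have "\<dots> = ennreal (real n) * (1 + ennreal (1 / \<alpha>) * ennreal ((?q u)))"
    proof -
      have "ennreal (n * (1 + 1 / \<alpha> * ((?q u)))) = ennreal n * ennreal (1 + 1 / \<alpha> * ((?q u)))"
        using u \<alpha>_pos by (intro ennreal_mult add_nonneg_nonneg mult_nonneg_nonneg divide_nonneg_nonneg) auto
      also have "ennreal (1 + 1 / \<alpha> * ((?q u))) = 1 + ennreal (1 / \<alpha> * ((?q u)))"
        using u \<alpha>_pos by (subst ennreal_plus) auto
      also have "ennreal (1 / \<alpha> * ((?q u))) = ennreal (1 / \<alpha>) * ennreal ((?q u))"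
        using u \<alpha>_pos by (intro ennreal_mult) auto
      finally show ?thesis .
    qed
    finally show "(\<integral>\<^sup>+d. ?e d u \<partial>D n)
       \<le> ennreal (real n) * (1 + ennreal (1 / \<alpha>) * ennreal ((?q u)))" .
  qed
  also have "\<dots> < \<infinity>"
    using finite_information
    by (subst nn_integral_cmult, measurable, subst nn_integral_add, measurable, subst nn_integral_cmult, measurable)
       (simp add: ennreal_mult_less_top \<mu>.emeasure_space_1[simplified])
  finally show ?thesis .
qed

text \<open>The deterministic integrand whose stochastic integral is the sum of the influences.\<close>

abbreviation "kL \<equiv> (\<lambda>u (d :: sample). \<psi> u / C u)"

lemma predictable_kL: "predictable n kL" by (simp add: predictable_def)

lemma measurable_kL[measurable]: "(\<lambda>(u, d). kL u d) \<in> borel_measurable (borel \<Otimes>\<^sub>M D n)" by measurable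

lemma AE_linear: "AE d in D n. integrable \<mu> (\<lambda>u. \<psi> u / C u * risk n d u / S u)"
  by (rule AE_integrable_mart[OF measurable_kL predictable_kL linear_finite])

lemma mart_linear:
  assumes d[measurable]: "d \<in> space (D n)" and int: "integrable \<mu> (\<lambda>u. \<psi> u / C u * risk n d u / S u)"
  shows "mart n kL d = (\<Sum>i<n. infl (d i))"
    and "i < n \<Longrightarrow> integrable \<mu> (\<lambda>u. if obsY d i \<le> u \<and> u \<le> obsX d i then \<psi> u / (C u * S u) else 0)"
proof -
  let ?f = "\<lambda>i u. (if obsY d i \<le> u \<and> u \<le> obsX d i then \<psi> u / (C u * S u) else 0)"
  show each: "integrable \<mu> (\<lambda>u. if obsY d i \<le> u \<and> u \<le> obsX d i then \<psi> u / (C u * S u) else 0)" if i: "i < n" for i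
  proof (rule Bochner_Integration.integrable_bound[OF int])
    show "AE u in \<mu>. norm (?f i u) \<le> norm (\<psi> u / C u * risk n d u / S u)"
    proof (rule AE_I2)
      fix u
      show "norm (?f i u) \<le> norm (\<psi> u / C u * risk n d u / S u)"
      proof (cases "obsY d i \<le> u \<and> u \<le> obsX d i")
        case True
        then have "1 \<le> risk n d u" using i by (intro risk_ge_1) (auto simp: risk_pos_iff)
        then have "\<bar>\<psi> u\<bar> / (C u * S u) * 1 \<le> \<bar>\<psi> u\<bar> / (C u * S u) * risk n d u"
          by (intro mult_left_mono) (auto simp: C_nonneg S_nonneg)
        then show ?thesis using True by (simp add: abs_mult C_nonneg S_nonneg risk_nonneg)
      next
        case False
        then show ?thesis by (subst if_not_P) auto
      qed
    qed
  qed measurable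
  have "(\<integral>u. \<psi> u / C u * risk n d u / S u \<partial>\<mu>) = (\<integral>u. (\<Sum>i<n. if obsY d i \<le> u \<and> u \<le> obsX d i then \<psi> u / (C u * S u) else 0) \<partial>\<mu>)"
  proof (intro Bochner_Integration.integral_cong refl)
    fix u
    have "\<psi> u / C u * risk n d u / S u = (\<Sum>i<n. \<psi> u / (C u * S u) * (if obsY d i \<le> u \<and> u \<le> obsX d i then 1 else 0))"
      unfolding sum_distrib_left[symmetric] risk_def[symmetric] by simp
    also have "\<dots> = (\<Sum>i<n. if obsY d i \<le> u \<and> u \<le> obsX d i then \<psi> u / (C u * S u) else 0)"
      by (intro sum.cong) auto
    finally show "\<psi> u / C u * risk n d u / S u = (\<Sum>i<n. if obsY d i \<le> u \<and> u \<le> obsX d i then \<psi> u / (C u * S u) else 0)" .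
  qed
  also have "\<dots> = (\<Sum>i<n. \<integral>u. (?f i u) \<partial>\<mu>)"
    by (rule Bochner_Integration.integral_sum) (use each in auto)
  finally show "mart n kL d = (\<Sum>i<n. infl (d i))"
    unfolding mart_def infl_def sum_subtractf obsX_def obsY_def by simp
qed

text \<open>The exact form of the linearisation. By Duhamel's equation the error is an integral of \<open>\<psi> W\<close>; where somebody is at
risk it is the stochastic integral of \<open>\<psi> W / R\<close>, and where nobody is at risk only the times before the first entry contribute.\<close>

lemma expansion:
  assumes g: "good n d" and n: "n > 0" and d[measurable]: "d \<in> space (D n)" and w: "\<not> waiting n d b"
    and int: "integrable \<mu> (\<lambda>u. \<psi> u / C u * risk n d u / S u)"
  shows "n * (pl_integral \<phi> n d - (\<integral>x. \<phi> x \<partial>\<mu>)) - (\<Sum>i<n. infl (d i))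
     = mart n (h n b) d - n * (\<integral>u. (if u < b \<and> waiting n d u then \<psi> u / (S u)\<^sup>2 else 0) \<partial>\<mu>)"
proof -
  note du = duhamel[OF g n integrable_\<phi> d]
  have wb: "waiting n d u \<Longrightarrow> u < b" for u using w unfolding waiting_def by force
  let ?e = "\<lambda>u. if u < b \<and> waiting n d u then \<psi> u / (S u)\<^sup>2 else 0"
  let ?f = "\<lambda>u. \<psi> u * W n d u / risk n d u * risk n d u / S u"
  have split: "\<psi> u * W n d u / S u = ?f u + ?e u" for u
    using B_cases[OF g, of u] B_waiting[OF g, of u] wb[of u]
    by (cases "risk n d u = 0") (auto simp: W_def power2_eq_square)
  have f_int: "integrable \<mu> ?f"
  proof (rule Bochner_Integration.integrable_bound[OF du(1)])
    show "AE u in \<mu>. norm (?f u) \<le> norm (\<psi> u * W n d u / S u)" by (rule AE_I2) simp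
  qed measurable
  have e_int: "integrable \<mu> ?e"
    using Bochner_Integration.integrable_diff[OF du(1) f_int] unfolding split by simp
  have "(\<integral>u. \<psi> u * W n d u / S u \<partial>\<mu>) = (\<integral>u. ?f u \<partial>\<mu>) + (\<integral>u. ?e u \<partial>\<mu>)"
    unfolding split by (rule Bochner_Integration.integral_add[OF f_int e_int])
  then have main: "pl_integral \<phi> n d - (\<integral>x. \<phi> x \<partial>\<mu>) = (\<Sum>i<n. \<psi> (obsX d i) * W n d (obsX d i) / risk n d (obsX d i)) - (\<integral>u. ?f u \<partial>\<mu>) - (\<integral>u. ?e u \<partial>\<mu>)"
    using du(2) by simp
  have "(\<integral>u. h n b u d * risk n d u / S u \<partial>\<mu>) = (\<integral>u. n * ?f u - \<psi> u / C u * risk n d u / S u \<partial>\<mu>)"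
    using w by (intro Bochner_Integration.integral_cong refl) (simp add: h_def right_diff_distrib left_diff_distrib diff_divide_distrib mult_ac)
  also have "\<dots> = n * (\<integral>u. ?f u \<partial>\<mu>) - (\<integral>u. \<psi> u / C u * risk n d u / S u \<partial>\<mu>)"
    by (simp only: Bochner_Integration.integral_diff[OF integrable_mult_right[OF f_int] int] integral_mult_right_zero)
  finally have cont: "(\<integral>u. h n b u d * risk n d u / S u \<partial>\<mu>) = n * (\<integral>u. ?f u \<partial>\<mu>) - (\<integral>u. \<psi> u / C u * risk n d u / S u \<partial>\<mu>)" .
  have jump: "(\<Sum>i<n. h n b (obsX d i) d) = n * (\<Sum>i<n. \<psi> (obsX d i) * W n d (obsX d i) / risk n d (obsX d i)) - (\<Sum>i<n. \<psi> (obsX d i) / C (obsX d i))"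
    unfolding sum_distrib_left sum_subtractf[symmetric] using w
    by (intro sum.cong refl) (simp add: h_def right_diff_distrib mult_ac)
  have "mart n (h n b) d = n * (\<Sum>i<n. \<psi> (obsX d i) * W n d (obsX d i) / risk n d (obsX d i)) - n * (\<integral>u. ?f u \<partial>\<mu>) - mart n kL d"
    unfolding mart_def cont jump by simp
  moreover have "n * (pl_integral \<phi> n d - (\<integral>x. \<phi> x \<partial>\<mu>)) = n * (\<Sum>i<n. \<psi> (obsX d i) * W n d (obsX d i) / risk n d (obsX d i))
      - n * (\<integral>u. ?f u \<partial>\<mu>) - n * (\<integral>u. ?e u \<partial>\<mu>)"
    unfolding main by (simp only: right_diff_distrib)
  ultimately show ?thesis using mart_linear(1)[OF d int] by linarith
qed

definition remainder :: "nat \<Rightarrow> sample \<Rightarrow> real" where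
  "remainder n d = sqrt n * (pl_integral \<phi> n d - (\<integral>x. \<phi> x \<partial>\<mu>)) - (\<Sum>i<n. infl (d i)) / sqrt n"

lemma measurable_remainder[measurable]: "remainder n \<in> borel_measurable (D n)"
proof -
  have [measurable]: "(\<lambda>d. infl (d i)) \<in> borel_measurable (D n)" if "i \<in> {..<n}" for i
  proof -
    have "(\<lambda>d. infl (obsX d i, obsY d i)) \<in> borel_measurable (D n)"
      using that by (intro measurable_compose[OF _ measurable_infl] measurable_Pair) measurable
    then show ?thesis by (simp add: obsX_def obsY_def)
  qed
  show ?thesis unfolding remainder_def[abs_def] pl_integral_def by measurable
qed

text \<open>With \<open>b\<close> a reference point, somebody enters by time \<open>b\<close> with probability tending to one. On that event the remainder is the
difference of the two parts treated above; one is handled by Chebyshev's inequality, the other by Markov's.\<close>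

lemma remainder_negligible:
  assumes \<epsilon>: "\<epsilon> > 0"
  shows "(\<lambda>n. \<integral>\<^sup>+d. (if \<bar>remainder n d\<bar> > \<epsilon> then 1 else 0) \<partial>D n) \<longlonglongrightarrow> 0"
proof -
  let ?I = "\<lambda>n d b. (\<integral>u. (if u < b \<and> waiting n d u then \<psi> u / (S u)\<^sup>2 else 0) \<partial>\<mu>)"
  let ?P = "\<lambda>n. (\<integral>\<^sup>+d. (if \<bar>remainder n d\<bar> > \<epsilon> then 1 else 0) \<partial>D n)"
  obtain b where b: "S b > 0" "G b > 0" by (rule reference_point)
  have "C b > 0" using b \<alpha>_pos by (simp add: C_def)
  then have Gb: "Gs b > 0" using Gs_ge_C[of b] by linarith
  let ?m = "\<lambda>n. \<integral>\<^sup>+d. ennreal ((mart n (h n b) d)\<^sup>2 / n) \<partial>D n"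
  let ?e = "\<lambda>n. \<integral>\<^sup>+d. ennreal (sqrt n) * early n b d \<partial>D n"
  have bound: "(?P n)
     \<le> ennreal ((1 - Gs b) ^ n) + ennreal (4 / \<epsilon>\<^sup>2) * ?m n + ennreal (2 / \<epsilon>) * ?e n" if n: "n > 0" for n
  proof -
    have "(?P n)
       \<le> (\<integral>\<^sup>+d. (if waiting n d b then 1 else 0) + ennreal (4 / \<epsilon>\<^sup>2) * ennreal ((mart n (h n b) d)\<^sup>2 / n)
          + ennreal (2 / \<epsilon>) * (ennreal (sqrt n) * early n b d) \<partial>D n)"
    proof (rule nn_integral_mono_AE, rule AE_mp[OF AE_good], rule AE_mp[OF AE_linear AE_I2], intro impI)
      fix d assume d[measurable]: "d \<in> space (D n)" and int: "integrable \<mu> (\<lambda>u. \<psi> u / C u * risk n d u / S u)" and g: "good n d"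
      define A where "A = ennreal (4 / \<epsilon>\<^sup>2) * ennreal ((mart n (h n b) d)\<^sup>2 / n)"
      define E where "E = ennreal (2 / \<epsilon>) * (ennreal (sqrt n) * early n b d)"
      have "(if \<bar>remainder n d\<bar> > \<epsilon> then 1 else 0) \<le> (if waiting n d b then 1 else 0) + A + E"
      proof (cases "\<bar>remainder n d\<bar> > \<epsilon> \<and> \<not> waiting n d b")
        case True
        define m where "m = mart n (h n b) d / sqrt n"
        define e where "e = sqrt n * (?I n d b)"
        define L where "L = pl_integral \<phi> n d - (\<integral>x. \<phi> x \<partial>\<mu>)"
        have rs: "real n / sqrt n = sqrt n" by (rule real_div_sqrt) simp
        have scale: "real n * x / sqrt n = sqrt n * x" for x
        proof -
          have "real n * x / sqrt n = real n / sqrt n * x" by simp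
          then show ?thesis by (simp only: rs)
        qed
        have "remainder n d = (n * L - (\<Sum>i<n. infl (d i))) / sqrt n"
          unfolding remainder_def diff_divide_distrib scale L_def ..
        also have "\<dots> = m - e"
          unfolding expansion[OF g n d conjunct2[OF True] int, folded L_def] m_def e_def diff_divide_distrib scale ..
        finally have "\<bar>m\<bar> + \<bar>e\<bar> > \<epsilon>" using True by linarith
        then consider "\<bar>m\<bar> \<ge> \<epsilon> / 2" | "\<bar>e\<bar> \<ge> \<epsilon> / 2" by linarith
        then show ?thesis
        proof cases
          case 1
          then have "(\<epsilon> / 2)\<^sup>2 \<le> m\<^sup>2" using \<epsilon> by (intro abs_le_square_iff[THEN iffD1]) simp
          then have "1 \<le> 4 / \<epsilon>\<^sup>2 * m\<^sup>2" using \<epsilon> by (simp add: field_simps)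
          moreover have "m\<^sup>2 = (mart n (h n b) d)\<^sup>2 / n" by (simp add: m_def power_divide)
          ultimately have "1 \<le> ennreal (4 / \<epsilon>\<^sup>2 * ((mart n (h n b) d)\<^sup>2 / n))"
            by (intro one_le_ennrealI) simp
          also have "\<dots> = ennreal (4 / \<epsilon>\<^sup>2) * ennreal ((mart n (h n b) d)\<^sup>2 / n)" by (rule ennreal_mult) auto
          finally have "1 \<le> A" by (simp only: A_def)
          then have "1 \<le> A + E" by (rule add_increasing2[OF zero_le])
          then show ?thesis using True by simp
        next
          case 2
          then have "1 \<le> 2 / \<epsilon> * \<bar>e\<bar>" using \<epsilon> by (simp add: field_simps)
          then have "1 \<le> ennreal (2 / \<epsilon> * \<bar>e\<bar>)" by (rule one_le_ennrealI)
          also have "\<dots> = ennreal (2 / \<epsilon>) * ennreal \<bar>e\<bar>" using \<epsilon> by (intro ennreal_mult) auto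
          also have "\<dots> \<le> ennreal (2 / \<epsilon>) * (ennreal (sqrt n) * early n b d)"
          proof (rule mult_left_mono)
            have "ennreal \<bar>e\<bar> = ennreal (sqrt n) * ennreal (norm (?I n d b))"
              unfolding e_def by (subst ennreal_mult[symmetric]) (auto simp: abs_mult)
            also have "\<dots> \<le> ennreal (sqrt n) * early n b d"
            proof (rule mult_left_mono)
              show "ennreal (norm (?I n d b)) \<le> early n b d"
              proof (cases "integrable \<mu> (\<lambda>u. if u < b \<and> waiting n d u then \<psi> u / (S u)\<^sup>2 else 0)")
                case True
                have "ennreal (norm (?I n d b))
                  \<le> (\<integral>\<^sup>+u. ennreal (norm (if u < b \<and> waiting n d u then \<psi> u / (S u)\<^sup>2 else 0)) \<partial>\<mu>)"
                  by (rule integral_norm_bound_ennreal[OF True])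
                also have "\<dots> = early n b d" unfolding early_def by (intro nn_integral_cong) auto
                finally show ?thesis .
              next
                case False
                then show ?thesis by (simp add: not_integrable_integral_eq)
              qed
            qed simp
            finally show "ennreal \<bar>e\<bar> \<le> ennreal (sqrt n) * early n b d" .
          qed simp
          finally have "1 \<le> E" by (simp only: E_def)
          then have "1 \<le> A + E" by (rule add_increasing[OF zero_le])
          then show ?thesis using True by simp
        qed
      next
        case False
        have "1 \<le> 1 + A + E" by (intro add_increasing2 zero_le order_refl)
        then show ?thesis using False by auto
      qed
      then show "(if \<bar>remainder n d\<bar> > \<epsilon> then 1 else 0) \<le> (if waiting n d b then 1 else 0) + ennreal (4 / \<epsilon>\<^sup>2) * ennreal ((mart n (h n b) d)\<^sup>2 / n)
          + ennreal (2 / \<epsilon>) * (ennreal (sqrt n) * early n b d)"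
        by (simp only: A_def E_def)
    qed
    also have "\<dots> = ennreal ((1 - Gs b) ^ n) + ennreal (4 / \<epsilon>\<^sup>2) * ?m n + ennreal (2 / \<epsilon>) * ?e n"
      by (subst nn_integral_add, measurable, subst nn_integral_add, measurable, subst nn_integral_cmult, measurable,
          subst nn_integral_cmult, measurable) (simp only: prob_waiting)
    finally show ?thesis .
  qed
  have lim: "(\<lambda>n. ennreal ((1 - Gs b) ^ n) + ennreal (4 / \<epsilon>\<^sup>2) * ?m n + ennreal (2 / \<epsilon>) * ?e n) \<longlonglongrightarrow> 0 + ennreal (4 / \<epsilon>\<^sup>2) * 0 + ennreal (2 / \<epsilon>) * 0"
  proof (intro tendsto_add ennreal_tendsto_cmult first_remainder second_remainder b)
    have "(\<lambda>n. (1 - Gs b) ^ n) \<longlonglongrightarrow> 0" using Gb Gs_le_1[of b] by (intro LIMSEQ_realpow_zero) auto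
    from tendsto_ennrealI[OF this] show "(\<lambda>n. ennreal ((1 - Gs b) ^ n)) \<longlonglongrightarrow> 0" by simp
  qed auto
  show ?thesis
  proof (rule tendsto_sandwich[OF _ _ tendsto_const])
    show "\<forall>\<^sub>F n in sequentially. (?P n)
      \<le> ennreal ((1 - Gs b) ^ n) + ennreal (4 / \<epsilon>\<^sup>2) * ?m n + ennreal (2 / \<epsilon>) * ?e n"
      using eventually_gt_at_top[of 0] by eventually_elim (rule bound)
  qed (use lim in simp_all)
qed

end

section \<open>The estimator as a finite sum\<close>

lemma eventually_at_left_finite:
  fixes a :: real
  assumes "finite A"
  shows "eventually (\<lambda>x. \<forall>b\<in>A. b \<le> x \<longleftrightarrow> b < a) (at_left a)"
proof (rule eventually_ball_finite[OF assms], rule ballI)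
  fix b assume "b \<in> A"
  show "eventually (\<lambda>x. b \<le> x \<longleftrightarrow> b < a) (at_left a)"
  proof (cases "b < a")
    case True
    then have "eventually (\<lambda>x. b < x) (at_left a)"
      by (rule eventually_at_left_real[THEN eventually_mono]) auto
    then show ?thesis by eventually_elim (use True in auto)
  next
    case False
    then show ?thesis by (auto simp: eventually_at_filter)
  qed
qed

text \<open>A function which depends on \<open>x\<close> only through the points of a finite set below \<open>x\<close> is locally constant to the left
of every point; so the limit in the definition of \<open>jump\<close> is attained.\<close>

lemma jump_of_step:
  fixes f :: "real \<Rightarrow> real"
  assumes "finite A" and f: "\<And>x. f x = g {b\<in>A. b \<le> x}"
  shows "jump f a = g {b\<in>A. b \<le> a} - g {b\<in>A. b < a}"
proof -
  have "eventually (\<lambda>x. f x = g {b\<in>A. b < a}) (at_left a)"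
    using eventually_at_left_finite[OF assms(1), of a]
  proof eventually_elim
    fix x assume "\<forall>b\<in>A. b \<le> x \<longleftrightarrow> b < a"
    then have "{b\<in>A. b \<le> x} = {b\<in>A. b < a}" by auto
    then show "f x = g {b\<in>A. b < a}" by (simp add: f)
  qed
  then have "(f \<longlongrightarrow> g {b\<in>A. b < a}) (at_left a)" by (rule tendsto_eventually)
  then have "Lim (at_left a) f = g {b\<in>A. b < a}" by (intro tendsto_Lim) auto
  then show ?thesis by (simp add: jump_def f)
qed

text \<open>The factor \<open>F\<^sub>n\<^sup>*{a} / C\<^sub>n(a)\<close> as a quotient of counts, with ties allowed. This form is used for measurability, which
is needed on the whole probability space and not only outside a null set.\<close>

definition hazard :: "nat \<Rightarrow> (nat \<Rightarrow> real) \<Rightarrow> (nat \<Rightarrow> real) \<Rightarrow> real \<Rightarrow> real" where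
  "hazard n xs ys a = (\<Sum>i<n. if xs i = a then 1 else 0) / (\<Sum>i<n. if ys i \<le> a \<and> a \<le> xs i then 1 else 0)"

lemma card_eq_sum: "real (card {i::nat. i < n \<and> Q i}) = (\<Sum>i<n. if Q i then 1 else 0)"
proof -
  have "{i. i < n \<and> Q i} = {i\<in>{..<n}. Q i}" by auto
  moreover have "(\<Sum>i<n. if Q i then 1 else 0) = (\<Sum>i\<in>{i\<in>{..<n}. Q i}. 1 :: real)"
    by (rule sum.inter_filter[symmetric]) simp
  ultimately show ?thesis by simp
qed

lemma hazard_eq:
  shows "jump (Fn_star n xs) a / Cn n xs ys a = hazard n xs ys a"
proof (cases "n = 0")
  case True
  then show ?thesis by (simp add: Cn_def hazard_def)
next
  case False
  let ?g = "\<lambda>A. real (card {i. i < n \<and> xs i \<in> A}) / n"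
  have "jump (Fn_star n xs) a = ?g {b\<in>xs ` {..<n}. b \<le> a} - ?g {b\<in>xs ` {..<n}. b < a}"
  proof (rule jump_of_step)
    fix x
    have "{i. i < n \<and> xs i \<le> x} = {i. i < n \<and> xs i \<in> {b \<in> xs ` {..<n}. b \<le> x}}" by auto
    then show "Fn_star n xs x = ?g {b\<in>xs ` {..<n}. b \<le> x}" by (simp only: Fn_star_def)
  qed simp
  also have "\<dots> = ((\<Sum>i<n. if xs i \<in> {b\<in>xs ` {..<n}. b \<le> a} then 1 else 0) - (\<Sum>i<n. if xs i \<in> {b\<in>xs ` {..<n}. b < a} then 1 else 0)) / n"
    by (simp only: card_eq_sum diff_divide_distrib)
  also have "\<dots> = (\<Sum>i<n. if xs i = a then 1 else 0) / n"
    unfolding sum_subtractf[symmetric] by (rule arg_cong[where f = "\<lambda>s. s / real n"], rule sum.cong) auto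
  finally show ?thesis using False by (simp add: Cn_def hazard_def card_eq_sum)
qed

lemma lynden_bell_integral_eq:
  "lynden_bell_integral \<phi> n xs ys = (\<Sum>a\<in>xs ` {..<n}. \<phi> a * (hazard n xs ys a *
     (\<Prod>b\<in>xs ` {..<n}. if b < a then 1 - hazard n xs ys b else 1)))"
  unfolding lynden_bell_integral_def
proof (rule sum.cong[OF refl])
  fix a assume a: "a \<in> xs ` {..<n}"
  let ?A = "xs ` {..<n}"
  let ?g = "\<lambda>A. 1 - (\<Prod>b\<in>A. 1 - hazard n xs ys b)"
  have "jump (lynden_bell n xs ys) a = ?g {b\<in>?A. b \<le> a} - ?g {b\<in>?A. b < a}"
    by (rule jump_of_step) (simp_all add: lynden_bell_def hazard_eq)
  also have "{b\<in>?A. b \<le> a} = insert a {b\<in>?A. b < a}" using a by auto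
  also have "?g (insert a {b\<in>?A. b < a}) - ?g {b\<in>?A. b < a} = hazard n xs ys a * (\<Prod>b\<in>{b\<in>?A. b < a}. 1 - hazard n xs ys b)"
    by (subst prod.insert) (simp_all add: algebra_simps)
  also have "(\<Prod>b\<in>{b\<in>?A. b < a}. 1 - hazard n xs ys b) = (\<Prod>b\<in>?A. if b < a then 1 - hazard n xs ys b else 1)"
    by (rule prod.inter_filter) simp
  finally show "\<phi> a * jump (lynden_bell n xs ys) a = \<phi> a * (hazard n xs ys a *
     (\<Prod>b\<in>?A. if b < a then 1 - hazard n xs ys b else 1))" by simp
qed

text \<open>The estimator is a sum and a product over the random set of distinct observed values. Indexing that set by first
occurrences makes the index set deterministic, and then measurability is routine.\<close>

lemma first_occurrences:
  fixes xs :: "nat \<Rightarrow> 'b"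
  shows "inj_on xs {i\<in>{..<n}. \<forall>j<i. xs j \<noteq> xs i}" "xs ` {i\<in>{..<n}. \<forall>j<i. xs j \<noteq> xs i} = xs ` {..<n}"
proof -
  show "inj_on xs {i\<in>{..<n}. \<forall>j<i. xs j \<noteq> xs i}"
    by (rule inj_onI) (metis (mono_tags, lifting) mem_Collect_eq linorder_neqE_nat)
  show "xs ` {i\<in>{..<n}. \<forall>j<i. xs j \<noteq> xs i} = xs ` {..<n}"
  proof (intro equalityI subsetI)
    fix a assume "a \<in> xs ` {..<n}"
    then obtain i where i: "i < n" "xs i = a" by auto
    define m where "m = (LEAST j. xs j = a)"
    have "xs m = a" unfolding m_def by (rule LeastI[of _ i]) (rule i)
    moreover have "m \<le> i" unfolding m_def by (rule Least_le) (rule i)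
    moreover have "\<forall>j<m. xs j \<noteq> a" unfolding m_def using not_less_Least by blast
    ultimately show "a \<in> xs ` {i\<in>{..<n}. \<forall>j<i. xs j \<noteq> xs i}" using i by (intro image_eqI[of _ _ m]) auto
  qed auto
qed

lemma sum_image_eq:
  fixes xs :: "nat \<Rightarrow> 'b"
  shows "(\<Sum>a\<in>xs ` {..<n}. f a) = (\<Sum>i<n. if \<forall>j\<in>{..<i}. xs j \<noteq> xs i then f (xs i) else (0::real))"
proof -
  have "(\<Sum>a\<in>xs ` {..<n}. f a) = (\<Sum>i\<in>{i\<in>{..<n}. \<forall>j<i. xs j \<noteq> xs i}. f (xs i))"
    by (rule sum.reindex[OF first_occurrences(1), unfolded first_occurrences(2) comp_def])
  also have "\<dots> = (\<Sum>i<n. if \<forall>j<i. xs j \<noteq> xs i then f (xs i) else 0)"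
    by (rule sum.inter_filter) simp
  finally show ?thesis by (simp add: Ball_def)
qed

lemma prod_image_eq:
  fixes xs :: "nat \<Rightarrow> 'b"
  shows "(\<Prod>a\<in>xs ` {..<n}. f a) = (\<Prod>i<n. if \<forall>j\<in>{..<i}. xs j \<noteq> xs i then f (xs i) else (1::real))"
proof -
  have "(\<Prod>a\<in>xs ` {..<n}. f a) = (\<Prod>i\<in>{i\<in>{..<n}. \<forall>j<i. xs j \<noteq> xs i}. f (xs i))"
    by (rule prod.reindex[OF first_occurrences(1), unfolded first_occurrences(2) comp_def])
  also have "\<dots> = (\<Prod>i<n. if \<forall>j<i. xs j \<noteq> xs i then f (xs i) else 1)"
    by (rule prod.inter_filter) simp
  finally show ?thesis by (simp add: Ball_def)
qed

lemma measurable_lynden_bell_integral: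
  assumes [measurable]: "\<phi> \<in> borel_measurable borel"
    and X: "\<And>i. X i \<in> borel_measurable P" and Y: "\<And>i. Y i \<in> borel_measurable P"
  shows "(\<lambda>\<omega>. lynden_bell_integral \<phi> n (\<lambda>i. X i \<omega>) (\<lambda>i. Y i \<omega>)) \<in> borel_measurable P"
proof -
  note [measurable] = X Y
  have eq: "Measurable.pred P (\<lambda>\<omega>. X j \<omega> = X i \<omega>)" for i j
    unfolding pred_def by (rule borel_measurable_eq) measurable
  have ne[measurable]: "Measurable.pred P (\<lambda>\<omega>. X j \<omega> \<noteq> X i \<omega>)" for i j
    using eq by (rule pred_intros_logic)
  note [measurable] = eq
  have h: "(\<lambda>\<omega>. hazard n (\<lambda>i. X i \<omega>) (\<lambda>i. Y i \<omega>) (X i \<omega>)) \<in> borel_measurable P" for i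
    unfolding hazard_def by measurable
  note [measurable] = h
  show ?thesis unfolding lynden_bell_integral_eq sum_image_eq prod_image_eq by measurable
qed

lemma lynden_bell_integral_distinct:
  assumes inj: "inj_on (obsX d) {..<n}"
  shows "lynden_bell_integral \<phi> n (obsX d) (obsY d) = (\<Sum>i<n. \<phi> (obsX d i) * B n d (obsX d i) / risk n d (obsX d i))"
proof -
  have hz: "hazard n (obsX d) (obsY d) (obsX d i) = 1 / risk n d (obsX d i)" if "i < n" for i
  proof -
    have "(\<Sum>j<n. if obsX d j = obsX d i then 1 else 0 :: real) = (\<Sum>j<n. if j = i then 1 else 0)"
      using inj that by (intro sum.cong) (auto simp: inj_on_def)
    also have "\<dots> = 1" using that by simp
    finally show ?thesis by (simp only: hazard_def risk_def)
  qed
  have "lynden_bell_integral \<phi> n (obsX d) (obsY d) = (\<Sum>i<n. \<phi> (obsX d i) * (hazard n (obsX d) (obsY d) (obsX d i) *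
     (\<Prod>j<n. if obsX d j < obsX d i then 1 - hazard n (obsX d) (obsY d) (obsX d j) else 1)))"
    unfolding lynden_bell_integral_eq by (simp add: sum.reindex[OF inj] prod.reindex[OF inj])
  also have "\<dots> = (\<Sum>i<n. \<phi> (obsX d i) * B n d (obsX d i) / risk n d (obsX d i))"
  proof (intro sum.cong refl)
    fix i assume i: "i \<in> {..<n}"
    have "(\<Prod>j<n. if obsX d j < obsX d i then 1 - hazard n (obsX d) (obsY d) (obsX d j) else 1) = B n d (obsX d i)"
      unfolding B_def by (intro prod.cong) (auto simp: hz)
    then show "\<phi> (obsX d i) * (hazard n (obsX d) (obsY d) (obsX d i) *
     (\<Prod>j<n. if obsX d j < obsX d i then 1 - hazard n (obsX d) (obsY d) (obsX d j) else 1))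
     = \<phi> (obsX d i) * B n d (obsX d i) / risk n d (obsX d i)"
      using i hz[of i] by simp
  qed
  finally show ?thesis .
qed

section \<open>Limit laws\<close>

text \<open>The joint distribution function determines the law of a pair.\<close>

lemma measure_eqI_quadrants:
  fixes M N :: "(real \<times> real) measure"
  assumes "finite_measure M" and sets: "sets M = sets (borel \<Otimes>\<^sub>M borel)" "sets N = sets (borel \<Otimes>\<^sub>M borel)"
    and eq: "\<And>x y. emeasure M ({..x} \<times> {..y}) = emeasure N ({..x} \<times> {..y})"
  shows "M = N"
proof (rule measure_eqI_generator_eq)
  interpret finite_measure M by fact
  let ?E = "range (\<lambda>a::real \<times> real. {..a})"
  have box: "{..a} = {..fst a} \<times> {..snd a}" for a :: "real \<times> real" by (cases a) (auto simp: less_eq_prod_def)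
  have inter: "{..a} \<inter> {..b} = {..inf a b}" for a b :: "real \<times> real" by auto
  show "Int_stable ?E" unfolding Int_stable_def using inter by auto
  show "?E \<subseteq> Pow UNIV" by simp
  show "emeasure M A = emeasure N A" if "A \<in> ?E" for A using that eq by (auto simp: box)
  have "sets (borel \<Otimes>\<^sub>M borel :: (real \<times> real) measure) = sigma_sets UNIV ?E"
    unfolding borel_prod by (subst borel_eq_atMost) (rule sets_measure_of, simp)
  then show "sets M = sigma_sets UNIV ?E" "sets N = sigma_sets UNIV ?E" using sets by auto
  show "range (\<lambda>n::nat. {..(real n, real n)}) \<subseteq> ?E" by auto
  show "(\<Union>n::nat. {..(real n, real n)}) = (UNIV :: (real \<times> real) set)"
  proof (intro equalityI subsetI UNIV_I)
    fix p :: "real \<times> real"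
    obtain n :: nat where "max (fst p) (snd p) \<le> real n" using real_arch_simple by blast
    then show "p \<in> (\<Union>n::nat. {..(real n, real n)})" by (auto simp: less_eq_prod_def)
  qed
  show "emeasure M {..(real i, real i)} \<noteq> \<infinity>" for i by simp
qed

lemma norm_iexp_diff: "cmod (iexp a - iexp b) \<le> \<bar>a - b\<bar>"
proof -
  have "iexp a - iexp b = iexp b * (iexp (a - b) - 1)"
    by (simp add: algebra_simps exp_diff)
  then have "cmod (iexp a - iexp b) = cmod (iexp (a - b) - 1)"
    by (simp add: norm_mult)
  also have "\<dots> \<le> \<bar>a - b\<bar>" using iexp_approx1[of "a - b" 0] by simp
  finally show ?thesis .
qed

text \<open>Slutsky's lemma, by characteristic functions: \<open>|exp(itZ) - exp(itL)|\<close> is at most \<open>|t| \<epsilon>\<close> where \<open>|Z - L| \<le> \<epsilon>\<close>, and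
at most \<open>2\<close> elsewhere.\<close>

lemma (in prob_space) weak_conv_perturbation:
  fixes Z L :: "nat \<Rightarrow> 'a \<Rightarrow> real"
  assumes Z[measurable]: "\<And>n. Z n \<in> borel_measurable M" and L[measurable]: "\<And>n. L n \<in> borel_measurable M"
    and lim: "real_distribution \<Lambda>"
    and L_lim: "\<And>t. (\<lambda>n. char (distr M borel (L n)) t) \<longlonglongrightarrow> char \<Lambda> t"
    and close: "\<And>\<epsilon>. \<epsilon> > 0 \<Longrightarrow> (\<lambda>n. prob {\<omega>\<in>space M. \<bar>Z n \<omega> - L n \<omega>\<bar> > \<epsilon>}) \<longlonglongrightarrow> 0"
  shows "weak_conv_m (\<lambda>n. distr M borel (Z n)) \<Lambda>"
proof (rule levy_continuity[OF _ lim])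
  show "real_distribution (distr M borel (Z n))" for n by (rule real_distribution_distr) (rule Z)
  fix t
  have diff: "cmod (char (distr M borel (Z n)) t - char (distr M borel (L n)) t)
      \<le> \<bar>t\<bar> * \<epsilon> + 2 * prob {\<omega>\<in>space M. \<bar>Z n \<omega> - L n \<omega>\<bar> > \<epsilon>}" if \<epsilon>: "\<epsilon> > 0" for n \<epsilon>
  proof -
    let ?A = "{\<omega>\<in>space M. \<bar>Z n \<omega> - L n \<omega>\<bar> > \<epsilon>}"
    have A[measurable]: "?A \<in> events" by measurable
    have iZ: "integrable M (\<lambda>\<omega>. iexp (t * Z n \<omega>))" and iL: "integrable M (\<lambda>\<omega>. iexp (t * L n \<omega>))"
      by (rule integrable_const_bound[where B = 1]; simp)+
    have "char (distr M borel (Z n)) t - char (distr M borel (L n)) t = (CLINT \<omega>|M. iexp (t * Z n \<omega>) - iexp (t * L n \<omega>))"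
    proof -
      have "char (distr M borel (Z n)) t = (CLINT \<omega>|M. iexp (t * Z n \<omega>))"
        "char (distr M borel (L n)) t = (CLINT \<omega>|M. iexp (t * L n \<omega>))"
        unfolding char_def by (rule integral_distr; measurable)+
      then show ?thesis by (simp only: Bochner_Integration.integral_diff[OF iZ iL])
    qed
    also have "cmod \<dots> \<le> (\<integral>\<omega>. cmod (iexp (t * Z n \<omega>) - iexp (t * L n \<omega>)) \<partial>M)"
      by (rule integral_norm_bound)
    also have "\<dots> \<le> (\<integral>\<omega>. \<bar>t\<bar> * \<epsilon> + 2 * indicator ?A \<omega> \<partial>M)"
    proof (rule integral_mono)
      show "integrable M (\<lambda>\<omega>. cmod (iexp (t * Z n \<omega>) - iexp (t * L n \<omega>)))"
        by (intro integrable_norm Bochner_Integration.integrable_diff iZ iL)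
      show "integrable M (\<lambda>\<omega>. \<bar>t\<bar> * \<epsilon> + 2 * indicator ?A \<omega>)"
        by (intro Bochner_Integration.integrable_add integrable_mult_right integrable_const integrable_real_indicator A)
           (simp add: emeasure_eq_measure)
      fix \<omega> assume \<omega>: "\<omega> \<in> space M"
      show "cmod (iexp (t * Z n \<omega>) - iexp (t * L n \<omega>)) \<le> \<bar>t\<bar> * \<epsilon> + 2 * indicator ?A \<omega>"
      proof (cases "\<omega> \<in> ?A")
        case True
        have "cmod (iexp (t * Z n \<omega>) - iexp (t * L n \<omega>)) \<le> cmod (iexp (t * Z n \<omega>)) + cmod (iexp (t * L n \<omega>))"
          by (rule norm_triangle_ineq4)
        also have "\<dots> = 2" by (simp del: of_real_mult)
        finally show ?thesis using True \<epsilon> by (simp add: add_increasing)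
      next
        case False
        have "cmod (iexp (t * Z n \<omega>) - iexp (t * L n \<omega>)) \<le> \<bar>t * Z n \<omega> - t * L n \<omega>\<bar>" by (rule norm_iexp_diff)
        also have "\<dots> = \<bar>t\<bar> * \<bar>Z n \<omega> - L n \<omega>\<bar>" by (simp add: right_diff_distrib[symmetric] abs_mult)
        also have "\<dots> \<le> \<bar>t\<bar> * \<epsilon>" using False \<omega> by (intro mult_left_mono) auto
        finally show ?thesis using False by simp
      qed
    qed
    also have "\<dots> = \<bar>t\<bar> * \<epsilon> + 2 * prob ?A"
    proof -
      have "integrable M (indicator ?A :: _ \<Rightarrow> real)"
        by (rule integrable_real_indicator[OF A]) (simp add: emeasure_eq_measure)
      then have "(\<integral>\<omega>. \<bar>t\<bar> * \<epsilon> + 2 * indicator ?A \<omega> \<partial>M) = (\<integral>\<omega>. \<bar>t\<bar> * \<epsilon> \<partial>M) + 2 * (\<integral>\<omega>. indicator ?A \<omega> \<partial>M)"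
        by (subst Bochner_Integration.integral_add) auto
      moreover have "(\<integral>\<omega>. indicator ?A \<omega> \<partial>M) = prob ?A"
        by (subst Bochner_Integration.integral_indicator) (auto intro!: arg_cong[where f = "measure M"])
      ultimately show ?thesis by (simp add: prob_space)
    qed
    finally show ?thesis .
  qed
  have "(\<lambda>n. char (distr M borel (Z n)) t - char (distr M borel (L n)) t) \<longlonglongrightarrow> 0"
  proof (rule tendstoI)
    fix r :: real assume r: "r > 0"
    define \<epsilon> where "\<epsilon> = r / (2 * (\<bar>t\<bar> + 1))"
    have \<epsilon>: "\<epsilon> > 0" using r by (simp add: \<epsilon>_def)
    have "\<bar>t\<bar> * \<epsilon> \<le> (\<bar>t\<bar> + 1) * \<epsilon>" using \<epsilon> by simp
    also have "\<dots> = r / 2" by (simp add: \<epsilon>_def field_simps)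
    finally have t: "\<bar>t\<bar> * \<epsilon> \<le> r / 2" .
    have "eventually (\<lambda>n. prob {\<omega>\<in>space M. \<bar>Z n \<omega> - L n \<omega>\<bar> > \<epsilon>} < r / 4) sequentially"
      using close[OF \<epsilon>] r by (intro order_tendstoD) auto
    then show "eventually (\<lambda>n. dist (char (distr M borel (Z n)) t - char (distr M borel (L n)) t) 0 < r) sequentially"
    proof eventually_elim
      fix n assume "prob {\<omega>\<in>space M. \<bar>Z n \<omega> - L n \<omega>\<bar> > \<epsilon>} < r / 4"
      then show "dist (char (distr M borel (Z n)) t - char (distr M borel (L n)) t) 0 < r"
        using diff[OF \<epsilon>, of n] t by simp
    qed
  qed
  from tendsto_add[OF this L_lim[of t]] show "(\<lambda>n. char (distr M borel (Z n)) t) \<longlonglongrightarrow> char \<Lambda> t" by simp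
qed

lemma real_distribution_centred_normal: "real_distribution (centred_normal v)"
proof -
  interpret prob_space std_normal_distribution by (rule prob_space_normal_density) simp
  show ?thesis unfolding centred_normal_def by (rule real_distribution_distr) simp
qed

lemma char_centred_normal: "char (centred_normal v) t = char std_normal_distribution (sqrt v * t)"
  unfolding centred_normal_def char_def by (subst integral_distr) (auto simp: mult_ac)

text \<open>The central limit theorem in the form needed for \<open>weak_conv_perturbation\<close>. If the variance is zero then the summands vanish almost surely
and the limit is the point mass at zero.\<close>

lemma (in prob_space) char_normalised_sum_lim:
  fixes X :: "nat \<Rightarrow> 'a \<Rightarrow> real"
  assumes indep: "indep_vars (\<lambda>i. borel) X UNIV"
    and mean: "\<And>n. expectation (X n) = 0" and sq: "\<And>n. integrable M (\<lambda>x. (X n x)\<^sup>2)"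
    and var: "\<And>n. expectation (\<lambda>x. (X n x)\<^sup>2) = v" and dist: "\<And>n. distr M borel (X n) = \<mu>"
  shows "(\<lambda>n. char (distr M borel (\<lambda>x. (\<Sum>i<n. X i x) / sqrt n)) t) \<longlonglongrightarrow> char (centred_normal v) t"
proof -
  have X[measurable]: "X n \<in> borel_measurable M" for n using indep by (auto simp: indep_vars_def)
  have v0: "v \<ge> 0" unfolding var[of 0, symmetric] by (rule Bochner_Integration.integral_nonneg) simp
  show ?thesis
  proof (cases "v = 0")
    case True
    have "AE x in M. X i x = 0" for i
    proof -
      have "AE x in M. (X i x)\<^sup>2 = 0"
        using integral_nonneg_eq_0_iff_AE[OF sq[of i]] var[of i] True by simp
      then show ?thesis by eventually_elim simp
    qed
    then have all: "AE x in M. \<forall>i. X i x = 0" by (simp add: AE_all_countable)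
    have "char (distr M borel (\<lambda>x. (\<Sum>i<n. X i x) / sqrt n)) t = char (centred_normal v) t" for n
    proof -
      have "char (distr M borel (\<lambda>x. (\<Sum>i<n. X i x) / sqrt n)) t = (CLINT x|M. iexp (t * ((\<Sum>i<n. X i x) / sqrt n)))"
        unfolding char_def by (rule integral_distr) measurable
      also have "\<dots> = (CLINT x|M. 1)"
        by (rule integral_cong_AE) (use all in \<open>auto elim!: eventually_mono\<close>)
      also have "\<dots> = 1" by (simp add: prob_space)
      also have "\<dots> = char (centred_normal v) t"
      proof -
        interpret N: real_distribution "std_normal_distribution" by (rule real_dist_normal_dist)
        show ?thesis unfolding char_centred_normal True by (simp add: N.char_zero)
      qed
      finally show ?thesis .
    qed
    then show ?thesis by simp
  next
    case False
    then have v: "v > 0" using v0 by simp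
    define s where "s = sqrt v"
    have s: "s > 0" "s\<^sup>2 = v" using v by (auto simp: s_def)
    have wc: "weak_conv_m (\<lambda>n. distr M borel (\<lambda>x. (\<Sum>i<n. X i x) / sqrt (n * s\<^sup>2))) std_normal_distribution"
      by (rule central_limit_theorem_zero_mean[OF indep mean s(1) sq _ dist]) (simp add: mean var s)
    have "(\<lambda>n. char (distr M borel (\<lambda>x. (\<Sum>i<n. X i x) / sqrt (n * s\<^sup>2))) (s * t)) \<longlonglongrightarrow> char std_normal_distribution (s * t)"
      by (rule levy_continuity1[OF _ real_dist_normal_dist wc]) (rule real_distribution_distr, measurable)
    moreover have "char (distr M borel (\<lambda>x. (\<Sum>i<n. X i x) / sqrt (n * s\<^sup>2))) (s * t)
        = char (distr M borel (\<lambda>x. (\<Sum>i<n. X i x) / sqrt n)) t" for n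
    proof -
      have "s * t * ((\<Sum>i<n. X i x) / sqrt (n * s\<^sup>2)) = t * ((\<Sum>i<n. X i x) / sqrt n)" for x
        using s(1) by (simp add: real_sqrt_mult)
      then show ?thesis unfolding char_def by (subst (1 2) integral_distr) simp_all
    qed
    ultimately show ?thesis by (simp add: char_centred_normal s_def)
  qed
qed

section \<open>The law of an observed pair\<close>

context left_truncation
begin

lemma distr_fst_H: "distr H borel fst = density \<mu> (\<lambda>z. ennreal (G z / \<alpha>))"
proof (rule measure_eqI)
  show "sets (distr H borel fst) = sets (density \<mu> (\<lambda>z. ennreal (G z / \<alpha>)))" by simp
  fix E assume "E \<in> sets (distr H borel fst)"
  then have [measurable]: "E \<in> sets borel" by simp
  interpret \<nu>\<mu>: pair_prob_space \<nu> \<mu> ..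
  have "emeasure (distr H borel fst) E = (\<integral>\<^sup>+x. indicator E x \<partial>distr H borel fst)" by simp
  also have "\<dots> = (\<integral>\<^sup>+p. indicator E (fst p) \<partial>H)" by (rule nn_integral_distr) measurable
  also have "\<dots> = (\<integral>\<^sup>+y. \<integral>\<^sup>+x. (if y \<le> x then indicator E (fst (x, y)) else 0) * ennreal (1 / \<alpha>) \<partial>\<mu> \<partial>\<nu>)"
    by (rule nn_integral_H) measurable
  also have "\<dots> = (\<integral>\<^sup>+y. \<integral>\<^sup>+x. indicator E x * ennreal (1 / \<alpha>) * (if y \<le> x then 1 else 0) \<partial>\<mu> \<partial>\<nu>)"
    by (intro nn_integral_cong) auto
  also have "\<dots> = (\<integral>\<^sup>+x. \<integral>\<^sup>+y. indicator E x * ennreal (1 / \<alpha>) * (if y \<le> x then 1 else 0) \<partial>\<nu> \<partial>\<mu>)"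
    by (rule \<mu>\<nu>.Fubini') measurable
  also have "\<dots> = (\<integral>\<^sup>+x. ennreal (G x / \<alpha>) * indicator E x \<partial>\<mu>)"
  proof (rule nn_integral_cong)
    fix x
    have "(\<integral>\<^sup>+y. (if y \<le> x then 1 else 0) \<partial>\<nu>) = (\<integral>\<^sup>+y. indicator {..x} y \<partial>\<nu>)"
      by (intro nn_integral_cong) (auto split: split_indicator)
    also have "\<dots> = ennreal (G x)" by (simp add: \<nu>.emeasure_eq_measure G_def cdf_def)
    finally have G: "(\<integral>\<^sup>+y. (if y \<le> x then 1 else 0) \<partial>\<nu>) = ennreal (G x)" .
    have "(\<integral>\<^sup>+y. indicator E x * ennreal (1 / \<alpha>) * (if y \<le> x then 1 else 0) \<partial>\<nu>) = indicator E x * ennreal (1 / \<alpha>) * ennreal (G x)"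
      unfolding G[symmetric] by (rule nn_integral_cmult) measurable
    also have "\<dots> = ennreal (G x / \<alpha>) * indicator E x"
    proof -
      have "ennreal (1 / \<alpha>) * ennreal (G x) = ennreal (G x / \<alpha>)"
        using \<alpha>_pos G_nonneg[of x] by (subst ennreal_mult[symmetric]) auto
      then show ?thesis by (simp add: mult_ac)
    qed
    finally show "(\<integral>\<^sup>+y. indicator E x * ennreal (1 / \<alpha>) * (if y \<le> x then 1 else 0) \<partial>\<nu>) = ennreal (G x / \<alpha>) * indicator E x" .
  qed
  also have "\<dots> = emeasure (density \<mu> (\<lambda>z. ennreal (G z / \<alpha>))) E"
    by (rule emeasure_density[symmetric]) auto
  finally show "emeasure (distr H borel fst) E = emeasure (density \<mu> (\<lambda>z. ennreal (G z / \<alpha>))) E" .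
qed

lemma G_over_\<alpha>: "0 \<le> G z / \<alpha>" using \<alpha>_pos G_nonneg by simp

lemma integrable_fst_H:
  fixes f :: "real \<Rightarrow> real"
  assumes [measurable]: "f \<in> borel_measurable borel"
  shows "integrable (distr H borel fst) f \<longleftrightarrow> integrable \<mu> (\<lambda>z. G z / \<alpha> * f z)"
  unfolding distr_fst_H by (subst integrable_density) (auto simp: G_over_\<alpha>)

lemma integral_fst_H:
  fixes f :: "real \<Rightarrow> real"
  assumes [measurable]: "f \<in> borel_measurable borel"
  shows "(\<integral>z. f z \<partial>distr H borel fst) = (\<integral>z. G z / \<alpha> * f z \<partial>\<mu>)"
  unfolding distr_fst_H by (subst integral_density) (auto simp: G_over_\<alpha>)

text \<open>A sample of size one is an observed pair. In this way the results on stochastic integrals give the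
moments of the influence function.\<close>

lemma distr_coord: "distr (D (Suc 0)) H (\<lambda>d. d 0) = H"
  unfolding D_def by (rule distr_PiM_component) (auto intro: prob_space_H)

end

context truncated_integrand
begin

lemma psi_integrand:
  "AE x in \<mu>. G x / \<alpha> * (indicator {y<..} x * (\<phi> x * S x / C x)) = (if y < x then \<phi> x else 0)"
  using AE_S_pos AE_G_pos by eventually_elim (use \<alpha>_pos in \<open>auto simp: C_def split: split_indicator\<close>)

lemma psi_integral:
  "integrable (distr H borel fst) (\<lambda>x. indicator {y<..} x * (\<phi> x * S x / C x))"
  "(\<integral>x. indicator {y<..} x * (\<phi> x * S x / C x) \<partial>distr H borel fst) = T y"
proof -
  have i: "integrable \<mu> (\<lambda>x. if y < x then \<phi> x else 0)"
    by (rule Bochner_Integration.integrable_bound[OF integrable_\<phi>]) auto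
  show "integrable (distr H borel fst) (\<lambda>x. indicator {y<..} x * (\<phi> x * S x / C x))"
    by (subst integrable_fst_H, measurable, subst integrable_cong_AE[OF _ _ psi_integrand]) (use i in auto)
  show "(\<integral>x. indicator {y<..} x * (\<phi> x * S x / C x) \<partial>distr H borel fst) = T y"
    by (subst integral_fst_H, measurable, unfold tail_def, rule integral_cong_AE[OF _ _ psi_integrand]) auto
qed

lemma \<psi>_differences: "\<psi> y = (LINT x:{y<..}|\<mu>. \<phi> y - \<phi> x)"
proof -
  have i: "integrable \<mu> (\<lambda>x. if y < x then \<phi> x else 0)"
    by (rule Bochner_Integration.integrable_bound[OF integrable_\<phi>]) auto
  have "(LINT x:{y<..}|\<mu>. \<phi> y - \<phi> x) = (\<integral>x. \<phi> y * indicator {y<..} x - (if y < x then \<phi> x else 0) \<partial>\<mu>)"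
    unfolding set_lebesgue_integral_def by (intro Bochner_Integration.integral_cong) (auto split: split_indicator)
  also have "\<dots> = \<phi> y * measure \<mu> {y<..} - T y"
    using i by (subst Bochner_Integration.integral_diff) (auto simp: tail_def \<mu>.emeasure_eq_measure)
  also have "measure \<mu> {y<..} = S y"
  proof -
    have "{y..} = insert y {y<..}" by auto
    then have "S y = measure \<mu> {y} + measure \<mu> {y<..}"
      unfolding S_def by (simp add: \<mu>.finite_measure_Union[of "{y}" "{y<..}", simplified])
    then show ?thesis by (simp add: no_atoms)
  qed
  finally show ?thesis by (simp add: \<Psi>_def)
qed

text \<open>The two forms of the compensator agree because \<open>dF\<^sup>* / C\<^sup>2 = dF / (C S)\<close>. Division by zero makes this
true also where \<open>S\<close> or \<open>C\<close> vanishes.\<close>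

lemma infl_integrand:
  "G u / \<alpha> * (indicator {a..b} u * (\<psi> u / (C u)\<^sup>2)) = (if a \<le> u \<and> u \<le> b then \<psi> u / (C u * S u) else 0)"
proof (cases "S u = 0")
  case False
  then have "G u / \<alpha> = C u / S u" by (simp add: C_def)
  then show ?thesis by (cases "C u = 0") (auto simp: power2_eq_square split: split_indicator)
qed (auto simp: C_def split: split_indicator)

lemma AE_infl_integrable:
  "AE p in H. integrable (distr H borel fst) (\<lambda>u. indicator {snd p..fst p} u * (\<psi> u / (C u)\<^sup>2))"
proof -
  let ?f = "\<lambda>p u. (if snd p \<le> u \<and> u \<le> fst p then \<psi> u / (C u * S u) else 0)"
  have "AE d in D (Suc 0). (\<integral>\<^sup>+u. ennreal (norm (if obsY d 0 \<le> u \<and> u \<le> obsX d 0 then \<psi> u / (C u * S u) else 0)) \<partial>\<mu>) < \<infinity>"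
    using AE_linear[of "Suc 0"] AE_space
  proof eventually_elim
    fix d assume i: "integrable \<mu> (\<lambda>u. \<psi> u / C u * risk (Suc 0) d u / S u)" and d: "d \<in> space (D (Suc 0))"
    show "(\<integral>\<^sup>+u. ennreal (norm (if obsY d 0 \<le> u \<and> u \<le> obsX d 0 then \<psi> u / (C u * S u) else 0)) \<partial>\<mu>) < \<infinity>"
      using mart_linear(2)[OF d i, of 0] unfolding integrable_iff_bounded by simp
  qed
  then have "AE d in D (Suc 0). (\<integral>\<^sup>+u. ennreal (norm (if snd (d 0) \<le> u \<and> u \<le> fst (d 0) then \<psi> u / (C u * S u) else 0)) \<partial>\<mu>) < \<infinity>"
    by (simp only: obsX_def obsY_def)
  then have "AE p in distr (D (Suc 0)) H (\<lambda>d. d 0). (\<integral>\<^sup>+u. ennreal (norm (?f p u)) \<partial>\<mu>) < \<infinity>"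
  proof (subst AE_distr_iff)
    show "(\<lambda>d. d 0) \<in> D (Suc 0) \<rightarrow>\<^sub>M H" unfolding D_def by measurable
    have "Measurable.pred H (\<lambda>p. (\<integral>\<^sup>+u. ennreal (norm (?f p u)) \<partial>\<mu>) < \<infinity>)"
      by measurable
    then show "{p \<in> space H. (\<integral>\<^sup>+u. ennreal (norm (?f p u)) \<partial>\<mu>) < \<infinity>} \<in> sets H"
      by (simp only: pred_def)
  qed
  then show ?thesis unfolding distr_coord
  proof eventually_elim
    fix p :: "real \<times> real"
    assume f: "(\<integral>\<^sup>+u. ennreal (norm (?f p u)) \<partial>\<mu>) < \<infinity>"
    have "integrable \<mu> (\<lambda>u. if snd p \<le> u \<and> u \<le> fst p then \<psi> u / (C u * S u) else 0)"
      by (rule integrableI_bounded[OF _ f]) measurable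
    then show "integrable (distr H borel fst) (\<lambda>u. indicator {snd p..fst p} u * (\<psi> u / (C u)\<^sup>2))"
      by (subst integrable_fst_H, measurable) (simp only: infl_integrand)
  qed
qed

lemma infl_alt:
  "infl (x, y) = \<psi> x / C x - (\<integral>u. indicator {y..x} u * (\<psi> u / (C u)\<^sup>2) \<partial>distr H borel fst)"
  unfolding infl_def by (subst integral_fst_H, measurable) (simp only: infl_integrand fst_conv snd_conv)

text \<open>The influence function is the stochastic integral of \<open>\<psi>/C\<close> for a sample of size one. So it is centred, and its second
moment is at most \<open>\<integral> \<psi>\<^sup>2 / (C S) dF\<close>.\<close>

lemma infl_moments:
  "integrable H infl" "(\<integral>p. infl p \<partial>H) = 0" "integrable H (\<lambda>p. (infl p)\<^sup>2)"
proof -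
  note [measurable] = measurable_mart[OF measurable_kL]
  have c[measurable]: "(\<lambda>d. d 0) \<in> D (Suc 0) \<rightarrow>\<^sub>M H" unfolding D_def by measurable
  have eq: "AE d in D (Suc 0). mart (Suc 0) kL d = infl (d 0)"
    using AE_linear[of "Suc 0"] AE_space by eventually_elim (simp add: mart_linear(1))
  have mi: "integrable (D (Suc 0)) (mart (Suc 0) kL)" "(\<integral>d. mart (Suc 0) kL d \<partial>D (Suc 0)) = 0"
    by (rule integrable_mart[OF measurable_kL predictable_kL linear_finite],
        rule integral_mart[OF measurable_kL predictable_kL linear_finite])
  have m: "infl \<in> borel_measurable H" by measurable
  have m': "(\<lambda>d. infl (d 0)) \<in> borel_measurable (D (Suc 0))"
    by (rule measurable_compose[OF c m])
  have "integrable (D (Suc 0)) (\<lambda>d. infl (d 0))"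
    using mi(1) integrable_cong_AE[OF _ m' eq] by simp
  then have "integrable (distr (D (Suc 0)) H (\<lambda>d. d 0)) infl"
    by (subst integrable_distr_eq[OF c m])
  then show "integrable H infl" by (simp only: distr_coord)
  have "(\<integral>p. infl p \<partial>distr (D (Suc 0)) H (\<lambda>d. d 0)) = (\<integral>d. infl (d 0) \<partial>D (Suc 0))"
    by (rule integral_distr[OF c m])
  also have "\<dots> = (\<integral>d. mart (Suc 0) kL d \<partial>D (Suc 0))"
    by (rule integral_cong_AE[OF m']) (measurable, use eq in \<open>auto elim!: eventually_mono\<close>)
  finally show "(\<integral>p. infl p \<partial>H) = 0" by (simp only: distr_coord mi)
  have "(\<integral>\<^sup>+p. ennreal ((infl p)\<^sup>2) \<partial>distr (D (Suc 0)) H (\<lambda>d. d 0)) = (\<integral>\<^sup>+d. ennreal ((infl (d 0))\<^sup>2) \<partial>D (Suc 0))"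
    by (rule nn_integral_distr[OF c]) measurable
  also have "\<dots> = (\<integral>\<^sup>+d. ennreal ((mart (Suc 0) kL d)\<^sup>2) \<partial>D (Suc 0))"
    by (rule nn_integral_cong_AE) (use eq in \<open>auto elim!: eventually_mono\<close>)
  also have "\<dots> \<le> (\<integral>\<^sup>+d. \<integral>\<^sup>+u. ennreal ((\<psi> u / C u)\<^sup>2 * risk (Suc 0) d u / S u) \<partial>\<mu> \<partial>D (Suc 0))"
    by (rule mart_second_moment[OF measurable_kL predictable_kL])
  also have "\<dots> = (\<integral>\<^sup>+u. \<integral>\<^sup>+d. ennreal ((\<psi> u / C u)\<^sup>2 * risk (Suc 0) d u / S u) \<partial>D (Suc 0) \<partial>\<mu>)"
    by (rule D\<mu>.Fubini'[symmetric]) measurable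
  also have "\<dots> = (\<integral>\<^sup>+u. ennreal ((\<psi> u)\<^sup>2 / (C u * S u)) \<partial>\<mu>)"
  proof (rule nn_integral_cong_AE, use AE_C_pos AE_S_pos in eventually_elim)
    fix u assume u: "C u > 0" "S u > 0"
    have "(\<integral>\<^sup>+d. ennreal ((\<psi> u / C u)\<^sup>2 * risk (Suc 0) d u / S u) \<partial>D (Suc 0))
       = (\<integral>\<^sup>+d. ennreal ((\<psi> u / C u)\<^sup>2 / S u) * ennreal (risk (Suc 0) d u) \<partial>D (Suc 0))"
      using u by (intro nn_integral_cong) (subst ennreal_mult[symmetric], auto simp: risk_nonneg)
    also have "\<dots> = ennreal ((\<psi> u / C u)\<^sup>2 / S u) * ennreal (real (Suc 0) * C u)"
      by (subst nn_integral_cmult) (auto simp: risk_first_moment)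
    also have "\<dots> = ennreal ((\<psi> u / C u)\<^sup>2 / S u * C u)"
      using u by (subst ennreal_mult[symmetric]) auto
    also have "(\<psi> u / C u)\<^sup>2 / S u * C u = (\<psi> u)\<^sup>2 / (C u * S u)"
      using u by (simp add: power_divide power2_eq_square[of "C u"])
    finally show "(\<integral>\<^sup>+d. ennreal ((\<psi> u / C u)\<^sup>2 * risk (Suc 0) d u / S u) \<partial>D (Suc 0)) = ennreal ((\<psi> u)\<^sup>2 / (C u * S u))" .
  qed
  also have "\<dots> < \<infinity>" by (rule finite_information)
  finally have "(\<integral>\<^sup>+p. ennreal ((infl p)\<^sup>2) \<partial>H) < \<infinity>" by (simp only: distr_coord)
  then show "integrable H (\<lambda>p. (infl p)\<^sup>2)"
    by (intro integrableI_nonneg) auto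
qed

text \<open>The first \<open>n\<close> observations have law \<open>D n\<close>, so the remainder estimates apply to them. The influences
of the observations are independent copies of \<open>infl\<close>.\<close>

lemma clt_lynden_bell:
  fixes P :: "'b measure" and Xo Yo :: "nat \<Rightarrow> 'b \<Rightarrow> real"
  assumes P: "prob_space P"
    and indep: "prob_space.indep_vars P (\<lambda>_. borel \<Otimes>\<^sub>M borel) (\<lambda>i \<omega>. (Xo i \<omega>, Yo i \<omega>)) UNIV"
    and law: "\<And>i. distr P (borel \<Otimes>\<^sub>M borel) (\<lambda>\<omega>. (Xo i \<omega>, Yo i \<omega>)) = H"
  shows "weak_conv_m (\<lambda>n. distr P borel (\<lambda>\<omega>.
      sqrt n * (lynden_bell_integral \<phi> n (\<lambda>i. Xo i \<omega>) (\<lambda>i. Yo i \<omega>) - (\<integral>x. \<phi> x \<partial>\<mu>))))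
    (centred_normal (\<integral>p. (infl p)\<^sup>2 \<partial>H))"
proof -
  interpret P: prob_space P by fact
  have pair[measurable]: "(\<lambda>\<omega>. (Xo i \<omega>, Yo i \<omega>)) \<in> P \<rightarrow>\<^sub>M borel \<Otimes>\<^sub>M borel" for i
    using indep by (auto simp: P.indep_vars_def)
  have [measurable]: "Xo i \<in> borel_measurable P" "Yo i \<in> borel_measurable P" for i
    using measurable_compose[OF pair measurable_fst] measurable_compose[OF pair measurable_snd] by simp_all
  define I where "I i \<omega> = infl (Xo i \<omega>, Yo i \<omega>)" for i \<omega>
  have [measurable]: "I i \<in> borel_measurable P" for i
    unfolding I_def by measurable
  show ?thesis
  proof (rule P.weak_conv_perturbation[where L = "\<lambda>n \<omega>. (\<Sum>i<n. I i \<omega>) / sqrt n"])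
    show "(\<lambda>\<omega>. sqrt n * (lynden_bell_integral \<phi> n (\<lambda>i. Xo i \<omega>) (\<lambda>i. Yo i \<omega>) - (\<integral>x. \<phi> x \<partial>\<mu>))) \<in> borel_measurable P" for n
    proof -
      have [measurable]: "(\<lambda>\<omega>. lynden_bell_integral \<phi> n (\<lambda>i. Xo i \<omega>) (\<lambda>i. Yo i \<omega>)) \<in> borel_measurable P"
        by (rule measurable_lynden_bell_integral) measurable
      show ?thesis by measurable
    qed
    show "(\<lambda>\<omega>. (\<Sum>i<n. I i \<omega>) / sqrt n) \<in> borel_measurable P" for n by measurable
    show "real_distribution (centred_normal (\<integral>p. (infl p)\<^sup>2 \<partial>H))" by (rule real_distribution_centred_normal)
    show "(\<lambda>n. char (distr P borel (\<lambda>\<omega>. (\<Sum>i<n. I i \<omega>) / sqrt n)) t) \<longlonglongrightarrow> char (centred_normal (\<integral>p. (infl p)\<^sup>2 \<partial>H)) t" for t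
    proof (rule P.char_normalised_sum_lim)
      show "P.indep_vars (\<lambda>i. borel) I UNIV"
        using P.indep_vars_compose[OF indep, of "\<lambda>_. infl" "\<lambda>_. borel"] by (simp add: comp_def I_def[abs_def])
      have tr: "(\<integral>\<omega>. f (Xo i \<omega>, Yo i \<omega>) \<partial>P) = (\<integral>p. f p \<partial>H)" if "f \<in> borel_measurable (borel \<Otimes>\<^sub>M borel)" for f :: "real \<times> real \<Rightarrow> real" and i
        unfolding law[of i, symmetric] by (rule integral_distr[symmetric]) (use that in auto)
      show "P.expectation (I n) = 0" for n unfolding I_def by (subst tr) (auto simp: infl_moments)
      show "P.expectation (\<lambda>x. (I n x)\<^sup>2) = (\<integral>p. (infl p)\<^sup>2 \<partial>H)" for n
        unfolding I_def by (rule tr[of "\<lambda>p. (infl p)\<^sup>2"]) measurable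
      show "integrable P (\<lambda>x. (I n x)\<^sup>2)" for n
        using infl_moments(3) unfolding I_def law[of n, symmetric] by (subst (asm) integrable_distr_eq) auto
      show "distr P borel (I n) = distr H borel infl" for n
        unfolding law[of n, symmetric] by (subst distr_distr) (auto simp: comp_def I_def[abs_def])
    qed
    fix \<epsilon> :: real assume \<epsilon>: "\<epsilon> > 0"
    let ?Z = "\<lambda>n \<omega>. sqrt n * (lynden_bell_integral \<phi> n (\<lambda>i. Xo i \<omega>) (\<lambda>i. Yo i \<omega>) - (\<integral>x. \<phi> x \<partial>\<mu>))"
    let ?L = "\<lambda>n \<omega>. (\<Sum>i<n. I i \<omega>) / sqrt n"
    let ?A = "\<lambda>n. {\<omega>\<in>space P. \<bar>?Z n \<omega> - ?L n \<omega>\<bar> > \<epsilon>}"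
    have Zm: "?Z n \<in> borel_measurable P" for n
    proof -
      have [measurable]: "(\<lambda>\<omega>. lynden_bell_integral \<phi> n (\<lambda>i. Xo i \<omega>) (\<lambda>i. Yo i \<omega>)) \<in> borel_measurable P"
        by (rule measurable_lynden_bell_integral) measurable
      show ?thesis by measurable
    qed
    have le: "ennreal (P.prob (?A n)) \<le> (\<integral>\<^sup>+d. (if \<bar>remainder n d\<bar> > \<epsilon> then 1 else 0) \<partial>D n)"
      if n: "n > 0" for n
    proof -
      define \<Delta> where "\<Delta> \<omega> = (\<lambda>i\<in>{..<n}. (Xo i \<omega>, Yo i \<omega>))" for \<omega>
      have \<Delta>_meas: "\<Delta> \<in> P \<rightarrow>\<^sub>M Pi\<^sub>M {..<n} (\<lambda>_. borel \<Otimes>\<^sub>M borel)"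
        unfolding \<Delta>_def[abs_def] by measurable
      have \<Delta>_meas'[measurable]: "\<Delta> \<in> P \<rightarrow>\<^sub>M D n"
        using \<Delta>_meas measurable_cong_sets[OF refl sets_D] by blast
      have "P.indep_vars (\<lambda>_. borel \<Otimes>\<^sub>M borel) (\<lambda>i \<omega>. (Xo i \<omega>, Yo i \<omega>)) {..<n}"
        using P.indep_vars_subset[OF indep] by auto
      then have "distr P (Pi\<^sub>M {..<n} (\<lambda>_. borel \<Otimes>\<^sub>M borel)) \<Delta> = Pi\<^sub>M {..<n} (\<lambda>i. distr P (borel \<Otimes>\<^sub>M borel) (\<lambda>\<omega>. (Xo i \<omega>, Yo i \<omega>)))"
        using n unfolding \<Delta>_def[abs_def] by (subst (asm) P.indep_vars_iff_distr_eq_PiM') auto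
      then have \<Delta>_law: "distr P (D n) \<Delta> = D n"
        unfolding law by (subst distr_cong[OF refl sets_D refl]) (simp add: D_def)
      have dx: "obsX (\<Delta> \<omega>) i = Xo i \<omega>" "obsY (\<Delta> \<omega>) i = Yo i \<omega>" if "i < n" for i \<omega>
        using that by (auto simp: \<Delta>_def obsX_def obsY_def)
      have lb: "lynden_bell_integral \<phi> n (\<lambda>i. Xo i \<omega>) (\<lambda>i. Yo i \<omega>) = lynden_bell_integral \<phi> n (obsX (\<Delta> \<omega>)) (obsY (\<Delta> \<omega>))" for \<omega>
      proof -
        have 1: "(\<lambda>i. Xo i \<omega>) ` {..<n} = obsX (\<Delta> \<omega>) ` {..<n}" using dx by (auto intro!: image_cong)
        have 2: "hazard n (\<lambda>i. Xo i \<omega>) (\<lambda>i. Yo i \<omega>) = hazard n (obsX (\<Delta> \<omega>)) (obsY (\<Delta> \<omega>))"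
          unfolding hazard_def using dx by (intro ext arg_cong2[where f = "(/)"] sum.cong) auto
        show ?thesis unfolding lynden_bell_integral_eq 1 2 ..
      qed
      have "AE d in distr P (D n) \<Delta>. good n d" unfolding \<Delta>_law by (rule AE_good)
      then have "AE \<omega> in P. good n (\<Delta> \<omega>)" by (rule AE_distrD[OF \<Delta>_meas'])
      then have eq: "AE \<omega> in P. ?Z n \<omega> - ?L n \<omega> = remainder n (\<Delta> \<omega>)"
      proof eventually_elim
        fix \<omega> assume g: "good n (\<Delta> \<omega>)"
        have "lynden_bell_integral \<phi> n (obsX (\<Delta> \<omega>)) (obsY (\<Delta> \<omega>)) = pl_integral \<phi> n (\<Delta> \<omega>)"
          unfolding pl_integral_def by (rule lynden_bell_integral_distinct) (use g in \<open>simp add: good_def\<close>)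
        moreover have "(\<Sum>i<n. I i \<omega>) = (\<Sum>i<n. infl (\<Delta> \<omega> i))"
          by (intro sum.cong) (auto simp: I_def \<Delta>_def)
        ultimately show "?Z n \<omega> - ?L n \<omega> = remainder n (\<Delta> \<omega>)" by (simp add: remainder_def lb)
      qed
      have set: "(?A n) \<in> sets P"
      proof -
        note [measurable] = Zm[of n]
        show ?thesis by measurable
      qed
      have "ennreal (P.prob (?A n)) = (\<integral>\<^sup>+\<omega>. indicator (?A n) \<omega> \<partial>P)"
        by (simp only: P.emeasure_eq_measure[symmetric] nn_integral_indicator[OF set])
      also have "\<dots> = (\<integral>\<^sup>+\<omega>. (if \<bar>remainder n (\<Delta> \<omega>)\<bar> > \<epsilon> then 1 else 0) \<partial>P)"
      proof (rule nn_integral_cong_AE)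
        show "AE \<omega> in P. indicator (?A n) \<omega> = (if \<bar>remainder n (\<Delta> \<omega>)\<bar> > \<epsilon> then 1 else (0::ennreal))"
          using eq AE_space by eventually_elim (simp split: split_indicator)
      qed
      also have "\<dots> = (\<integral>\<^sup>+d. (if \<bar>remainder n d\<bar> > \<epsilon> then 1 else 0) \<partial>distr P (D n) \<Delta>)"
        by (rule nn_integral_distr[symmetric]) measurable
      finally show ?thesis by (simp only: \<Delta>_law order_refl)
    qed
    have "(\<lambda>n. ennreal (P.prob (?A n))) \<longlonglongrightarrow> 0"
    proof (rule tendsto_sandwich[OF _ _ tendsto_const remainder_negligible[OF \<epsilon>]])
      show "\<forall>\<^sub>F n in sequentially. ennreal (P.prob (?A n)) \<le> (\<integral>\<^sup>+d. (if \<bar>remainder n d\<bar> > \<epsilon> then 1 else 0) \<partial>D n)"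
        using eventually_gt_at_top[of 0] by eventually_elim (rule le)
    qed simp
    then show "(\<lambda>n. P.prob (?A n)) \<longlonglongrightarrow> 0"
      by (subst tendsto_ennreal_iff[symmetric]) simp_all
  qed
qed

end

theorem corollary1p1:
  fixes M :: "'a measure" and X Y :: "'a \<Rightarrow> real"
    and P :: "'b measure" and Xo Yo :: "nat \<Rightarrow> 'b \<Rightarrow> real"
    and F G \<phi> :: "real \<Rightarrow> real" and dF :: "real measure"
  defines "dF \<equiv> distr M borel X"
    and "F \<equiv> cdf (distr M borel X)"
    and "G \<equiv> cdf (distr M borel Y)"
  assumes "prob_space M"
    and "prob_space.indep_var M borel X borel Y"
    and "measure M {\<omega> \<in> space M. Y \<omega> \<le> X \<omega>} > 0"
    and "prob_space P"
    and "prob_space.indep_vars P (\<lambda>_. borel \<Otimes>\<^sub>M borel) (\<lambda>i \<omega>. (Xo i \<omega>, Yo i \<omega>)) UNIV"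
    and "\<And>i x y. measure P {\<omega> \<in> space P. Xo i \<omega> \<le> x \<and> Yo i \<omega> \<le> y} = H_star M X Y x y"
    and "\<phi> \<in> borel_measurable borel"
    and "left_endpoint G \<le> left_endpoint F"
    and "\<And>a. ereal a = left_endpoint F \<Longrightarrow> jump F a = 0"
    and "continuous_on UNIV F"
    and "(\<integral>\<^sup>+x. ennreal ((\<phi> x)\<^sup>2) / ennreal (G x) \<partial>dF) < \<infinity>"
    and "(\<integral>\<^sup>+x. 1 / ennreal (G x) \<partial>dF) < \<infinity>"
  shows "integrable dF \<phi>
    \<and> (\<forall>y. set_integrable (F_star M X Y) {y<..} (\<lambda>x. \<phi> x * (1 - F x) / C_fun M X Y x)
         \<and> psi M X Y \<phi> y = (LINT x:{y<..}|dF. \<phi> y - \<phi> x))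
    \<and> (AE \<omega> in observed M X Y.
         set_integrable (F_star M X Y) {Y \<omega>..X \<omega>} (\<lambda>y. psi M X Y \<phi> y / (C_fun M X Y y)\<^sup>2))
    \<and> integrable (observed M X Y) (influence M X Y \<phi>)
    \<and> integrable (observed M X Y) (\<lambda>\<omega>. (influence M X Y \<phi> \<omega>)\<^sup>2)
    \<and> weak_conv_m
        (\<lambda>n. distr P borel (\<lambda>\<omega>.
           sqrt (real n) * (lynden_bell_integral \<phi> n (\<lambda>i. Xo i \<omega>) (\<lambda>i. Yo i \<omega>) - (LINT x|dF. \<phi> x))))
        (centred_normal (prob_space.variance (observed M X Y) (influence M X Y \<phi>)))"
proof -
  interpret M: prob_space M by fact
  note indep = \<open>M.indep_var borel X borel Y\<close>
  have X[measurable]: "X \<in> borel_measurable M" and Y[measurable]: "Y \<in> borel_measurable M"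
    using M.indep_var_rv1[OF indep] M.indep_var_rv2[OF indep] by auto
  let ?\<mu> = "distr M borel X" and ?\<nu> = "distr M borel Y"
  interpret \<mu>: real_distribution ?\<mu> by (rule M.real_distribution_distr) (rule X)
  interpret \<nu>: real_distribution ?\<nu> by (rule M.real_distribution_distr) (rule Y)
  have joint: "distr M (borel \<Otimes>\<^sub>M borel) (\<lambda>\<omega>. (X \<omega>, Y \<omega>)) = ?\<mu> \<Otimes>\<^sub>M ?\<nu>"
    using indep M.indep_var_distribution_eq by metis
  have XY[measurable]: "(\<lambda>\<omega>. (X \<omega>, Y \<omega>)) \<in> M \<rightarrow>\<^sub>M borel \<Otimes>\<^sub>M borel" by measurable
  have \<alpha>: "measure (?\<mu> \<Otimes>\<^sub>M ?\<nu>) {p. snd p \<le> fst p} = measure M {\<omega> \<in> space M. Y \<omega> \<le> X \<omega>}"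
    unfolding joint[symmetric] by (subst measure_distr[OF XY observable_set]) (auto intro!: arg_cong[where f = "measure M"])
  have cont: "measure ?\<mu> {x} = 0" for x
    using \<open>continuous_on UNIV F\<close> \<mu>.isCont_cdf[of x] by (simp add: F_def continuous_on_eq_continuous_at)
  interpret L: truncated_integrand ?\<mu> ?\<nu> \<phi>
  proof (intro truncated_integrand.intro truncated_integrand_axioms.intro)
    show tr: "left_truncation ?\<mu> ?\<nu>"
      by (intro left_truncation.intro left_truncation_axioms.intro \<mu>.real_distribution_axioms \<nu>.real_distribution_axioms cont)
         (use \<alpha> \<open>measure M {\<omega> \<in> space M. Y \<omega> \<le> X \<omega>} > 0\<close> in simp)
    show "\<phi> \<in> borel_measurable borel" by fact
    show "(\<integral>\<^sup>+x. ennreal ((\<phi> x)\<^sup>2) / ennreal (left_truncation.G ?\<nu> x) \<partial>?\<mu>) < \<infinity>"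
      "(\<integral>\<^sup>+x. 1 / ennreal (left_truncation.G ?\<nu> x) \<partial>?\<mu>) < \<infinity>"
      using assms(14,15) unfolding left_truncation.G_def[OF tr] G_def dF_def by auto
  qed
  have F: "F x = 1 - L.S x" for x by (simp add: F_def L.S_conv)
  let ?O = "observed M X Y"
  have law: "distr ?O (borel \<Otimes>\<^sub>M borel) (\<lambda>\<omega>. (X \<omega>, Y \<omega>)) = L.H"
  proof -
    let ?A = "{\<omega> \<in> space M. Y \<omega> \<le> X \<omega>}"
    let ?f = "\<lambda>p. ennreal (indicator {p. snd p \<le> fst p} p / L.\<alpha>)"
    \<comment> \<open>Conditioning on \<open>Y \<le> X\<close> is a change of density, which commutes with taking the joint law.\<close>
    have "L.H = density (distr M (borel \<Otimes>\<^sub>M borel) (\<lambda>\<omega>. (X \<omega>, Y \<omega>))) ?f"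
      unfolding L.H_def joint ..
    also have "\<dots> = distr (density M (\<lambda>\<omega>. ?f (X \<omega>, Y \<omega>))) (borel \<Otimes>\<^sub>M borel) (\<lambda>\<omega>. (X \<omega>, Y \<omega>))"
      by (rule density_distr) measurable
    also have "density M (\<lambda>\<omega>. ?f (X \<omega>, Y \<omega>)) = ?O"
      unfolding observed_def uniform_measure_def
    proof (rule density_cong)
      have a: "L.\<alpha> = measure M ?A" unfolding L.\<alpha>_def by (rule \<alpha>)
      show "AE \<omega> in M. ?f (X \<omega>, Y \<omega>) = indicator ?A \<omega> / emeasure M ?A"
      proof (rule AE_I2)
        fix \<omega> assume "\<omega> \<in> space M"
        then show "?f (X \<omega>, Y \<omega>) = indicator ?A \<omega> / emeasure M ?A"
          using divide_ennreal[of 1 "L.\<alpha>"] L.\<alpha>_pos by (auto simp: M.emeasure_eq_measure a split: split_indicator)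
      qed
    qed measurable
    finally show ?thesis by simp
  qed
  have sets_O[measurable_cong]: "sets ?O = sets M" by (simp add: observed_def)
  have space_O: "space ?O = space M" by (simp add: observed_def)
  have XYO[measurable]: "(\<lambda>\<omega>. (X \<omega>, Y \<omega>)) \<in> ?O \<rightarrow>\<^sub>M borel \<Otimes>\<^sub>M borel" by measurable
  have Fs: "F_star M X Y = distr L.H borel fst"
    unfolding F_star_def law[symmetric] by (subst distr_distr) (auto simp: comp_def)
  have rect: "measure ?O {\<omega> \<in> space M. (X \<omega>, Y \<omega>) \<in> E} = measure L.H E" if "E \<in> sets (borel \<Otimes>\<^sub>M borel)" for E
    unfolding law[symmetric] by (subst measure_distr[OF XYO that]) (auto simp: space_O intro!: arg_cong[where f = "measure ?O"])
  have C: "C_fun M X Y z = L.C z" for z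
  proof -
    have "{q::real \<times> real. snd q \<le> z \<and> z \<le> fst q} = {z..} \<times> {..z}" by auto
    then have "{q::real \<times> real. snd q \<le> z \<and> z \<le> fst q} \<in> sets (borel \<Otimes>\<^sub>M borel)" by simp
    from rect[OF this] show ?thesis unfolding C_fun_def L.C_eq_prob[symmetric] by simp
  qed
  have psi: "psi M X Y \<phi> y = L.\<psi> y" for y
    unfolding psi_def Fs C F_def[symmetric] F set_lebesgue_integral_def
    using L.psi_integral(2)[of y] by (simp add: L.\<Psi>_def)
  have infl: "influence M X Y \<phi> \<omega> = L.infl (X \<omega>, Y \<omega>)" for \<omega>
    unfolding influence_def L.infl_alt Fs C psi set_lebesgue_integral_def by simp
  have inflf: "influence M X Y \<phi> = (\<lambda>\<omega>. L.infl (X \<omega>, Y \<omega>))" by (rule ext) (rule infl)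
  have lawP: "distr P (borel \<Otimes>\<^sub>M borel) (\<lambda>\<omega>. (Xo i \<omega>, Yo i \<omega>)) = L.H" for i
  proof -
    interpret P: prob_space P by fact
    have pair[measurable]: "(\<lambda>\<omega>. (Xo i \<omega>, Yo i \<omega>)) \<in> P \<rightarrow>\<^sub>M borel \<Otimes>\<^sub>M borel"
      using assms(8) by (auto simp: P.indep_vars_def)
    interpret Q: prob_space "distr P (borel \<Otimes>\<^sub>M borel) (\<lambda>\<omega>. (Xo i \<omega>, Yo i \<omega>))"
      by (rule P.prob_space_distr) (rule pair)
    show ?thesis
    proof (rule measure_eqI_quadrants)
      show "finite_measure (distr P (borel \<Otimes>\<^sub>M borel) (\<lambda>\<omega>. (Xo i \<omega>, Yo i \<omega>)))" by (rule Q.finite_measure_axioms)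
      show "sets L.H = sets (borel \<Otimes>\<^sub>M borel)" by (rule L.sets_H)
      fix x y :: real
      have "measure (distr P (borel \<Otimes>\<^sub>M borel) (\<lambda>\<omega>. (Xo i \<omega>, Yo i \<omega>))) ({..x} \<times> {..y})
          = measure P {\<omega> \<in> space P. Xo i \<omega> \<le> x \<and> Yo i \<omega> \<le> y}"
        by (subst measure_distr[OF pair]) (auto intro!: arg_cong[where f = "measure P"])
      also have "\<dots> = H_star M X Y x y" by (rule assms(9))
      also have "\<dots> = measure L.H ({..x} \<times> {..y})"
        unfolding H_star_def using rect[of "{..x} \<times> {..y}"] by simp
      finally show "emeasure (distr P (borel \<Otimes>\<^sub>M borel) (\<lambda>\<omega>. (Xo i \<omega>, Yo i \<omega>))) ({..x} \<times> {..y}) = emeasure L.H ({..x} \<times> {..y})"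
        by (simp only: Q.emeasure_eq_measure L.H.emeasure_eq_measure)
    qed simp
  qed
  have tr: "integrable ?O (\<lambda>\<omega>. f (X \<omega>, Y \<omega>)) \<longleftrightarrow> integrable L.H f" "(\<integral>\<omega>. f (X \<omega>, Y \<omega>) \<partial>?O) = (\<integral>p. f p \<partial>L.H)"
    if "f \<in> borel_measurable (borel \<Otimes>\<^sub>M borel)" for f :: "real \<times> real \<Rightarrow> real"
    unfolding law[symmetric]
    by (rule integrable_distr_eq[symmetric, OF XYO that], rule integral_distr[symmetric, OF XYO that])
  have m2: "(\<lambda>p. (L.infl p)\<^sup>2) \<in> borel_measurable (borel \<Otimes>\<^sub>M borel)" by measurable
  have var: "prob_space.variance ?O (influence M X Y \<phi>) = (\<integral>p. (L.infl p)\<^sup>2 \<partial>L.H)"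
    using tr(2)[OF L.measurable_infl] tr(2)[OF m2] by (simp add: inflf L.infl_moments)
  have "integrable dF \<phi>" unfolding dF_def by (rule L.integrable_\<phi>)
  moreover have "set_integrable (F_star M X Y) {y<..} (\<lambda>x. \<phi> x * (1 - F x) / C_fun M X Y x)" for y
    unfolding set_integrable_def Fs C F using L.psi_integral(1)[of y] by simp
  moreover have "psi M X Y \<phi> y = (LINT x:{y<..}|dF. \<phi> y - \<phi> x)" for y
    unfolding psi dF_def by (rule L.\<psi>_differences)
  moreover have "AE \<omega> in ?O. set_integrable (F_star M X Y) {Y \<omega>..X \<omega>} (\<lambda>y. psi M X Y \<phi> y / (C_fun M X Y y)\<^sup>2)"
  proof -
    have "AE p in distr ?O (borel \<Otimes>\<^sub>M borel) (\<lambda>\<omega>. (X \<omega>, Y \<omega>)).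
        integrable (distr L.H borel fst) (\<lambda>u. indicator {snd p..fst p} u * (L.\<psi> u / (L.C u)\<^sup>2))"
      unfolding law by (rule L.AE_infl_integrable)
    from AE_distrD[OF XYO this] show ?thesis
      unfolding set_integrable_def Fs C psi by simp
  qed
  moreover have "integrable ?O (influence M X Y \<phi>)"
    using tr(1)[OF L.measurable_infl] L.infl_moments(1) by (simp add: inflf)
  moreover have "integrable ?O (\<lambda>\<omega>. (influence M X Y \<phi> \<omega>)\<^sup>2)"
    using tr(1)[OF m2] L.infl_moments(3) by (simp add: infl)
  moreover have "weak_conv_m
        (\<lambda>n. distr P borel (\<lambda>\<omega>.
           sqrt (real n) * (lynden_bell_integral \<phi> n (\<lambda>i. Xo i \<omega>) (\<lambda>i. Yo i \<omega>) - (LINT x|dF. \<phi> x))))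
        (centred_normal (prob_space.variance ?O (influence M X Y \<phi>)))"
    unfolding var dF_def by (rule L.clt_lynden_bell[OF assms(7,8) lawP])
  ultimately show ?thesis by blast
qed

end
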